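(* Consider the Newtonian $N$-body problem in a Euclidean space $E$ with $\dim E\ge2$ and masses $m_1,\dots,m_N>0$, and let $h>0$. Given $u\in\mathcal{B}_h$ and $r>0$, for each $x\in E^N$ there are some $y\in E^N$ with $\|y-x\|=r$ and a curve $\gamma_x\in\mathcal{C}(y,x)$ such that $u(x)-u(y)=\mathcal{A}_{L+h}(\gamma_x)$. In particular, every function $u\in\mathcal{B}_h$ is a global viscosity solution (on $E^N$) of the Hamilton-Jacobi equation $H(x,d_xu)=h$.
   Context: $E$ is a finite-dimensional Euclidean space, $N\ge 2$, $m_1,\dots,m_N>0$. For $x=(r_1,\dots,r_N),\,y=(s_1,\dots,s_N)\in E^N$ the mass inner product is $\langle x,y\rangle=\sum_i m_i\langle r_i,s_i\rangle_E$, with norm $\|\cdot\|$ (and dual norm on $(E^N)^*$: $\|p\|^2=\sum_i m_i^{-1}\|p_i\|^2$). $U(x)=\sum_{i<j}m_im_j\|r_i-r_j\|_E^{-1}\in(0,+\infty]$. Hamiltonian: $H(x,p)=\frac12\|p\|^2-U(x)$, equal to $-\infty$ if $x$ has collisions. Lagrangian: $L(x,v)=\frac12\|v\|^2+U(x)$. $\mathcal{C}(x,y)$ is the set of absolutely continuous curves $\gamma:[a,b]\to E^N$ ($a<b$ arbitrary) with $\gamma(a)=x$, $\gamma(b)=y$; $\mathcal{A}_{L+h}(\gamma)=\int_a^b (L(\gamma,\dot\gamma)+h)\,dt$; $\phi_h(x,y)=\inf\{\mathcal{A}_{L+h}(\gamma):\gamma\in\mathcal{C}(x,y)\}$. $\mathcal{B}_h$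 (the ideal boundary of level $h$, whose elements are called horofunctions) is the set of $u\in C^0(E^N)$ for which there is a sequence $p_n\in E^N$ with $\|p_n\|\to+\infty$ and $u(x)=\lim_{n\to\infty}\big(\phi_h(x,p_n)-\phi_h(0,p_n)\big)$ for all $x\in E^N$. A continuous $u:E^N\to\mathbb{R}$ is a viscosity subsolution (resp. supersolution) of $H(x,d_xu)=h$ if for every $\psi\in C^1(E^N)$ and every $x_0$ at which $u-\psi$ has a local maximum (resp. minimum) one has $H(x_0,d_{x_0}\psi)\le h$ (resp. $\ge h$); it is a viscosity solution if it is both. *)

theory Defs
  imports "HOL-Analysis.Analysis"
begin

text \<open>
  Configurations in \<open>E\<^sup>N\<close> are vectors \<open>x :: 'a ^ 'n\<close>, with \<open>E = 'a\<close> and \<open>N = CARD('n)\<close>; the linear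
  order on \<open>'n\<close> serves only to write \<open>i < j\<close>. The norm of the library on \<open>'a ^ 'n\<close> ignores the
  masses, so the mass norm is defined separately.
\<close>

type_synonym ('a, 'n) config = "('a, 'n) vec"

definition mass_inner :: "('n::finite \<Rightarrow> real) \<Rightarrow> ('a::euclidean_space, 'n) config \<Rightarrow> ('a, 'n) config \<Rightarrow> real" where
  "mass_inner m x y = (\<Sum>i\<in>UNIV. m i * (x $ i \<bullet> y $ i))"

definition mass_norm :: "('n::finite \<Rightarrow> real) \<Rightarrow> ('a::euclidean_space, 'n) config \<Rightarrow> real" where
  "mass_norm m x = sqrt (mass_inner m x x)"

text \<open>The \<open>i\<close>-th component of a covector \<open>p\<close> is its restriction to the \<open>i\<close>-th factor of \<open>E\<^sup>N\<close>.\<close>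

definition dual_mass_norm :: "('n::finite \<Rightarrow> real) \<Rightarrow> (('a::euclidean_space, 'n) config \<Rightarrow>\<^sub>L real) \<Rightarrow> real" where
  "dual_mass_norm m p =
     sqrt (\<Sum>i\<in>UNIV. inverse (m i) * (onorm (\<lambda>v. blinfun_apply p (axis i v)))\<^sup>2)"

text \<open>In \<open>ereal\<close>, \<open>c / 0 = \<infinity>\<close> for \<open>c > 0\<close>, so the potential is \<open>\<infinity>\<close> exactly at collisions.\<close>

definition newton_potential ::
    "('n::{finite,linorder} \<Rightarrow> real) \<Rightarrow> ('a::euclidean_space, 'n) config \<Rightarrow> ereal" where
  "newton_potential m x =
     (\<Sum>(i, j)\<in>{(i, j). i < j}. ereal (m i * m j) / ereal (norm (x $ i - x $ j)))"

definition hamiltonian ::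
    "('n::{finite,linorder} \<Rightarrow> real) \<Rightarrow> ('a::euclidean_space, 'n) config \<Rightarrow> (('a, 'n) config \<Rightarrow>\<^sub>L real) \<Rightarrow> ereal" where
  "hamiltonian m x p = ereal ((dual_mass_norm m p)\<^sup>2 / 2) - newton_potential m x"

definition lagrangian ::
    "('n::{finite,linorder} \<Rightarrow> real) \<Rightarrow> ('a::euclidean_space, 'n) config \<Rightarrow> ('a, 'n) config \<Rightarrow> ereal" where
  "lagrangian m x v = ereal ((mass_norm m v)\<^sup>2 / 2) + newton_potential m x"

definition abs_continuous_on_interval :: "real \<Rightarrow> real \<Rightarrow> (real \<Rightarrow> 'b::metric_space) \<Rightarrow> bool" where
  "abs_continuous_on_interval a b \<gamma> \<longleftrightarrow>
     (\<forall>\<epsilon>>0. \<exists>\<delta>>0. \<forall>(n::nat) s t.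
        (\<forall>k<n. a \<le> s k \<and> s k < t k \<and> t k \<le> b) \<longrightarrow>
        disjoint_family_on (\<lambda>k. {s k<..<t k}) {..<n} \<longrightarrow>
        (\<Sum>k<n. t k - s k) < \<delta> \<longrightarrow>
        (\<Sum>k<n. dist (\<gamma> (s k)) (\<gamma> (t k))) < \<epsilon>)"

text \<open>A curve defined on \<open>[a, b]\<close> is a triple \<open>(a, b, \<gamma>)\<close>; values of \<open>\<gamma>\<close> outside \<open>[a, b]\<close> are irrelevant.
  Absolute continuity is meant for the library metric, which is equivalent to that of the mass
  norm.\<close>

definition curves ::
    "('a::euclidean_space, 'n::finite) config \<Rightarrow> ('a, 'n) config \<Rightarrow> (real \<times> real \<times> (real \<Rightarrow> ('a, 'n) config)) set" where
  "curves x y = {(a, b, \<gamma>). a < b \<and> abs_continuous_on_interval a b \<gamma> \<and> \<gamma> a = x \<and> \<gamma> b = y}"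

text \<open>The action is used for \<open>h \<ge> 0\<close> only: then the integrand is nonnegative and \<open>e2ennreal\<close> loses
  nothing. An absolutely continuous curve is differentiable almost everywhere, so the value of
  \<open>vector_derivative\<close> at the remaining points does not matter.\<close>

definition action ::
    "('n::{finite,linorder} \<Rightarrow> real) \<Rightarrow> real \<Rightarrow> real \<times> real \<times> (real \<Rightarrow> ('a::euclidean_space, 'n) config) \<Rightarrow> ereal" where
  "action m h = (\<lambda>(a, b, \<gamma>). enn2ereal
     (\<integral>\<^sup>+t\<in>{a..b}. e2ennreal
        (lagrangian m (\<gamma> t) (vector_derivative \<gamma> (at t within {a..b})) + ereal h) \<partial>lebesgue))"

definition action_potential ::
    "('n::{finite,linorder} \<Rightarrow> real) \<Rightarrow> real \<Rightarrow> ('a::euclidean_space, 'n) config \<Rightarrow> ('a, 'n) config \<Rightarrow> ereal" where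
  "action_potential m h x y = (INF \<gamma>\<in>curves x y. action m h \<gamma>)"

text \<open>The limit is taken in \<open>ereal\<close>, so that no finiteness of the action potential is built in.\<close>

definition ideal_boundary ::
    "('n::{finite,linorder} \<Rightarrow> real) \<Rightarrow> real \<Rightarrow> (('a::euclidean_space, 'n) config \<Rightarrow> real) set" where
  "ideal_boundary m h = {u. continuous_on UNIV u \<and>
     (\<exists>p :: nat \<Rightarrow> ('a, 'n) config.
        filterlim (\<lambda>n. mass_norm m (p n)) at_top sequentially \<and>
        (\<forall>x. (\<lambda>n. action_potential m h x (p n) - action_potential m h 0 (p n))
                \<longlonglongrightarrow> ereal (u x)))}"

definition C1_with_differential ::
    "('b::real_normed_vector \<Rightarrow> real) \<Rightarrow> ('b \<Rightarrow> 'b \<Rightarrow>\<^sub>L real) \<Rightarrow> bool" where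
  "C1_with_differential \<psi> d\<psi> \<longleftrightarrow>
     (\<forall>x. (\<psi> has_derivative blinfun_apply (d\<psi> x)) (at x)) \<and> continuous_on UNIV d\<psi>"

definition viscosity_subsolution ::
    "('n::{finite,linorder} \<Rightarrow> real) \<Rightarrow> real \<Rightarrow> (('a::euclidean_space, 'n) config \<Rightarrow> real) \<Rightarrow> bool" where
  "viscosity_subsolution m h u \<longleftrightarrow> continuous_on UNIV u \<and>
     (\<forall>\<psi> d\<psi> x\<^sub>0. C1_with_differential \<psi> d\<psi> \<longrightarrow>
        (\<forall>\<^sub>F x in nhds x\<^sub>0. u x - \<psi> x \<le> u x\<^sub>0 - \<psi> x\<^sub>0) \<longrightarrow>
        hamiltonian m x\<^sub>0 (d\<psi> x\<^sub>0) \<le> ereal h)"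

definition viscosity_supersolution ::
    "('n::{finite,linorder} \<Rightarrow> real) \<Rightarrow> real \<Rightarrow> (('a::euclidean_space, 'n) config \<Rightarrow> real) \<Rightarrow> bool" where
  "viscosity_supersolution m h u \<longleftrightarrow> continuous_on UNIV u \<and>
     (\<forall>\<psi> d\<psi> x\<^sub>0. C1_with_differential \<psi> d\<psi> \<longrightarrow>
        (\<forall>\<^sub>F x in nhds x\<^sub>0. u x - \<psi> x \<ge> u x\<^sub>0 - \<psi> x\<^sub>0) \<longrightarrow>
        hamiltonian m x\<^sub>0 (d\<psi> x\<^sub>0) \<ge> ereal h)"

definition viscosity_solution ::
    "('n::{finite,linorder} \<Rightarrow> real) \<Rightarrow> real \<Rightarrow> (('a::euclidean_space, 'n) config \<Rightarrow> real) \<Rightarrow> bool" where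
  "viscosity_solution m h u \<longleftrightarrow> viscosity_subsolution m h u \<and> viscosity_supersolution m h u"

end

theory Submission
  imports Defs "HOL-Complex_Analysis.Great_Picard"
begin

text \<open>
  Let \<open>\<phi> = \<phi>\<^sub>h\<close> be the action potential and \<open>u = lim (\<phi>(\<cdot>, p\<^sub>n) - \<phi>(0, p\<^sub>n))\<close>. Because \<open>\<phi>\<close> is symmetric and
  satisfies the triangle inequality, \<open>u\<close> is dominated: \<open>u x - u y \<le> \<phi>(x, y)\<close>.

  For the calibrated curves, take curves from \<open>x\<close> to \<open>p\<^sub>n\<close> whose action exceeds \<open>\<phi>(x, p\<^sub>n)\<close> by little, and
  cut them at the first exit \<open>y\<^sub>n\<close> from the ball of radius \<open>r\<close>. A subsequence of \<open>y\<^sub>n\<close> converges to some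
  \<open>z\<close>, the actions of the pieces are asymptotically at most \<open>u x - u z\<close>, and Tonelli's direct method gives
  a limit curve from \<open>x\<close> to \<open>z\<close> whose action is at most \<open>u x - u z\<close>. Domination shows that it is equal,
  and reversing time gives the required curve (lemma \<open>calibrated_curve\<close>). Three ingredients carry this
  argument.

  First, curves are merely absolutely continuous, and the action refers to their derivative. They are
  differentiable almost everywhere (\<open>ac_differentiable_ae\<close>, from Vitali's covering theorem) and satisfy
  the fundamental theorem of calculus (\<open>ac_has_integral_derivative\<close>), so that the energy controls
  displacements (\<open>displacement_le_energy\<close>).

  Second, \<open>\<phi>(y\<^sub>n, z) \<longlonglongrightarrow> 0\<close> even if \<open>z\<close> is a collision (\<open>phi_small\<close>). Order the bodies by one coordinate. Two
  configurations with the same order can be pulled apart in a common direction at a speed that makes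
  the action small, and joined by a segment between well separated configurations; only finitely many
  orders exist.

  Third, the action is lower semicontinuous (\<open>action_limit_curve\<close>): polygon energies converge pointwise
  and determine the kinetic energy, and Fatou's lemma handles the potential, which is continuous with
  values in \<open>[0, \<infinity>]\<close>.

  Domination along short segments makes \<open>u\<close> a viscosity subsolution. For the supersolution property,
  let \<open>u - \<psi>\<close> have a local minimum at \<open>x\<^sub>0\<close>. A calibrated curve of small radius \<open>\<rho>\<close> has action at least
  \<open>\<surd>(2 b) \<rho>\<close> for every \<open>b < U(x\<^sub>0) + h\<close>, by the inequality between the arithmetic and the geometric mean,
  so \<open>\<psi>\<close> has slope at least \<open>\<surd>(2 b)\<close> at \<open>x\<^sub>0\<close>. In particular there is no such \<open>\<psi>\<close> at a collision.
\<close>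

section \<open>Almost everywhere differentiability of absolutely continuous functions\<close>

text \<open>Degenerate and touching intervals are admitted, so that the intervals of a division and the
  intersections of a family with a fixed interval are again such families.\<close>

definition interval_family :: "real \<Rightarrow> real \<Rightarrow> 'i set \<Rightarrow> ('i \<Rightarrow> real) \<Rightarrow> ('i \<Rightarrow> real) \<Rightarrow> bool" where
  "interval_family a b I s t \<longleftrightarrow> finite I \<and> (\<forall>k\<in>I. a \<le> s k \<and> s k \<le> t k \<and> t k \<le> b) \<and>
     disjoint_family_on (\<lambda>k. {s k<..<t k}) I"

lemma interval_familyD:
  assumes "interval_family a b I s t"
  shows "finite I" "\<And>k. k \<in> I \<Longrightarrow> a \<le> s k \<and> s k \<le> t k \<and> t k \<le> b"
    "disjoint_family_on (\<lambda>k. {s k<..<t k}) I"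
  using assms by (auto simp: interval_family_def)

lemma interval_family_subset: "interval_family a b I s t \<Longrightarrow> J \<subseteq> I \<Longrightarrow> interval_family a b J s t"
  unfolding interval_family_def using disjoint_family_on_mono by (blast intro: finite_subset)

text \<open>The definition speaks of nondegenerate intervals numbered by an initial segment of the naturals.
  Degenerate intervals do no harm, and any finite index set can be numbered; divisions and tagged
  divisions are such index sets below.\<close>

lemma ac_small_variation:
  fixes \<gamma> :: "real \<Rightarrow> 'b::metric_space"
  assumes ac: "abs_continuous_on_interval a b \<gamma>" and "\<epsilon> > 0"
  shows "\<exists>\<delta>>0. \<forall>(I :: 'i set) s t. interval_family a b I s t \<longrightarrow> (\<Sum>k\<in>I. t k - s k) < \<delta> \<longrightarrow>
     (\<Sum>k\<in>I. dist (\<gamma> (s k)) (\<gamma> (t k))) < \<epsilon>"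
proof -
  have "\<exists>\<delta>>0. \<forall>(n::nat) s t. (\<forall>k<n. a \<le> s k \<and> s k < t k \<and> t k \<le> b) \<longrightarrow>
        disjoint_family_on (\<lambda>k. {s k<..<t k}) {..<n} \<longrightarrow> (\<Sum>k<n. t k - s k) < \<delta> \<longrightarrow>
        (\<Sum>k<n. dist (\<gamma> (s k)) (\<gamma> (t k))) < \<epsilon>"
    using ac \<open>\<epsilon> > 0\<close> unfolding abs_continuous_on_interval_def by simp
  then obtain \<delta> where \<delta>: "\<delta> > 0" and D: "\<forall>(n::nat) s t. (\<forall>k<n. a \<le> s k \<and> s k < t k \<and> t k \<le> b) \<longrightarrow>
        disjoint_family_on (\<lambda>k. {s k<..<t k}) {..<n} \<longrightarrow> (\<Sum>k<n. t k - s k) < \<delta> \<longrightarrow>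
        (\<Sum>k<n. dist (\<gamma> (s k)) (\<gamma> (t k))) < \<epsilon>"
    by (elim exE conjE)
  show ?thesis
  proof (intro exI[of _ \<delta>] conjI allI impI \<delta>)
    fix I :: "'i set" and s t
    assume fam: "interval_family a b I s t" and sm: "(\<Sum>k\<in>I. t k - s k) < \<delta>"
    note fin = interval_familyD(1)[OF fam] and I = interval_familyD(2)[OF fam] and dis = interval_familyD(3)[OF fam]
    define I' where "I' = {k \<in> I. s k < t k}"
    have fin': "finite I'" "I' \<subseteq> I" using fin by (auto simp: I'_def)
    have eq0: "s k = t k" if "k \<in> I - I'" for k using that I[of k] by (auto simp: I'_def)
    obtain e where e: "bij_betw e {..<card I'} I'"
      using ex_bij_betw_nat_finite[OF fin'(1)] by (auto simp: atLeast0LessThan)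
    have "(\<Sum>k\<in>I. t k - s k) = (\<Sum>k\<in>I'. t k - s k)"
      using fin fin' eq0 by (intro sum.mono_neutral_right) auto
    also have "\<dots> = (\<Sum>k<card I'. t (e k) - s (e k))"
      by (rule sum.reindex_bij_betw[OF e, symmetric])
    finally have sm': "(\<Sum>k<card I'. t (e k) - s (e k)) < \<delta>" using sm by simp
    have eI: "e k \<in> I'" if "k < card I'" for k using e that by (auto simp: bij_betw_def)
    have "(\<Sum>k\<in>I. dist (\<gamma> (s k)) (\<gamma> (t k))) = (\<Sum>k\<in>I'. dist (\<gamma> (s k)) (\<gamma> (t k)))"
      using fin fin' eq0 by (intro sum.mono_neutral_right) auto
    also have "\<dots> = (\<Sum>k<card I'. dist (\<gamma> (s (e k))) (\<gamma> (t (e k))))"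
      by (rule sum.reindex_bij_betw[OF e, symmetric])
    also have "\<dots> < \<epsilon>"
    proof (rule D[rule_format, OF _ _ sm'])
      show "a \<le> s (e k) \<and> s (e k) < t (e k) \<and> t (e k) \<le> b" if "k < card I'" for k
        using eI[OF that] I by (auto simp: I'_def)
      have inj: "inj_on e {..<card I'}" using e by (auto simp: bij_betw_def)
      show "disjoint_family_on (\<lambda>k. {s (e k)<..<t (e k)}) {..<card I'}"
        unfolding disjoint_family_on_def
      proof (intro ballI impI)
        fix k l assume "k \<in> {..<card I'}" "l \<in> {..<card I'}" "k \<noteq> l"
        then have "e k \<noteq> e l" "e k \<in> I" "e l \<in> I"
          using inj eI fin' by (auto simp: inj_on_def)
        then show "{s (e k)<..<t (e k)} \<inter> {s (e l)<..<t (e l)} = {}"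
          using dis unfolding disjoint_family_on_def by blast
      qed
    qed
    finally show "(\<Sum>k\<in>I. dist (\<gamma> (s k)) (\<gamma> (t k))) < \<epsilon>" .
  qed
qed

lemma ac_imp_continuous_on:
  fixes \<gamma> :: "real \<Rightarrow> 'b::metric_space"
  assumes ac: "abs_continuous_on_interval a b \<gamma>"
  shows "continuous_on {a..b} \<gamma>"
  unfolding continuous_on_iff
proof (intro ballI allI impI)
  fix x e :: real assume x: "x \<in> {a..b}" and e: "0 < e"
  obtain \<delta> where \<delta>: "\<delta> > 0" and D: "\<forall>(I :: nat set) s t. interval_family a b I s t \<longrightarrow>
       (\<Sum>k\<in>I. t k - s k) < \<delta> \<longrightarrow> (\<Sum>k\<in>I. dist (\<gamma> (s k)) (\<gamma> (t k))) < e"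
    using ac_small_variation[OF ac e, where 'i = nat] by (elim exE conjE)
  have "dist (\<gamma> x') (\<gamma> x) < e" if "x' \<in> {a..b}" "dist x' x < \<delta>" for x'
    using D[rule_format, of "{0}" "\<lambda>_. min x x'" "\<lambda>_. max x x'"] that x
    by (cases "x \<le> x'") (auto simp: min_def max_def dist_real_def dist_commute interval_family_def disjoint_family_on_def abs_if split: if_splits)
  then show "\<exists>d>0. \<forall>x'\<in>{a..b}. dist x' x < d \<longrightarrow> dist (\<gamma> x') (\<gamma> x) < e" using \<delta> by blast
qed

text \<open>The gaps of a finite disjoint family of intervals form such a family again. Since the
  increments of every function \<open>g\<close> add up, the choice \<open>g = id\<close> measures the gaps, and the choice of
  an absolutely continuous \<open>g\<close> then shows that its increment over the gaps is small.\<close>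

lemma complementary_intervals:
  fixes J :: "(real \<times> real) set"
  assumes "interval_family a b J fst snd" "\<forall>i\<in>J. fst i < snd i" and "a \<le> b"
  shows "\<exists>R. interval_family a b (J \<union> R) fst snd \<and> (\<forall>i\<in>R. fst i < snd i) \<and> J \<inter> R = {} \<and>
     (\<forall>g::real \<Rightarrow> real. g b - g a = (\<Sum>i\<in>J. g (snd i) - g (fst i)) + (\<Sum>i\<in>R. g (snd i) - g (fst i)))"
  using assms
proof (induction "card J" arbitrary: J b)
  case 0
  then have J: "J = {}" by (auto simp: interval_family_def)
  show ?case using J \<open>a \<le> b\<close>
    by (intro exI[of _ "if a < b then {(a, b)} else {}"]) (auto simp: interval_family_def disjoint_family_on_def)
next
  case (Suc n)
  note fam = interval_familyD[OF Suc.prems(1)]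
  have "J \<noteq> {}" using Suc.hyps(2) by auto
  then have "Max (snd ` J) \<in> snd ` J" using fam(1) by (intro Max_in) auto
  then obtain k where k0: "k \<in> J" "Max (snd ` J) = snd k" by auto
  have k: "k \<in> J" "\<And>i. i \<in> J \<Longrightarrow> snd i \<le> snd k"
    using k0(1) fam(1) by (auto simp: k0(2)[symmetric] intro!: Max_ge)
  define J' where "J' = J - {k}"
  have J: "J = insert k J'" "k \<notin> J'" using k by (auto simp: J'_def)
  have kk: "a \<le> fst k" "fst k < snd k" "snd k \<le> b" using fam(2) Suc.prems(2) k by auto
  have below: "snd i \<le> fst k" if "i \<in> J'" for i
  proof (rule ccontr)
    assume "\<not> snd i \<le> fst k"
    moreover have i: "i \<in> J" "i \<noteq> k" "fst i < snd i" "snd i \<le> snd k" using that k Suc.prems(2) by (auto simp: J'_def)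
    ultimately have "max (fst i) (fst k) < snd i" using kk by auto
    then obtain x where "max (fst i) (fst k) < x" "x < snd i" using dense by blast
    then have "x \<in> {fst i<..<snd i} \<inter> {fst k<..<snd k}" using i by auto
    then show False using disjoint_family_onD[OF fam(3) i(1) k(1) i(2)] by blast
  qed
  have "\<exists>R. interval_family a (fst k) (J' \<union> R) fst snd \<and> (\<forall>i\<in>R. fst i < snd i) \<and> J' \<inter> R = {} \<and>
     (\<forall>g::real \<Rightarrow> real. g (fst k) - g a = (\<Sum>i\<in>J'. g (snd i) - g (fst i)) + (\<Sum>i\<in>R. g (snd i) - g (fst i)))"
  proof (rule Suc.hyps(1)[OF _ _ _ kk(1)])
    show "n = card J'" using Suc.hyps(2) fam(1) k by (simp add: J'_def)
    show "interval_family a (fst k) J' fst snd"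
      using interval_family_subset[OF Suc.prems(1), of J'] below by (auto simp: interval_family_def J'_def)
    show "\<forall>i\<in>J'. fst i < snd i" using Suc.prems(2) by (auto simp: J'_def)
  qed
  then obtain R where R: "interval_family a (fst k) (J' \<union> R) fst snd" "\<forall>i\<in>R. fst i < snd i" "J' \<inter> R = {}"
     and g: "\<forall>g::real \<Rightarrow> real. g (fst k) - g a = (\<Sum>i\<in>J'. g (snd i) - g (fst i)) + (\<Sum>i\<in>R. g (snd i) - g (fst i))"
    by (elim exE conjE)
  note famR = interval_familyD[OF R(1)]
  have fin: "finite J'" "finite R" using famR(1) by auto
  have left: "snd i \<le> fst k" if "i \<in> J' \<union> R" for i using famR(2)[OF that] by simp
  have kR: "k \<notin> R" using left[of k] kk by auto
  let ?last = "if snd k < b then {(snd k, b)} else {}"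
  have nin: "(snd k, b) \<notin> insert k (J' \<union> R)" if "snd k < b" using left[of "(snd k, b)"] kk that by (cases k) auto
  have fam1: "interval_family a b (insert k (J' \<union> R)) fst snd"
  proof -
    have "{fst k<..<snd k} \<inter> (\<Union>i\<in>J' \<union> R. {fst i<..<snd i}) = {}" using left by fastforce
    then have "disjoint_family_on (\<lambda>i. {fst i<..<snd i}) (insert k (J' \<union> R))"
      using famR(3) kR J(2) by (simp only: disjoint_family_on_insert simp_thms Un_iff)
    moreover have "a \<le> fst i \<and> fst i \<le> snd i \<and> snd i \<le> b" if "i \<in> insert k (J' \<union> R)" for i
      using famR(2)[of i] kk that by (auto simp del: split_paired_All)
    ultimately show ?thesis using fin by (simp add: interval_family_def del: split_paired_All)
  qed
  have "interval_family a b (J \<union> (R \<union> ?last)) fst snd"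
  proof (cases "snd k < b")
    case False then show ?thesis using fam1 by (simp add: J(1))
  next
    case True
    have "{snd k<..<b} \<inter> (\<Union>i\<in>insert k (J' \<union> R). {fst i<..<snd i}) = {}" using left kk by fastforce
    then have "disjoint_family_on (\<lambda>i. {fst i<..<snd i}) (insert (snd k, b) (insert k (J' \<union> R)))"
      using interval_familyD(3)[OF fam1] nin[OF True] by (simp only: disjoint_family_on_insert simp_thms fst_conv snd_conv)
    moreover have "J \<union> (R \<union> ?last) = insert (snd k, b) (insert k (J' \<union> R))" using True by (auto simp: J(1))
    moreover have "a \<le> snd k" using kk by simp
    ultimately show ?thesis using fam1 True by (simp add: interval_family_def del: split_paired_All)
  qed
  moreover have "\<forall>i\<in>R \<union> ?last. fst i < snd i" using R(2) by simp
  moreover have "J \<inter> (R \<union> ?last) = {}" using R(3) kR nin by (auto simp: J(1))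
  moreover have "f b - f a = (\<Sum>i\<in>J. f (snd i) - f (fst i)) + (\<Sum>i\<in>R \<union> ?last. f (snd i) - f (fst i))" for f :: "real \<Rightarrow> real"
  proof (cases "snd k < b")
    case True
    then have "(snd k, b) \<notin> R" using nin by blast
    then show ?thesis using spec[OF g, of f] fin True J(2) by (simp add: J(1))
  next
    case False
    then have "b = snd k" using kk by simp
    then show ?thesis using spec[OF g, of f] fin J(2) by (simp add: J(1))
  qed
  ultimately show ?case by (intro exI[of _ "R \<union> ?last"] conjI allI)
qed

text \<open>Up to the boundary case, the upper derivate of \<open>f\<close> at \<open>x\<close> exceeds \<open>c\<close>. The intervals have \<open>x\<close> in their
  interior, which makes the set of such points a \<open>G\<^sub>\<delta>\<close> set and hence measurable.\<close>

definition steep_at :: "real \<Rightarrow> real \<Rightarrow> (real \<Rightarrow> real) \<Rightarrow> real \<Rightarrow> real \<Rightarrow> bool" where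
  "steep_at a b f c x \<longleftrightarrow>
     (\<forall>d>0. \<exists>s t. a \<le> s \<and> t \<le> b \<and> s < x \<and> x < t \<and> t - s < d \<and> c * (t - s) < f t - f s)"

lemma borel_steep_at: "{x. steep_at a b f c x} \<in> sets borel"
proof -
  define V where "V n = \<Union>{{s<..<t} | s t. a \<le> s \<and> t \<le> b \<and> t - s < inverse (real (Suc n)) \<and> c * (t - s) < f t - f s}" for n
  have "{x. steep_at a b f c x} = (\<Inter>n. V n)"
  proof (intro set_eqI iffI)
    fix x assume "x \<in> {x. steep_at a b f c x}"
    then have *: "\<And>n. \<exists>s t. a \<le> s \<and> t \<le> b \<and> s < x \<and> x < t \<and> t - s < inverse (real (Suc n)) \<and> c * (t - s) < f t - f s"
      unfolding steep_at_def by (simp del: of_nat_Suc)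
    have "x \<in> V n" for n
    proof -
      obtain s t where "a \<le> s \<and> t \<le> b \<and> s < x \<and> x < t \<and> t - s < inverse (real (Suc n)) \<and> c * (t - s) < f t - f s"
        using * by blast
      then show ?thesis unfolding V_def by (intro UnionI[of "{s<..<t}"]) auto
    qed
    then show "x \<in> (\<Inter>n. V n)" by blast
  next
    fix x assume x: "x \<in> (\<Inter>n. V n)"
    show "x \<in> {x. steep_at a b f c x}" unfolding steep_at_def mem_Collect_eq
    proof (intro allI impI)
      fix d :: real assume "d > 0"
      then obtain n where n: "inverse (real (Suc n)) < d" using reals_Archimedean by blast
      have "x \<in> V n" using x by blast
      then show "\<exists>s t. a \<le> s \<and> t \<le> b \<and> s < x \<and> x < t \<and> t - s < d \<and> c * (t - s) < f t - f s"
        unfolding V_def using n by fastforce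
    qed
  qed
  moreover have "open (V n)" for n unfolding V_def by (rule open_Union) auto
  ultimately show ?thesis by (auto intro: borel_open)
qed

lemma measure_disjoint_intervals:
  fixes s t :: "'i \<Rightarrow> real"
  assumes "interval_family a b J s t"
  shows "measure lebesgue (\<Union>i\<in>J. {s i<..<t i}) = (\<Sum>i\<in>J. t i - s i)"
proof -
  have "measure lebesgue (\<Union>i\<in>J. {s i<..<t i}) = (\<Sum>i\<in>J. measure lebesgue {s i<..<t i})"
  proof (rule measure_finite_Union)
    show "emeasure lebesgue {s i<..<t i} \<noteq> \<infinity>" if "i \<in> J" for i
      using interval_familyD(2)[OF assms that] by (simp add: emeasure_lborel_Ioo)
  qed (use interval_familyD(1,3)[OF assms] in auto)
  also have "\<dots> = (\<Sum>i\<in>J. t i - s i)"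
    using interval_familyD(2)[OF assms] by (intro sum.cong refl) simp
  finally show ?thesis .
qed

text \<open>The steep intervals around the points of \<open>E\<close> can be chosen arbitrarily short. They form a Vitali
  cover, of which finitely many disjoint members exhaust \<open>E\<close> up to measure \<open>\<epsilon>\<close>.\<close>

lemma Vitali_steep_intervals:
  fixes E G :: "real set"
  assumes E: "E \<in> sets lebesgue" "E \<subseteq> G" and G: "open G" "bounded G" and "\<epsilon> > 0"
    and steep: "\<forall>x\<in>E. steep_at a b f c x"
  shows "\<exists>J. interval_family a b J fst snd \<and>
    (\<forall>i\<in>J. fst i < snd i \<and> {fst i<..<snd i} \<subseteq> G \<and> c * (snd i - fst i) < f (snd i) - f (fst i)) \<and>
    measure lebesgue (E - (\<Union>i\<in>J. {fst i<..<snd i})) < \<epsilon>"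
proof -
  define K where "K = {i. a \<le> fst i \<and> fst i < snd i \<and> snd i \<le> b \<and> {fst i<..<snd i} \<subseteq> G \<and>
       c * (snd i - fst i) < f (snd i) - f (fst i)}"
  have ball: "ball ((fst i + snd i) / 2) ((snd i - fst i) / 2) = {fst i<..<snd i}" for i :: "real \<times> real"
    by (auto simp: ball_def dist_real_def abs_if field_simps split: if_splits)
  have cover: "\<exists>i. i \<in> K \<and> x \<in> ball ((fst i + snd i) / 2) ((snd i - fst i) / 2) \<and> (snd i - fst i) / 2 < d"
    if x: "x \<in> E" and d: "d > 0" for x d
  proof -
    obtain e where e: "e > 0" "ball x e \<subseteq> G" using G(1) E(2) x by (meson openE subsetD)
    obtain s t where st: "a \<le> s" "t \<le> b" "s < x" "x < t" "t - s < min d e" "c * (t - s) < f t - f s"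
      using bspec[OF steep x] d e unfolding steep_at_def by (metis min_less_iff_conj)
    have "{s<..<t} \<subseteq> ball x e" using st by (auto simp: dist_real_def)
    then have "(s,t) \<in> K" using st e by (auto simp: K_def)
    then show ?thesis using st d by (intro exI[of _ "(s,t)"]) (simp add: ball[of "(s,t)", simplified])
  qed
  obtain C where C: "countable C" "C \<subseteq> K"
     "pairwise (\<lambda>i j. disjnt {fst i<..<snd i} {fst j<..<snd j}) C"
     "negligible (E - (\<Union>i \<in> C. {fst i<..<snd i}))"
    using Vitali_covering_theorem_balls[of E K "\<lambda>i. (fst i + snd i) / 2" "\<lambda>i. (snd i - fst i) / 2", OF cover]
    unfolding ball by blast
  have lmG: "G \<in> lmeasurable" using G by (simp add: lmeasurable_open)
  obtain D where D: "D \<subseteq> (\<lambda>i. {fst i<..<snd i}) ` C" "finite D"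
    "measure lebesgue (\<Union>((\<lambda>i. {fst i<..<snd i}) ` C)) - \<epsilon> < measure lebesgue (\<Union>D)"
  proof (rule measure_countable_Union_approachable[of "(\<lambda>i. {fst i<..<snd i}) ` C" \<epsilon> "measure lebesgue G"])
    show "measure lebesgue (\<Union>D') \<le> measure lebesgue G"
      if "D' \<subseteq> (\<lambda>i. {fst i<..<snd i}) ` C" "finite D'" for D'
    proof (rule measure_mono_fmeasurable[OF _ _ lmG])
      show "\<Union>D' \<subseteq> G" using that C(2) unfolding K_def by auto
      show "\<Union>D' \<in> sets lebesgue" using that by (intro sets.finite_Union) auto
    qed
  qed (use C \<open>\<epsilon> > 0\<close> in auto)
  obtain J where J: "J \<subseteq> C" "finite J" "D = (\<lambda>i. {fst i<..<snd i}) ` J"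
    using finite_subset_image[OF D(2,1)] by blast
  let ?UC = "\<Union>i\<in>C. {fst i<..<snd i}" and ?UJ = "\<Union>i\<in>J. {fst i<..<snd i}"
  have "?UC \<subseteq> G" "?UJ \<subseteq> G" using C(2) J(1) by (auto simp: K_def)
  then have "bounded ?UC" "bounded ?UJ" using bounded_subset[OF G(2)] by blast+
  then have lm: "?UC \<in> lmeasurable" "?UJ \<in> lmeasurable"
    by (auto intro!: lmeasurable_open)
  have "measure lebesgue (E - ?UJ) \<le> measure lebesgue ((E - ?UC) \<union> (?UC - ?UJ))"
  proof (rule measure_mono_fmeasurable)
    have "E - ?UC \<in> lmeasurable" using C(4) negligible_iff_measure by blast
    then show "(E - ?UC) \<union> (?UC - ?UJ) \<in> lmeasurable" using lm by auto
  qed (use E lm in auto)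
  also have "\<dots> \<le> measure lebesgue (E - ?UC) + measure lebesgue (?UC - ?UJ)"
    using E lm by (intro measure_Un_le) auto
  also have "measure lebesgue (E - ?UC) = 0" using C(4) negligible_iff_measure by blast
  also have "measure lebesgue (?UC - ?UJ) = measure lebesgue ?UC - measure lebesgue ?UJ"
    using lm J(1) by (intro measurable_measure_Diff) auto
  also have "\<dots> < \<epsilon>" using D(3) J(3) by simp
  finally have small: "measure lebesgue (E - ?UJ) < \<epsilon>" by simp
  have "disjoint_family_on (\<lambda>i. {fst i<..<snd i}) J"
    using C(3) J(1) unfolding disjoint_family_on_def pairwise_def disjnt_def by blast
  then have "interval_family a b J fst snd" using J(1,2) C(2) by (fastforce simp: interval_family_def K_def)
  then show ?thesis using J(1) C(2) small by (intro exI[of _ J]) (auto simp: K_def)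
qed

lemma steep_at_intro:
  fixes f :: "real \<Rightarrow> real"
  assumes x: "a < x" "x < b" and cont: "continuous_on {a..b} f"
    and fr: "\<exists>\<^sub>F t in at x. c < (f t - f x) / (t - x)"
  shows "steep_at a b f c x"
  unfolding steep_at_def
proof (intro allI impI)
  fix d :: real assume d: "d > 0"
  have "isCont f x"
    using continuous_on_interior[OF cont] x by (simp add: interior_atLeastAtMost_real)
  then have lim: "(f \<longlongrightarrow> f x) (at x)" by (simp add: isCont_def)
  define e where "e = min (d/2) (min (x - a) (b - x))"
  have e: "e > 0" using d x by (auto simp: e_def)
  obtain t where t: "t \<noteq> x" "dist t x < e" "c < (f t - f x) / (t - x)"
    using fr e unfolding frequently_at by auto
  have near: "a < t" "t < b" "\<bar>t - x\<bar> < d/2" using t(2) by (auto simp: e_def dist_real_def)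
  \<comment> \<open>The quotient with endpoint \<open>x\<close> stays above \<open>c\<close> when \<open>x\<close> is moved slightly to the other side of \<open>t\<close>.\<close>
  have "((\<lambda>y. (f t - f y) / (t - y)) \<longlongrightarrow> (f t - f x) / (t - x)) (at x)"
    using t(1) by (intro tendsto_intros lim) auto
  then have "\<forall>\<^sub>F y in at x. c < (f t - f y) / (t - y)" using t(3) by (rule order_tendstoD)
  then obtain k where k: "k > 0" "\<And>y. y \<noteq> x \<Longrightarrow> dist y x < k \<Longrightarrow> c < (f t - f y) / (t - y)"
    unfolding eventually_at by auto
  define l where "l = min (k/2) (e/2)"
  have l: "l > 0" "l < k" "l < e" using k e by (auto simp: l_def)
  show "\<exists>s t. a \<le> s \<and> t \<le> b \<and> s < x \<and> x < t \<and> t - s < d \<and> c * (t - s) < f t - f s"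
  proof (cases "x < t")
    case True
    have "c < (f t - f (x - l)) / (t - (x - l))" using k(2)[of "x - l"] l by (simp add: dist_real_def)
    then have "c * (t - (x - l)) < f t - f (x - l)" using True l by (simp add: pos_less_divide_eq)
    then show ?thesis using True l near by (intro exI[of _ "x - l"] exI[of _ t]) (auto simp: e_def)
  next
    case False
    then have tx: "t < x" using t by simp
    have "c < (f t - f (x + l)) / (t - (x + l))" using k(2)[of "x + l"] l by (simp add: dist_real_def)
    also have "\<dots> = (f (x + l) - f t) / (x + l - t)" using minus_divide_divide[of "f t - f (x+l)" "t - (x+l)"] by simp
    finally have "c * (x + l - t) < f (x + l) - f t" using tx l by (simp add: pos_less_divide_eq)
    then show ?thesis using tx l near by (intro exI[of _ "t"] exI[of _ "x+l"]) (auto simp: e_def)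
  qed
qed

text \<open>The lower and upper limits of the difference quotient either agree and are finite, or one of
  them is infinite, or a rational gap separates them.\<close>

lemma differentiable_if_not_steep:
  fixes f :: "real \<Rightarrow> real"
  assumes x: "a < x" "x < b" and cont: "continuous_on {a..b} f"
    and up: "\<not> (\<forall>k::nat. steep_at a b f k x)" and down: "\<not> (\<forall>k::nat. steep_at a b (\<lambda>x. - f x) k x)"
    and gap: "\<And>p q. p \<in> \<rat> \<Longrightarrow> q \<in> \<rat> \<Longrightarrow> p < q \<Longrightarrow> \<not> (steep_at a b (\<lambda>x. - f x) (-p) x \<and> steep_at a b f q x)"
  shows "f differentiable (at x)"
proof -
  define Q where "Q t = (f t - f x) / (t - x)" for t
  define L M where "L = Liminf (at x) (\<lambda>t. ereal (Q t))" and "M = Limsup (at x) (\<lambda>t. ereal (Q t))"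
  have upI: "steep_at a b f c x" if "\<exists>\<^sub>F t in at x. c < Q t" for c
    using steep_at_intro[OF x cont] that unfolding Q_def by blast
  have cont': "continuous_on {a..b} (\<lambda>x. - f x)" using cont by (intro continuous_intros)
  have downI: "steep_at a b (\<lambda>x. - f x) (-c) x" if "\<exists>\<^sub>F t in at x. Q t < c" for c
  proof (rule steep_at_intro[OF x cont'])
    have "- c < (- f t - - f x) / (t - x)" if "Q t < c" for t
    proof -
      have "(- f t - - f x) / (t - x) = - Q t" unfolding Q_def by (simp add: minus_divide_left)
      then show ?thesis using that by simp
    qed
    then show "\<exists>\<^sub>F t in at x. - c < (- f t - - f x) / (t - x)"
      using that by (rule frequently_elim1[rotated]) 
  qed
  have frL: "\<exists>\<^sub>F t in at x. Q t < p" if "L < ereal p" for p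
  proof (rule ccontr)
    assume "\<not> ?thesis"
    then have "\<forall>\<^sub>F t in at x. ereal p \<le> ereal (Q t)" by (simp add: frequently_def not_less)
    then have "ereal p \<le> L" unfolding L_def by (rule Liminf_bounded)
    then show False using that by simp
  qed
  have frM: "\<exists>\<^sub>F t in at x. q < Q t" if "ereal q < M" for q
  proof (rule ccontr)
    assume "\<not> ?thesis"
    then have "\<forall>\<^sub>F t in at x. ereal (Q t) \<le> ereal q" by (simp add: frequently_def not_less)
    then have "M \<le> ereal q" unfolding M_def by (rule Limsup_bounded)
    then show False using that by simp
  qed
  have LM: "L \<le> M" unfolding L_def M_def by (rule Liminf_le_Limsup) simp
  have "\<not> L < M"
  proof
    assume "L < M"
    then obtain p' where p': "L < ereal p'" "ereal p' < M" using ereal_dense2 by blast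
    then obtain q' where q': "ereal p' < ereal q'" "ereal q' < M" using ereal_dense2 by blast
    then have "p' < q'" by simp
    then obtain p where p: "p \<in> \<rat>" "p' < p" "p < q'" using Rats_dense_in_real by blast
    obtain q where q: "q \<in> \<rat>" "p < q" "q < q'" using Rats_dense_in_real[OF p(3)] by blast
    have "ereal q < ereal q'" using q by simp
    then have "ereal q < M" using q'(2) by (rule less_trans)
    moreover have "L < ereal p" using p'(1) p(2) by (metis less_ereal.simps(1) less_trans)
    ultimately have "steep_at a b (\<lambda>x. - f x) (-p) x" "steep_at a b f q x" using upI downI frL frM by blast+
    then show False using gap p q by blast
  qed
  then have eq: "M = L" using LM by auto
  have "M \<noteq> \<infinity>" using up upI frM by force
  moreover have "L \<noteq> -\<infinity>"
  proof
    assume "L = -\<infinity>"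
    then have "steep_at a b (\<lambda>x. - f x) (- (- real k)) x" for k by (intro downI frL) simp
    then show False using down by simp
  qed
  ultimately obtain l where l: "L = ereal l" "M = ereal l" using eq by (cases L) auto
  have "((\<lambda>t. ereal (Q t)) \<longlongrightarrow> ereal l) (at x)"
    by (subst tendsto_iff_Liminf_eq_Limsup) (use l in \<open>auto simp: L_def M_def\<close>)
  then have "(Q \<longlongrightarrow> l) (at x)" by simp
  then have "(f has_field_derivative l) (at x)" unfolding Q_def has_field_derivative_iff .
  then show ?thesis using real_differentiable_def by blast
qed

text \<open>If \<open>f\<close> had derivates on both sides of the gap \<open>(p, q)\<close> on a set \<open>E\<close> of positive measure, then
  disjoint intervals \<open>I\<close> of slope below \<open>p\<close> and, inside them, disjoint intervals \<open>J\<close> of slope above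
  \<open>q\<close> would both fill \<open>E\<close> almost exactly. The two families then differ by intervals of small total
  length, so by absolute continuity the increments of \<open>f\<close> over them are almost equal, which
  contradicts the slopes.\<close>

lemma derivate_gap_null:
  fixes f :: "real \<Rightarrow> real"
  assumes ac: "abs_continuous_on_interval a b f" and "p < q"
    and E: "E \<in> sets lebesgue" "E \<subseteq> {a<..<b}"
    and low: "\<And>x. x \<in> E \<Longrightarrow> steep_at a b (\<lambda>x. - f x) (-p) x"
    and high: "\<And>x. x \<in> E \<Longrightarrow> steep_at a b f q x"
  shows "negligible E"
proof (rule ccontr)
  assume nn: "\<not> negligible E"
  have lmE: "E \<in> lmeasurable"
    using bounded_set_imp_lmeasurable[OF _ E(1)] bounded_subset[OF bounded_box[of a b, unfolded box_real] E(2)] by blast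
  define \<mu> where "\<mu> = measure lebesgue E"
  have \<mu>: "\<mu> > 0" using nn lmE negligible_iff_measure unfolding \<mu>_def by (metis measure_nonneg order_le_less)
  have ab: "a \<le> b" using nn E(2) by (cases "a \<le> b") auto
  define C where "C = 2 * (q - p) + 3 * \<bar>p\<bar>"
  have C: "C > 0" using \<open>p < q\<close> unfolding C_def by (simp add: add_pos_nonneg)
  define \<eta> where "\<eta> = (q - p) * \<mu> / 3"
  have \<eta>: "\<eta> > 0" using \<mu> \<open>p < q\<close> by (simp add: \<eta>_def)
  obtain \<delta> where \<delta>: "\<delta> > 0" and D: "\<forall>(I :: (real \<times> real) set) s t. interval_family a b I s t \<longrightarrow>
       (\<Sum>k\<in>I. t k - s k) < \<delta> \<longrightarrow> (\<Sum>k\<in>I. dist (f (s k)) (f (t k))) < \<eta>"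
    using ac_small_variation[OF ac \<eta>, where 'i = "real \<times> real"] by (elim exE conjE)
  define \<kappa> where "\<kappa> = min (\<delta> / 4) (\<eta> / C)"
  have \<kappa>: "\<kappa> > 0" "3 * \<kappa> < \<delta>" "C * \<kappa> \<le> \<eta>"
    using \<delta> C \<eta> by (auto simp: \<kappa>_def min_def field_simps)
  obtain T where T: "open T" "E \<subseteq> T" "T - E \<in> lmeasurable" "emeasure lebesgue (T - E) < ennreal \<kappa>"
    using sets_lebesgue_outer_open[OF E(1) \<kappa>(1)] by blast
  define G where "G = T \<inter> {a<..<b}"
  have G: "open G" "E \<subseteq> G" "bounded G"
    using T E by (auto simp: G_def intro: bounded_subset[OF bounded_box[of a b, unfolded box_real]])
  have lmG: "G \<in> lmeasurable" using G by (simp add: lmeasurable_open)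
  have GE: "measure lebesgue (G - E) < \<kappa>"
  proof -
    have "measure lebesgue (G - E) \<le> measure lebesgue (T - E)"
      using T(3) lmG lmE by (intro measure_mono_fmeasurable) (auto simp: G_def)
    also have "\<dots> < \<kappa>" using T(3,4) \<kappa>(1) by (metis emeasure_eq_measure2 ennreal_less_iff measure_nonneg)
    finally show ?thesis .
  qed
  have mG: "measure lebesgue G < \<mu> + \<kappa>"
    using GE measurable_measure_Diff[OF lmG _ G(2)] E(1) by (simp add: \<mu>_def)
  have lowE: "\<forall>x\<in>E. steep_at a b (\<lambda>x. - f x) (-p) x" using low by blast
  obtain I where I: "interval_family a b I fst snd"
    "\<forall>i\<in>I. fst i < snd i \<and> {fst i<..<snd i} \<subseteq> G \<and>
       (- p) * (snd i - fst i) < - f (snd i) - - f (fst i)"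
    "measure lebesgue (E - (\<Union>i\<in>I. {fst i<..<snd i})) < \<kappa>"
    using Vitali_steep_intervals[OF E(1) G(2) G(1) G(3) \<kappa>(1) lowE] by (elim exE conjE)
  define G' where "G' = (\<Union>i\<in>I. {fst i<..<snd i})"
  have G': "G' \<subseteq> G" "open G'" using I(2) by (auto simp: G'_def)
  have bG': "bounded G'" using G'(1) G(3) by (rule bounded_subset[rotated])
  have lmG': "G' \<in> lmeasurable" using G' bG' by (simp add: lmeasurable_open)
  define E' where "E' = E \<inter> G'"
  have E': "E' \<in> sets lebesgue" "E' \<subseteq> G'" using E(1) lmG' by (auto simp: E'_def)
  have highE': "\<forall>x\<in>E'. steep_at a b f q x" using high by (simp add: E'_def)
  obtain J where J: "interval_family a b J fst snd"
    "\<forall>i\<in>J. fst i < snd i \<and> {fst i<..<snd i} \<subseteq> G' \<and>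
       q * (snd i - fst i) < f (snd i) - f (fst i)"
    "measure lebesgue (E' - (\<Union>i\<in>J. {fst i<..<snd i})) < \<kappa>"
    using Vitali_steep_intervals[OF E' G'(2) bG' \<kappa>(1) highE'] by (elim exE conjE)
  define H where "H = (\<Union>i\<in>J. {fst i<..<snd i})"
  have H: "H \<subseteq> G'" "open H" using J(2) by (auto simp: H_def)
  have lmH: "H \<in> lmeasurable" using H bG' bounded_subset by (blast intro: lmeasurable_open)
  define lI lJ where "lI = (\<Sum>i\<in>I. snd i - fst i)" and "lJ = (\<Sum>i\<in>J. snd i - fst i)"
  have lI: "measure lebesgue G' = lI" unfolding G'_def lI_def by (rule measure_disjoint_intervals[OF I(1)])
  have lJ: "measure lebesgue H = lJ" unfolding H_def lJ_def by (rule measure_disjoint_intervals[OF J(1)])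
  have "lI \<le> measure lebesgue G" unfolding lI[symmetric] using G'(1) lmG lmG' by (intro measure_mono_fmeasurable) auto
  then have lI_le: "lI < \<mu> + \<kappa>" using mG by simp
  have "\<mu> \<le> measure lebesgue ((E - G') \<union> (E' - H) \<union> H)"
    unfolding \<mu>_def using lmE lmG' lmH by (intro measure_mono_fmeasurable) (auto simp: E'_def)
  also have "\<dots> \<le> measure lebesgue ((E - G') \<union> (E' - H)) + measure lebesgue H"
    using E E' lmG' lmH by (intro measure_Un_le) auto
  also have "measure lebesgue ((E - G') \<union> (E' - H)) \<le> measure lebesgue (E - G') + measure lebesgue (E' - H)"
    using E E' lmG' lmH by (intro measure_Un_le) auto
  finally have lJ_ge: "\<mu> - 2 * \<kappa> < lJ" using I(3) J(3) lJ unfolding G'_def[symmetric] H_def[symmetric] by linarith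
  have lJI: "lJ \<le> lI" unfolding lI[symmetric] lJ[symmetric] using H(1) lmG' lmH by (intro measure_mono_fmeasurable) auto
  \<comment> \<open>The gaps of \<open>I\<close> together with \<open>J\<close> form one disjoint family; its gaps are what \<open>I\<close> has more than \<open>J\<close>.\<close>
  have strictI: "\<forall>i\<in>I. fst i < snd i" using I(2) by blast
  obtain R where R: "interval_family a b (I \<union> R) fst snd" "\<forall>i\<in>R. fst i < snd i" "I \<inter> R = {}"
     and gR: "\<forall>g::real \<Rightarrow> real. g b - g a = (\<Sum>i\<in>I. g (snd i) - g (fst i)) + (\<Sum>i\<in>R. g (snd i) - g (fst i))"
    using complementary_intervals[OF I(1) strictI ab] by (elim exE conjE)
  have famR: "interval_family a b R fst snd" using R(1) by (rule interval_family_subset) simp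
  have RG': "{fst i<..<snd i} \<inter> G' = {}" if "i \<in> R" for i
  proof -
    have "{fst i<..<snd i} \<inter> {fst k<..<snd k} = {}" if "k \<in> I" for k
    proof (rule disjoint_family_onD[OF interval_familyD(3)[OF R(1)]])
      show "i \<noteq> k" using R(3) \<open>i \<in> R\<close> that by blast
    qed (use \<open>i \<in> R\<close> that in simp_all)
    then show ?thesis unfolding G'_def by blast
  qed
  have JR: "J \<inter> R = {}"
  proof (rule ccontr)
    assume "J \<inter> R \<noteq> {}"
    then obtain i where i: "i \<in> J" "i \<in> R" by blast
    then have "{fst i<..<snd i} = {}" using bspec[OF J(2) i(1)] RG'[OF i(2)] by blast
    then show False using bspec[OF J(2) i(1)] by simp
  qed
  have famJR: "interval_family a b (J \<union> R) fst snd"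
    unfolding interval_family_def disjoint_family_on_def
  proof (intro conjI ballI impI)
    show "finite (J \<union> R)" using interval_familyD(1)[OF J(1)] interval_familyD(1)[OF famR] by simp
    fix i assume i: "i \<in> J \<union> R"
    then show "a \<le> fst i" "fst i \<le> snd i" "snd i \<le> b"
      using interval_familyD(2)[OF J(1), of i] interval_familyD(2)[OF famR, of i] by blast+
    fix k assume k: "k \<in> J \<union> R" "i \<noteq> k"
    from i k(1) consider "i \<in> J" "k \<in> J" | "i \<in> R" "k \<in> R" | "i \<in> J" "k \<in> R" | "i \<in> R" "k \<in> J" by blast
    then show "{fst i<..<snd i} \<inter> {fst k<..<snd k} = {}"
    proof cases
      case 1 then show ?thesis using k(2) by (intro disjoint_family_onD[OF interval_familyD(3)[OF J(1)]])
    next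
      case 2 then show ?thesis using k(2) by (intro disjoint_family_onD[OF interval_familyD(3)[OF famR]])
    next
      case 3 then show ?thesis using bspec[OF J(2), of i] RG'[of k] by blast
    next
      case 4 then show ?thesis using bspec[OF J(2), of k] RG'[of i] by blast
    qed
  qed
  have strict: "\<forall>i\<in>J \<union> R. fst i < snd i" using J(2) R(2) by blast
  obtain S where S: "interval_family a b (J \<union> R \<union> S) fst snd"
     and gS: "\<forall>g::real \<Rightarrow> real. g b - g a = (\<Sum>i\<in>J \<union> R. g (snd i) - g (fst i)) + (\<Sum>i\<in>S. g (snd i) - g (fst i))"
    using complementary_intervals[OF famJR strict ab] by (elim exE conjE)
  have famS: "interval_family a b S fst snd" using S by (rule interval_family_subset) simp
  have diff: "(\<Sum>i\<in>J. g (snd i) - g (fst i)) + (\<Sum>i\<in>S. g (snd i) - g (fst i)) = (\<Sum>i\<in>I. g (snd i) - g (fst i))"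
    for g :: "real \<Rightarrow> real"
    using spec[OF gR, of g] spec[OF gS, of g] sum.union_disjoint[OF interval_familyD(1)[OF J(1)] interval_familyD(1)[OF famR] JR, of "\<lambda>i. g (snd i) - g (fst i)"] by linarith
  have "(\<Sum>i\<in>S. snd i - fst i) = lI - lJ" using diff[of "\<lambda>x. x"] by (simp add: lI_def lJ_def)
  also have "\<dots> < \<delta>" using lI_le lJ_ge \<kappa> by linarith
  finally have small: "(\<Sum>i\<in>S. snd i - fst i) < \<delta>" .
  have "(\<Sum>i\<in>S. dist (f (fst i)) (f (snd i))) < \<eta>"
    by (rule D[rule_format, OF famS small])
  moreover have "- (\<Sum>i\<in>S. f (snd i) - f (fst i)) \<le> (\<Sum>i\<in>S. dist (f (fst i)) (f (snd i)))"
    unfolding sum_negf[symmetric] by (intro sum_mono) (auto simp: dist_real_def)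
  moreover have "q * lJ \<le> (\<Sum>i\<in>J. f (snd i) - f (fst i))"
    unfolding lJ_def sum_distrib_left using J(2) by (intro sum_mono) (auto simp: less_imp_le)
  moreover have "(\<Sum>i\<in>I. f (snd i) - f (fst i)) \<le> p * lI"
    unfolding lI_def sum_distrib_left 
  proof (intro sum_mono)
    fix i assume "i \<in> I" then show "f (snd i) - f (fst i) \<le> p * (snd i - fst i)" using bspec[OF I(2), of i] by (simp add: algebra_simps)
  qed
  ultimately have "q * lJ - p * lI < \<eta>" using diff[of f] by linarith
  moreover have "(q - p) * (\<mu> - 2 * \<kappa>) - \<bar>p\<bar> * (3 * \<kappa>) \<le> (q - p) * lJ - p * (lI - lJ)"
  proof -
    have "p * (lI - lJ) \<le> \<bar>p\<bar> * (lI - lJ)" using lJI by (intro mult_right_mono) auto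
    also have "\<dots> \<le> \<bar>p\<bar> * (3 * \<kappa>)" using lI_le lJ_ge by (intro mult_left_mono) auto
    finally have "p * (lI - lJ) \<le> \<bar>p\<bar> * (3 * \<kappa>)" .
    moreover have "(q - p) * (\<mu> - 2 * \<kappa>) \<le> (q - p) * lJ" using lJ_ge \<open>p < q\<close> by (intro mult_left_mono) auto
    ultimately show ?thesis by linarith
  qed
  ultimately have "(q - p) * \<mu> - C * \<kappa> < \<eta>" unfolding C_def by (simp add: algebra_simps)
  moreover have "(q - p) * \<mu> = 3 * \<eta>" by (simp add: \<eta>_def)
  ultimately show False using \<kappa>(3) \<eta> by linarith
qed

text \<open>Absolute continuity bounds the total increment of \<open>f\<close> on a short interval, which leaves no room
  for a set of positive measure covered by disjoint intervals of arbitrarily large slope.\<close>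

lemma infinite_derivate_null:
  fixes f :: "real \<Rightarrow> real"
  assumes ac: "abs_continuous_on_interval a b f" 
    and E: "E \<in> sets lebesgue" "E \<subseteq> {a<..<b}"
    and high: "\<And>x k. x \<in> E \<Longrightarrow> steep_at a b f (real k) x"
  shows "negligible E"
proof -
  obtain \<delta> where \<delta>: "\<delta> > 0" and D: "\<forall>(I :: (real \<times> real) set) s t. interval_family a b I s t \<longrightarrow>
       (\<Sum>k\<in>I. t k - s k) < \<delta> \<longrightarrow> (\<Sum>k\<in>I. dist (f (s k)) (f (t k))) < 1"
    using ac_small_variation[OF ac zero_less_one, where 'i = "real \<times> real"] by (elim exE conjE)
  \<comment> \<open>Inside a ball of length below \<open>\<delta>\<close> the total increment of \<open>f\<close> is at most 1, whatever the slopes.\<close>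
  have loc: "negligible (E \<inter> ball x (\<delta>/4))" if "x \<in> E" for x
  proof (rule ccontr)
    assume nn: "\<not> ?thesis"
    let ?E = "E \<inter> ball x (\<delta>/4)"
    have lmE: "?E \<in> lmeasurable" using E by (intro bounded_set_imp_lmeasurable) auto
    define \<mu> where "\<mu> = measure lebesgue ?E"
    have \<mu>: "\<mu> > 0" using nn lmE negligible_iff_measure unfolding \<mu>_def by (metis measure_nonneg order_le_less)
    obtain k :: nat where k: "2 / \<mu> < real k" using reals_Archimedean2 by blast
    have \<mu>2: "\<mu> / 2 > 0" using \<mu> by simp
    have highE: "\<forall>y\<in>?E. steep_at a b f (real k) y" using high by blast
    obtain J where J: "interval_family a b J fst snd"
      "\<forall>i\<in>J. fst i < snd i \<and> {fst i<..<snd i} \<subseteq> ball x (\<delta>/4) \<and>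
         real k * (snd i - fst i) < f (snd i) - f (fst i)"
      "measure lebesgue (?E - (\<Union>i\<in>J. {fst i<..<snd i})) < \<mu> / 2"
      using Vitali_steep_intervals[OF fmeasurableD[OF lmE] Int_lower2 open_ball bounded_ball \<mu>2 highE] by (elim exE conjE)
    define H where "H = (\<Union>i\<in>J. {fst i<..<snd i})"
    have H: "H \<subseteq> ball x (\<delta>/4)" "open H" using J(2) by (auto simp: H_def)
    have lmH: "H \<in> lmeasurable" using H bounded_subset by (blast intro: lmeasurable_open)
    have mH: "measure lebesgue H = (\<Sum>i\<in>J. snd i - fst i)" unfolding H_def by (rule measure_disjoint_intervals[OF J(1)])
    have "measure lebesgue H \<le> measure lebesgue (ball x (\<delta>/4))"
      using H(1) lmH by (intro measure_mono_fmeasurable) auto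
    also have "\<dots> < \<delta>" using \<delta> by (simp add: ball_eq_greaterThanLessThan)
    finally have small: "(\<Sum>i\<in>J. snd i - fst i) < \<delta>" unfolding mH .
    have "(\<Sum>i\<in>J. dist (f (fst i)) (f (snd i))) < 1"
      by (rule D[rule_format, OF J(1) small])
    moreover have "real k * measure lebesgue H \<le> (\<Sum>i\<in>J. dist (f (fst i)) (f (snd i)))"
      unfolding mH sum_distrib_left
    proof (intro sum_mono)
      fix i assume "i \<in> J" then show "real k * (snd i - fst i) \<le> dist (f (fst i)) (f (snd i))"
        using bspec[OF J(2), of i] unfolding dist_real_def by linarith
    qed
    moreover have "\<mu> / 2 < measure lebesgue H"
    proof -
      have "\<mu> \<le> measure lebesgue ((?E - H) \<union> H)" unfolding \<mu>_def
        using lmE lmH by (intro measure_mono_fmeasurable) auto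
      also have "\<dots> \<le> measure lebesgue (?E - H) + measure lebesgue H"
        using lmE lmH by (intro measure_Un_le) auto
      finally show ?thesis using J(3) unfolding H_def[symmetric] by linarith
    qed
    ultimately have "real k * (\<mu> / 2) < 1"
      by (smt (verit) mult_left_mono of_nat_0_le_iff)
    then show False using k \<mu> by (simp add: field_simps)
  qed
  show ?thesis
  proof (rule iffD2[OF locally_negligible_alt], rule ballI)
    fix x assume "x \<in> E"
    then show "\<exists>U. openin (top_of_set E) U \<and> x \<in> U \<and> negligible U"
      using loc \<delta> by (intro exI[of _ "E \<inter> ball x (\<delta>/4)"]) (auto simp: openin_open_Int)
  qed
qed

lemma ac_minus: "abs_continuous_on_interval a b f \<Longrightarrow> abs_continuous_on_interval a b (\<lambda>x. - f x :: real)"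
  unfolding abs_continuous_on_interval_def by (simp add: dist_minus)

lemma ac_real_differentiable_ae:
  fixes f :: "real \<Rightarrow> real"
  assumes ac: "abs_continuous_on_interval a b f"
  shows "negligible {x \<in> {a..b}. \<not> f differentiable (at x)}"
proof -
  let ?g = "\<lambda>x. - f x"
  note acg = ac_minus[OF ac]
  define Bad where "Bad p q = {x. steep_at a b ?g (-p) x} \<inter> {x. steep_at a b f q x} \<inter> {a<..<b}" for p q
  define Up where "Up h = (\<Inter>k::nat. {x. steep_at a b h (real k) x}) \<inter> {a<..<b}" for h
  have meas: "Bad p q \<in> sets lebesgue" "Up h \<in> sets lebesgue" for p q h
    using borel_steep_at by (auto simp: Bad_def Up_def intro!: sets.Int sets.countable_INT')
  have negBad: "negligible (Bad p q)" if "p < q" for p q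
    using meas that by (intro derivate_gap_null[OF ac, of p q]) (auto simp: Bad_def)
  have "negligible (Up f)" using meas by (intro infinite_derivate_null[OF ac]) (auto simp: Up_def)
  moreover have "negligible (Up ?g)" using meas by (intro infinite_derivate_null[OF acg]) (auto simp: Up_def)
  ultimately have negUp: "negligible (Up f)" "negligible (Up ?g)" .
  define N where "N = {a, b} \<union> Up f \<union> Up ?g \<union> (\<Union>(p,q)\<in>{(p,q) \<in> \<rat> \<times> \<rat>. p < q}. Bad p q)"
  have "negligible (\<Union>(p,q)\<in>{(p,q) \<in> \<rat> \<times> \<rat>. p < q}. Bad p q)"
  proof (rule negligible_countable_Union)
    have "countable {(p,q) \<in> (\<rat> :: real set) \<times> \<rat>. p < q}"
      by (rule countable_subset[of _ "\<rat> \<times> \<rat>"]) (auto simp: countable_rat)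
    then show "countable ((\<lambda>(p,q). Bad p q) ` {(p,q) \<in> (\<rat> :: real set) \<times> \<rat>. p < q})" by (rule countable_image)
  qed (use negBad in auto)
  then have "negligible N" using negUp unfolding N_def by (auto intro!: negligible_Un)
  moreover have "{x \<in> {a..b}. \<not> f differentiable (at x)} \<subseteq> N"
  proof
    fix x assume x: "x \<in> {x \<in> {a..b}. \<not> f differentiable (at x)}"
    show "x \<in> N"
    proof (rule ccontr)
      assume nN: "x \<notin> N"
      then have ab: "a < x" "x < b" using x by (auto simp: N_def)
      have "f differentiable (at x)"
      proof (rule differentiable_if_not_steep[OF ab ac_imp_continuous_on[OF ac]])
        show "\<not> (\<forall>k::nat. steep_at a b f k x)" "\<not> (\<forall>k::nat. steep_at a b ?g k x)"
          using nN ab by (auto simp: N_def Up_def)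
        show "\<not> (steep_at a b ?g (-p) x \<and> steep_at a b f q x)" if "p \<in> \<rat>" "q \<in> \<rat>" "p < q" for p q
          using nN ab that by (force simp: N_def Bad_def)
      qed
      then show False using x by simp
    qed
  qed
  ultimately show ?thesis using negligible_subset by blast
qed

section \<open>Absolutely continuous curves and the fundamental theorem of calculus\<close>

lemma ac_if_small_variation:
  fixes \<gamma> :: "real \<Rightarrow> 'b::metric_space"
  assumes "\<And>\<epsilon>. \<epsilon> > 0 \<Longrightarrow> \<exists>\<delta>>0. \<forall>(I :: nat set) s t. interval_family a b I s t \<longrightarrow> (\<Sum>k\<in>I. t k - s k) < \<delta> \<longrightarrow>
     (\<Sum>k\<in>I. dist (\<gamma> (s k)) (\<gamma> (t k))) < \<epsilon>"
  shows "abs_continuous_on_interval a b \<gamma>"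
  unfolding abs_continuous_on_interval_def
proof (intro allI impI)
  fix \<epsilon> :: real assume "\<epsilon> > 0"
  from assms[OF this] obtain \<delta> where \<delta>: "\<delta> > 0" and
    D: "\<forall>(I :: nat set) s t. interval_family a b I s t \<longrightarrow> (\<Sum>k\<in>I. t k - s k) < \<delta> \<longrightarrow>
     (\<Sum>k\<in>I. dist (\<gamma> (s k)) (\<gamma> (t k))) < \<epsilon>" by (elim exE conjE)
  show "\<exists>\<delta>>0. \<forall>(n::nat) s t. (\<forall>k<n. a \<le> s k \<and> s k < t k \<and> t k \<le> b) \<longrightarrow>
        disjoint_family_on (\<lambda>k. {s k<..<t k}) {..<n} \<longrightarrow> (\<Sum>k<n. t k - s k) < \<delta> \<longrightarrow>
        (\<Sum>k<n. dist (\<gamma> (s k)) (\<gamma> (t k))) < \<epsilon>"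
  proof (intro exI[of _ \<delta>] conjI allI impI \<delta>)
    fix n :: nat and s t
    assume "\<forall>k<n. a \<le> s k \<and> s k < t k \<and> t k \<le> b" "disjoint_family_on (\<lambda>k. {s k<..<t k}) {..<n}"
    then have "interval_family a b {..<n} s t" by (simp add: interval_family_def less_imp_le)
    moreover assume "(\<Sum>k<n. t k - s k) < \<delta>"
    ultimately show "(\<Sum>k<n. dist (\<gamma> (s k)) (\<gamma> (t k))) < \<epsilon>" by (intro D[rule_format])
  qed
qed

text \<open>Absolute continuity is inherited by restrictions, by Lipschitz images and by curves that agree on
  the interval.\<close>

lemma ac_comparison:
  fixes \<gamma> :: "real \<Rightarrow> 'b::metric_space" and \<eta> :: "real \<Rightarrow> 'c::metric_space"
  assumes ac: "abs_continuous_on_interval a b \<gamma>" and cd: "a \<le> c" "d \<le> b" and C: "C > 0"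
    and le: "\<And>s t. c \<le> s \<Longrightarrow> s \<le> t \<Longrightarrow> t \<le> d \<Longrightarrow> dist (\<eta> s) (\<eta> t) \<le> C * dist (\<gamma> s) (\<gamma> t)"
  shows "abs_continuous_on_interval c d \<eta>"
proof (rule ac_if_small_variation)
  fix \<epsilon> :: real assume "\<epsilon> > 0"
  then have e: "\<epsilon> / C > 0" using C by simp
  obtain \<delta> where \<delta>: "\<delta> > 0" and D: "\<forall>(I :: nat set) s t. interval_family a b I s t \<longrightarrow>
       (\<Sum>k\<in>I. t k - s k) < \<delta> \<longrightarrow> (\<Sum>k\<in>I. dist (\<gamma> (s k)) (\<gamma> (t k))) < \<epsilon> / C"
    using ac_small_variation[OF ac e, where 'i = nat] by (elim exE conjE)
  show "\<exists>\<delta>>0. \<forall>(I :: nat set) s t. interval_family c d I s t \<longrightarrow> (\<Sum>k\<in>I. t k - s k) < \<delta> \<longrightarrow>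
     (\<Sum>k\<in>I. dist (\<eta> (s k)) (\<eta> (t k))) < \<epsilon>"
  proof (intro exI[of _ \<delta>] conjI allI impI \<delta>)
    fix I :: "nat set" and s t
    assume I: "interval_family c d I s t" and sm: "(\<Sum>k\<in>I. t k - s k) < \<delta>"
    have I': "interval_family a b I s t" using I cd by (fastforce simp: interval_family_def)
    have "(\<Sum>k\<in>I. dist (\<eta> (s k)) (\<eta> (t k))) \<le> (\<Sum>k\<in>I. C * dist (\<gamma> (s k)) (\<gamma> (t k)))"
      using interval_familyD(2)[OF I] by (intro sum_mono le) auto
    also have "\<dots> = C * (\<Sum>k\<in>I. dist (\<gamma> (s k)) (\<gamma> (t k)))" by (simp add: sum_distrib_left)
    also have "\<dots> < C * (\<epsilon> / C)" by (rule mult_strict_left_mono[OF D[rule_format, OF I' sm] C])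
    finally show "(\<Sum>k\<in>I. dist (\<eta> (s k)) (\<eta> (t k))) < \<epsilon>" using C by simp
  qed
qed

lemma ac_lipschitz_image:
  fixes \<gamma> :: "real \<Rightarrow> 'b::metric_space" and T :: "'b \<Rightarrow> 'c::metric_space"
  assumes ac: "abs_continuous_on_interval a b \<gamma>" and C: "C > 0" "\<And>x y. dist (T x) (T y) \<le> C * dist x y"
  shows "abs_continuous_on_interval a b (\<lambda>t. T (\<gamma> t))"
  by (rule ac_comparison[OF ac order_refl order_refl C(1)]) (rule C(2))

lemma ac_subinterval:
  assumes ac: "abs_continuous_on_interval a b \<gamma>" and "a \<le> c" "d \<le> b"
  shows "abs_continuous_on_interval c d \<gamma>"
  by (rule ac_comparison[OF ac assms(2,3) zero_less_one]) simp

lemma ac_cong: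
  assumes ac: "abs_continuous_on_interval a b \<gamma>" and eq: "\<And>t. t \<in> {a..b} \<Longrightarrow> \<eta> t = \<gamma> t"
  shows "abs_continuous_on_interval a b \<eta>"
  by (rule ac_comparison[OF ac order_refl order_refl zero_less_one]) (simp add: eq)

lemma ac_join:
  assumes ac1: "abs_continuous_on_interval a b \<gamma>" and ac2: "abs_continuous_on_interval b c \<gamma>"
    and "a \<le> b" "b \<le> c"
  shows "abs_continuous_on_interval a c \<gamma>"
proof (rule ac_if_small_variation)
  fix \<epsilon> :: real assume "\<epsilon> > 0"
  then have e: "\<epsilon> / 2 > 0" by simp
  obtain \<delta>1 where \<delta>1: "\<delta>1 > 0" and D1: "\<forall>(I :: nat set) s t. interval_family a b I s t \<longrightarrow>
       (\<Sum>k\<in>I. t k - s k) < \<delta>1 \<longrightarrow> (\<Sum>k\<in>I. dist (\<gamma> (s k)) (\<gamma> (t k))) < \<epsilon>/2"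
    using ac_small_variation[OF ac1 e, where 'i = nat] by (elim exE conjE)
  obtain \<delta>2 where \<delta>2: "\<delta>2 > 0" and D2: "\<forall>(I :: nat set) s t. interval_family b c I s t \<longrightarrow>
       (\<Sum>k\<in>I. t k - s k) < \<delta>2 \<longrightarrow> (\<Sum>k\<in>I. dist (\<gamma> (s k)) (\<gamma> (t k))) < \<epsilon>/2"
    using ac_small_variation[OF ac2 e, where 'i = nat] by (elim exE conjE)
  show "\<exists>\<delta>>0. \<forall>(I :: nat set) s t. interval_family a c I s t \<longrightarrow> (\<Sum>k\<in>I. t k - s k) < \<delta> \<longrightarrow>
     (\<Sum>k\<in>I. dist (\<gamma> (s k)) (\<gamma> (t k))) < \<epsilon>"
  proof (rule exI[of _ "min \<delta>1 \<delta>2"], intro conjI allI impI)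
    fix I :: "nat set" and s t
    assume I: "interval_family a c I s t" and sm: "(\<Sum>k\<in>I. t k - s k) < min \<delta>1 \<delta>2"
    note II = interval_familyD[OF I]
    let ?l = "\<lambda>r. min r b" and ?u = "\<lambda>r. max r b"
    have "(\<Sum>k\<in>I. ?l (t k) - ?l (s k)) \<le> (\<Sum>k\<in>I. t k - s k)"
      using II(2) by (intro sum_mono) (fastforce simp: min_def)
    then have A: "(\<Sum>k\<in>I. ?l (t k) - ?l (s k)) < \<delta>1" using sm by simp
    have "(\<Sum>k\<in>I. ?u (t k) - ?u (s k)) \<le> (\<Sum>k\<in>I. t k - s k)"
      using II(2) by (intro sum_mono) (fastforce simp: max_def)
    then have B: "(\<Sum>k\<in>I. ?u (t k) - ?u (s k)) < \<delta>2" using sm by simp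
    have "disjoint_family_on (\<lambda>k. {?l (s k)<..<?l (t k)}) I"
      by (rule disjoint_family_on_bisimulation[OF II(3)]) fastforce
    moreover have "disjoint_family_on (\<lambda>k. {?u (s k)<..<?u (t k)}) I"
      by (rule disjoint_family_on_bisimulation[OF II(3)]) fastforce
    moreover have "a \<le> ?l (s k) \<and> ?l (s k) \<le> ?l (t k) \<and> ?l (t k) \<le> b" "b \<le> ?u (s k) \<and> ?u (s k) \<le> ?u (t k) \<and> ?u (t k) \<le> c"
      if "k \<in> I" for k using II(2)[OF that] assms(3,4) by auto
    ultimately have fA: "interval_family a b I (\<lambda>k. ?l (s k)) (\<lambda>k. ?l (t k))"
      and fB: "interval_family b c I (\<lambda>k. ?u (s k)) (\<lambda>k. ?u (t k))"
      using II(1) unfolding interval_family_def by blast+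
    have "(\<Sum>k\<in>I. dist (\<gamma> (s k)) (\<gamma> (t k))) \<le>
        (\<Sum>k\<in>I. dist (\<gamma> (?l (s k))) (\<gamma> (?l (t k))) + dist (\<gamma> (?u (s k))) (\<gamma> (?u (t k))))"
    proof (rule sum_mono)
      fix k assume "k \<in> I"
      then have "s k \<le> t k" using II(2) by blast
      then show "dist (\<gamma> (s k)) (\<gamma> (t k)) \<le> dist (\<gamma> (?l (s k))) (\<gamma> (?l (t k))) + dist (\<gamma> (?u (s k))) (\<gamma> (?u (t k)))"
        by (auto simp: min_def max_def dist_triangle)
    qed
    also have "\<dots> = (\<Sum>k\<in>I. dist (\<gamma> (?l (s k))) (\<gamma> (?l (t k)))) + (\<Sum>k\<in>I. dist (\<gamma> (?u (s k))) (\<gamma> (?u (t k))))"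
      by (rule sum.distrib)
    also have "(\<Sum>k\<in>I. dist (\<gamma> (?l (s k))) (\<gamma> (?l (t k)))) < \<epsilon>/2" by (rule D1[rule_format, OF fA A])
    also have "(\<Sum>k\<in>I. dist (\<gamma> (?u (s k))) (\<gamma> (?u (t k)))) < \<epsilon>/2" by (rule D2[rule_format, OF fB B])
    finally show "(\<Sum>k\<in>I. dist (\<gamma> (s k)) (\<gamma> (t k))) < \<epsilon>" by simp
  qed (use \<delta>1 \<delta>2 in simp)
qed

lemma ac_affine_reparametrisation:
  fixes \<gamma> :: "real \<Rightarrow> 'b::metric_space"
  assumes ac: "abs_continuous_on_interval a b \<gamma>" and \<sigma>: "\<sigma> = 1 \<or> \<sigma> = -1"
    and img: "\<And>r. c \<le> r \<Longrightarrow> r \<le> d \<Longrightarrow> a \<le> \<sigma> * r + k \<and> \<sigma> * r + k \<le> b"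
  shows "abs_continuous_on_interval c d (\<lambda>r. \<gamma> (\<sigma> * r + k))"
proof (rule ac_if_small_variation)
  fix \<epsilon> :: real assume e: "\<epsilon> > 0"
  obtain \<delta> where \<delta>: "\<delta> > 0" and D: "\<forall>(I :: nat set) s t. interval_family a b I s t \<longrightarrow>
       (\<Sum>k\<in>I. t k - s k) < \<delta> \<longrightarrow> (\<Sum>k\<in>I. dist (\<gamma> (s k)) (\<gamma> (t k))) < \<epsilon>"
    using ac_small_variation[OF ac e, where 'i = nat] by (elim exE conjE)
  show "\<exists>\<delta>>0. \<forall>(I :: nat set) s t. interval_family c d I s t \<longrightarrow> (\<Sum>k\<in>I. t k - s k) < \<delta> \<longrightarrow>
     (\<Sum>i\<in>I. dist (\<gamma> (\<sigma> * s i + k)) (\<gamma> (\<sigma> * t i + k))) < \<epsilon>"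
  proof (intro exI[of _ \<delta>] conjI allI impI \<delta>)
    fix I :: "nat set" and s t
    assume I: "interval_family c d I s t" and sm: "(\<Sum>k\<in>I. t k - s k) < \<delta>"
    note II = interval_familyD[OF I]
    \<comment> \<open>For \<open>\<sigma> = -1\<close> the end points of each interval are interchanged.\<close>
    define s' t' where "s' i = min (\<sigma> * s i + k) (\<sigma> * t i + k)" and "t' i = max (\<sigma> * s i + k) (\<sigma> * t i + k)" for i
    have in_ab: "a \<le> s' i \<and> s' i \<le> t' i \<and> t' i \<le> b" if "i \<in> I" for i
      using img[of "s i"] img[of "t i"] II(2)[OF that] by (auto simp: s'_def t'_def)
    have inv: "\<sigma> * (y - k) \<in> {s i<..<t i}" if "i \<in> I" "y \<in> {s' i<..<t' i}" for i y
      using \<sigma> that(2) II(2)[OF that(1)] by (elim disjE) (simp_all add: s'_def t'_def)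
    have "disjoint_family_on (\<lambda>i. {s' i<..<t' i}) I"
      unfolding disjoint_family_on_def
    proof (intro ballI impI equals0I)
      fix i j y assume ij: "i \<in> I" "j \<in> I" "i \<noteq> j" and y: "y \<in> {s' i<..<t' i} \<inter> {s' j<..<t' j}"
      have "\<sigma> * (y - k) \<in> {s i<..<t i} \<inter> {s j<..<t j}" using y inv ij by blast
      then show False using disjoint_family_onD[OF II(3) ij] by blast
    qed
    then have fam: "interval_family a b I s' t'" using II(1) in_ab by (simp add: interval_family_def)
    have "t' i - s' i = t i - s i" if "i \<in> I" for i using \<sigma> II(2)[OF that] by (auto simp: s'_def t'_def)
    then have "(\<Sum>i\<in>I. t' i - s' i) < \<delta>" using sm by simp
    then have "(\<Sum>i\<in>I. dist (\<gamma> (s' i)) (\<gamma> (t' i))) < \<epsilon>" by (rule D[rule_format, OF fam])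
    moreover have "dist (\<gamma> (s' i)) (\<gamma> (t' i)) = dist (\<gamma> (\<sigma> * s i + k)) (\<gamma> (\<sigma> * t i + k))" for i
      by (auto simp: s'_def t'_def min_def max_def dist_commute)
    ultimately show "(\<Sum>i\<in>I. dist (\<gamma> (\<sigma> * s i + k)) (\<gamma> (\<sigma> * t i + k))) < \<epsilon>" by simp
  qed
qed

lemma ac_differentiable_ae:
  fixes \<gamma> :: "real \<Rightarrow> 'b::euclidean_space"
  assumes ac: "abs_continuous_on_interval a b \<gamma>"
  shows "negligible {x \<in> {a..b}. \<not> \<gamma> differentiable (at x)}"
proof -
  have "{x \<in> {a..b}. \<not> \<gamma> differentiable (at x)} \<subseteq> (\<Union>i\<in>Basis. {x \<in> {a..b}. \<not> (\<lambda>t. \<gamma> t \<bullet> i) differentiable (at x)})"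
    using differentiable_componentwise_within[of \<gamma> _ UNIV] by blast
  moreover have "negligible {x \<in> {a..b}. \<not> (\<lambda>t. \<gamma> t \<bullet> i) differentiable (at x)}" if "i \<in> Basis" for i
  proof (rule ac_real_differentiable_ae, rule ac_lipschitz_image[OF ac zero_less_one])
    show "dist (x \<bullet> i) (y \<bullet> i) \<le> 1 * dist x y" for x y :: 'b
      using Basis_le_norm[OF that, of "x - y"] by (simp add: dist_norm inner_diff_left)
  qed
  moreover have "negligible (\<Union>i\<in>(Basis::'b set). {x \<in> {a..b}. \<not> (\<lambda>t. \<gamma> t \<bullet> i) differentiable (at x)})"
    using calculation(2) by (intro negligible_Union) auto
  ultimately show ?thesis by (metis (no_types, lifting) negligible_subset)
qed

text \<open>Tags outside the exceptional null set are controlled by the derivative; the intervals tagged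
  inside it lie in an open set of small measure, so their increments are small by absolute
  continuity.\<close>

lemma ac_has_integral_derivative:
  fixes \<gamma> :: "real \<Rightarrow> 'b::euclidean_space"
  assumes ac: "abs_continuous_on_interval a b \<gamma>" and ab: "a \<le> b"
  shows "((\<lambda>t. vector_derivative \<gamma> (at t within {a..b})) has_integral (\<gamma> b - \<gamma> a)) {a..b}"
proof -
  let ?v = "\<lambda>t. vector_derivative \<gamma> (at t within {a..b})"
  define N where "N = {x \<in> {a..b}. \<not> \<gamma> differentiable (at x)}"
  have N: "negligible N" unfolding N_def by (rule ac_differentiable_ae[OF ac])
  define g where "g t = (if t \<in> N then 0 else ?v t)" for t
  have der: "(\<gamma> has_vector_derivative g t) (at t within {a..b})" if "t \<in> {a..b}" "t \<notin> N" for t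
    using that vector_derivative_works[of \<gamma> "at t within {a..b}"] differentiable_at_withinI[of \<gamma> t "{a..b}"]
    by (simp add: N_def g_def)
  have "(g has_integral (\<gamma> b - \<gamma> a)) {a..b}"
    unfolding has_integral_real
  proof (intro allI impI)
    fix e :: real assume e: "e > 0"
    then have e2: "e / 2 > 0" by simp
    define e1 where "e1 = e / (2 * (b - a + 1))"
    have e1: "e1 > 0" using e ab by (simp add: e1_def)
    have "e1 * (b - a) = e / 2 * ((b - a) / (b - a + 1))" unfolding e1_def by simp
    also have "\<dots> \<le> e / 2 * 1" using e ab by (intro mult_left_mono) auto
    finally have e1': "e1 * (b - a) \<le> e / 2" by simp
    obtain \<delta> where \<delta>: "\<delta> > 0" and D: "\<forall>(I :: (real \<times> real set) set) s t. interval_family a b I s t \<longrightarrow>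
       (\<Sum>k\<in>I. t k - s k) < \<delta> \<longrightarrow> (\<Sum>k\<in>I. dist (\<gamma> (s k)) (\<gamma> (t k))) < e / 2"
      using ac_small_variation[OF ac e2, where 'i = "real \<times> real set"] by (elim exE conjE)
    obtain G where G: "open G" "N \<subseteq> G" "G - N \<in> lmeasurable" "emeasure lebesgue (G - N) < ennreal \<delta>"
      using sets_lebesgue_outer_open[OF negligible_imp_sets[OF N] \<delta>] by blast
    have lmN: "N \<in> lmeasurable" "measure lebesgue N = 0" using N negligible_iff_measure by blast+
    have GN: "G = (G - N) \<union> N" using G(2) by blast
    have lmG: "G \<in> lmeasurable" using fmeasurable.Un[OF G(3) lmN(1)] GN by simp
    have "measure lebesgue G \<le> measure lebesgue (G - N) + measure lebesgue N"
      using measure_Un_le[of "G - N" lebesgue N] G(3) lmN GN by (metis fmeasurableD)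
    also have "\<dots> < \<delta>" using G(3,4) lmN(2) \<delta> by (metis emeasure_eq_measure2 ennreal_less_iff measure_nonneg add_0_right)
    finally have mG: "measure lebesgue G < \<delta>" .
    have "\<exists>r>0. (x \<in> N \<longrightarrow> ball x r \<subseteq> G) \<and> (x \<in> {a..b} \<and> x \<notin> N \<longrightarrow>
        (\<forall>y\<in>{a..b}. \<bar>y - x\<bar> < r \<longrightarrow> norm (\<gamma> y - \<gamma> x - (y - x) *\<^sub>R g x) \<le> e1 * \<bar>y - x\<bar>))" for x
    proof -
      consider "x \<in> N" | "x \<in> {a..b}" "x \<notin> N" | "x \<notin> {a..b}" "x \<notin> N" by blast
      then show ?thesis
      proof cases
        case 1 then show ?thesis using G(1,2) by (meson openE subsetD)
      next
        case 2
        have "\<forall>e>0. \<exists>d>0. \<forall>y\<in>{a..b}. norm (y - x) < d \<longrightarrow> norm (\<gamma> y - \<gamma> x - (y - x) *\<^sub>R g x) \<le> e * norm (y - x)"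
          using der[OF 2] unfolding has_vector_derivative_def has_derivative_within_alt by blast
        then have "\<exists>d>0. \<forall>y\<in>{a..b}. norm (y - x) < d \<longrightarrow> norm (\<gamma> y - \<gamma> x - (y - x) *\<^sub>R g x) \<le> e1 * norm (y - x)" using e1 by blast
        then show ?thesis using 2 by auto
      next
        case 3 then show ?thesis by (intro exI[of _ 1]) auto
      qed
    qed
    then obtain r where r: "\<And>x. r x > 0" "\<And>x. x \<in> N \<Longrightarrow> ball x (r x) \<subseteq> G"
      "\<And>x y. x \<in> {a..b} \<Longrightarrow> x \<notin> N \<Longrightarrow> y \<in> {a..b} \<Longrightarrow> \<bar>y - x\<bar> < r x \<Longrightarrow> norm (\<gamma> y - \<gamma> x - (y - x) *\<^sub>R g x) \<le> e1 * \<bar>y - x\<bar>"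
      by metis
    show "\<exists>d. gauge d \<and> (\<forall>p. p tagged_division_of {a..b} \<and> d fine p \<longrightarrow>
       norm ((\<Sum>(x, k)\<in>p. measure lborel k *\<^sub>R g x) - (\<gamma> b - \<gamma> a)) < e)"
    proof (intro exI[of _ "\<lambda>x. ball x (r x)"] conjI allI impI)
      show "gauge (\<lambda>x. ball x (r x))" using r(1) gauge_ball_dependent by blast
      fix p assume "p tagged_division_of {a..b} \<and> (\<lambda>x. ball x (r x)) fine p"
      then have p: "p tagged_division_of {a..b}" and fine: "(\<lambda>x. ball x (r x)) fine p" by blast+
      have finp: "finite p" using p by blast
      define u v where "u i = Inf (snd i)" and "v i = Sup (snd i)" for i :: "real \<times> real set"
      have el: "snd i = {u i..v i} \<and> u i \<le> fst i \<and> fst i \<le> v i \<and> a \<le> u i \<and> v i \<le> b \<and> {u i..v i} \<subseteq> ball (fst i) (r (fst i))"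
        if i: "i \<in> p" for i
      proof -
        have ik: "(fst i, snd i) \<in> p" using i by simp
        obtain c d where cd: "snd i = cbox c d" using tagged_division_ofD(4)[OF p ik] by blast
        have "fst i \<in> snd i" "snd i \<subseteq> {a..b}" using tagged_division_ofD(2,3)[OF p ik] by auto
        moreover have "snd i \<subseteq> ball (fst i) (r (fst i))" using fine ik unfolding fine_def by blast
        moreover have "c \<le> d" using \<open>fst i \<in> snd i\<close> cd by auto
        ultimately show ?thesis using cd by (auto simp: u_def v_def)
      qed
      have total: "b - a = (\<Sum>i\<in>p. v i - u i)" "\<gamma> b - \<gamma> a = (\<Sum>i\<in>p. \<gamma> (v i) - \<gamma> (u i))"
        using additive_tagged_division_1[OF ab p, of "\<lambda>x. x"] additive_tagged_division_1[OF ab p, of \<gamma>]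
        by (simp_all add: u_def v_def case_prod_unfold)
      have dis: "disjoint_family_on (\<lambda>i. {u i<..<v i}) p"
        unfolding disjoint_family_on_def
      proof (intro ballI impI)
        fix i j assume ij: "i \<in> p" "j \<in> p" "i \<noteq> j"
        have "interior (snd i) \<inter> interior (snd j) = {}"
          using tagged_division_ofD(5)[OF p, of "fst i" "snd i" "fst j" "snd j"] ij by simp
        then show "{u i<..<v i} \<inter> {u j<..<v j} = {}"
          using el[OF ij(1)] el[OF ij(2)] by (simp add: interior_atLeastAtMost_real)
      qed
      define pN where "pN = {i \<in> p. fst i \<in> N}"
      have pN: "pN \<subseteq> p" "finite pN" using finp by (auto simp: pN_def)
      have uvN: "a \<le> u i \<and> u i \<le> v i \<and> v i \<le> b" if "i \<in> pN" for i
        using el[of i] that pN(1) by auto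
      have famN: "interval_family a b pN u v"
        unfolding interval_family_def using pN(2) uvN disjoint_family_on_mono[OF pN(1) dis] by blast
      have "(\<Sum>i\<in>pN. v i - u i) = measure lebesgue (\<Union>i\<in>pN. {u i<..<v i})"
        by (rule measure_disjoint_intervals[OF famN, symmetric])
      also have "\<dots> \<le> measure lebesgue G"
      proof (rule measure_mono_fmeasurable[OF _ _ lmG])
        show "(\<Union>i\<in>pN. {u i<..<v i}) \<subseteq> G"
        proof (rule UN_least)
          fix i assume "i \<in> pN"
          then have "{u i..v i} \<subseteq> G" using el[of i] r(2)[of "fst i"] by (auto simp: pN_def)
          then show "{u i<..<v i} \<subseteq> G" by auto
        qed
      qed (use pN in auto)
      also have "\<dots> < \<delta>" by (rule mG)
      finally have smN: "(\<Sum>i\<in>pN. v i - u i) < \<delta>" .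
      have "(\<Sum>i\<in>pN. dist (\<gamma> (u i)) (\<gamma> (v i))) < e / 2"
        by (rule D[rule_format, OF famN smN])
      moreover have "norm (\<Sum>i\<in>pN. measure lborel (snd i) *\<^sub>R g (fst i) - (\<gamma> (v i) - \<gamma> (u i))) \<le> (\<Sum>i\<in>pN. dist (\<gamma> (u i)) (\<gamma> (v i)))"
        by (intro sum_norm_le) (auto simp: pN_def g_def dist_norm norm_minus_commute)
      moreover have "norm (\<Sum>i\<in>p - pN. measure lborel (snd i) *\<^sub>R g (fst i) - (\<gamma> (v i) - \<gamma> (u i))) \<le> (\<Sum>i\<in>p - pN. e1 * (v i - u i))"
      proof (intro sum_norm_le)
        fix i assume i: "i \<in> p - pN"
        then have i': "i \<in> p" "fst i \<notin> N" by (auto simp: pN_def)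
        let ?x = "fst i"
        have e: "u i \<le> ?x" "?x \<le> v i" "a \<le> u i" "v i \<le> b" "snd i = {u i..v i}" using el[OF i'(1)] by auto
        have xab: "?x \<in> {a..b}" "u i \<in> {a..b}" "v i \<in> {a..b}" using e by auto
        have "u i \<in> ball ?x (r ?x)" "v i \<in> ball ?x (r ?x)" using el[OF i'(1)] e by (meson atLeastAtMost_iff order_refl order_trans subsetD)+
        then have "\<bar>u i - ?x\<bar> < r ?x" "\<bar>v i - ?x\<bar> < r ?x" by (auto simp: dist_real_def)
        then have "norm (\<gamma> (u i) - \<gamma> ?x - (u i - ?x) *\<^sub>R g ?x) \<le> e1 * \<bar>u i - ?x\<bar>"
           "norm (\<gamma> (v i) - \<gamma> ?x - (v i - ?x) *\<^sub>R g ?x) \<le> e1 * \<bar>v i - ?x\<bar>"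
          using r(3)[OF xab(1) i'(2) xab(2)] r(3)[OF xab(1) i'(2) xab(3)] by blast+
        moreover have "e1 * \<bar>u i - ?x\<bar> + e1 * \<bar>v i - ?x\<bar> = e1 * (v i - u i)"
          using e by (simp add: algebra_simps)
        ultimately have "norm (\<gamma> (u i) - \<gamma> ?x - (u i - ?x) *\<^sub>R g ?x) + norm (\<gamma> (v i) - \<gamma> ?x - (v i - ?x) *\<^sub>R g ?x) \<le> e1 * (v i - u i)"
          by linarith
        moreover have "measure lborel (snd i) *\<^sub>R g ?x - (\<gamma> (v i) - \<gamma> (u i)) =
           (\<gamma> (u i) - \<gamma> ?x - (u i - ?x) *\<^sub>R g ?x) - (\<gamma> (v i) - \<gamma> ?x - (v i - ?x) *\<^sub>R g ?x)"
          using e by (simp add: algebra_simps)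
        ultimately show "norm (measure lborel (snd i) *\<^sub>R g ?x - (\<gamma> (v i) - \<gamma> (u i))) \<le> e1 * (v i - u i)"
          using norm_triangle_ineq4 by (metis order_trans)
      qed
      moreover have "(\<Sum>i\<in>p - pN. e1 * (v i - u i)) \<le> e / 2"
      proof -
        have "(\<Sum>i\<in>p - pN. e1 * (v i - u i)) \<le> (\<Sum>i\<in>p. e1 * (v i - u i))"
        proof (rule sum_mono2[OF finp])
          fix i assume "i \<in> p - (p - pN)"
          then have "u i \<le> v i" using uvN[of i] by simp
          then show "0 \<le> e1 * (v i - u i)" using e1 by simp
        qed simp
        also have "\<dots> = e1 * (b - a)" using total(1) by (simp add: sum_distrib_left)
        finally show ?thesis using e1' by simp
      qed
      moreover have eq: "(\<Sum>(x, k)\<in>p. measure lborel k *\<^sub>R g x) - (\<gamma> b - \<gamma> a) =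
         (\<Sum>i\<in>pN. measure lborel (snd i) *\<^sub>R g (fst i) - (\<gamma> (v i) - \<gamma> (u i))) +
         (\<Sum>i\<in>p - pN. measure lborel (snd i) *\<^sub>R g (fst i) - (\<gamma> (v i) - \<gamma> (u i)))"
        unfolding total(2) case_prod_unfold sum_subtractf[symmetric]
        using sum.subset_diff[OF pN(1) finp, of "\<lambda>i. measure lborel (snd i) *\<^sub>R g (fst i) - (\<gamma> (v i) - \<gamma> (u i))"]
        by (simp add: add.commute)
      ultimately have "norm (\<Sum>i\<in>pN. measure lborel (snd i) *\<^sub>R g (fst i) - (\<gamma> (v i) - \<gamma> (u i))) +
          norm (\<Sum>i\<in>p - pN. measure lborel (snd i) *\<^sub>R g (fst i) - (\<gamma> (v i) - \<gamma> (u i))) < e" by linarith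
      then show "norm ((\<Sum>(x, k)\<in>p. measure lborel k *\<^sub>R g x) - (\<gamma> b - \<gamma> a)) < e"
        unfolding eq by (rule le_less_trans[OF norm_triangle_ineq])
    qed
  qed
  then show ?thesis
    by (rule has_integral_spike[OF N, rotated]) (simp add: g_def)
qed

lemma ac_derivative_measurable:
  fixes \<gamma> :: "real \<Rightarrow> 'b::euclidean_space"
  assumes ac: "abs_continuous_on_interval a b \<gamma>" and ab: "a \<le> b"
  shows "(\<lambda>t. indicator {a..b} t *\<^sub>R vector_derivative \<gamma> (at t within {a..b})) \<in> borel_measurable lebesgue"
  using has_integral_implies_lebesgue_measurable[OF ac_has_integral_derivative[OF ac ab]] .

lemma vector_derivative_within_subinterval:
  assumes "a \<le> c" "d \<le> b" "t \<in> {c<..<d}"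
  shows "vector_derivative \<gamma> (at t within {c..d}) = vector_derivative \<gamma> (at t within {a..b})"
  using assms by (simp add: at_within_Icc_at)

text \<open>Pairing the derivative with a linear map \<open>T\<close> gives the estimate in the mass norm, with \<open>T\<close> the
  scaling by the masses. If the right-hand side is finite, the Henstock-Kurzweil integral of the
  derivative is a Lebesgue integral, to which the triangle inequality applies.\<close>

lemma ac_norm_increment_le:
  fixes \<gamma> :: "real \<Rightarrow> 'b::euclidean_space" and T :: "'b \<Rightarrow> 'c::euclidean_space"
  assumes ac: "abs_continuous_on_interval a b \<gamma>" and T: "bounded_linear T"
    and st: "a \<le> s" "s \<le> t" "t \<le> b"
  shows "ennreal (norm (T (\<gamma> t) - T (\<gamma> s))) \<le>
     (\<integral>\<^sup>+x\<in>{s..t}. ennreal (norm (T (vector_derivative \<gamma> (at x within {a..b})))) \<partial>lebesgue)"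
proof -
  let ?v = "\<lambda>x. vector_derivative \<gamma> (at x within {a..b})"
  let ?w = "\<lambda>x. vector_derivative \<gamma> (at x within {s..t})"
  have "(?w has_integral (\<gamma> t - \<gamma> s)) {s..t}"
    by (rule ac_has_integral_derivative[OF ac_subinterval[OF ac] st(2)]) (use st in auto)
  then have "(?v has_integral (\<gamma> t - \<gamma> s)) {s..t}"
  proof (rule has_integral_spike[rotated 2])
    show "negligible {s, t}" by simp
    show "?v x = ?w x" if "x \<in> {s..t} - {s, t}" for x
      using vector_derivative_within_subinterval[of a s t b x \<gamma>] that st by auto
  qed
  then have "((T \<circ> ?v) has_integral T (\<gamma> t - \<gamma> s)) {s..t}" using T by (rule has_integral_linear)
  then have hi: "((\<lambda>x. T (?v x)) has_integral (T (\<gamma> t) - T (\<gamma> s))) {s..t}"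
    by (simp add: o_def linear_diff[OF bounded_linear.linear[OF T]])
  let ?F = "\<lambda>x. indicator {s..t} x *\<^sub>R T (?v x)"
  have meas: "?F \<in> borel_measurable lebesgue" by (rule has_integral_implies_lebesgue_measurable[OF hi])
  have eq: "(\<integral>\<^sup>+x. ennreal (norm (?F x)) \<partial>lebesgue) = (\<integral>\<^sup>+x\<in>{s..t}. ennreal (norm (T (?v x))) \<partial>lebesgue)"
    by (intro nn_integral_cong) (auto simp: indicator_def)
  show ?thesis
  proof (cases "(\<integral>\<^sup>+x. ennreal (norm (?F x)) \<partial>lebesgue) < \<infinity>")
    case False
    then show ?thesis unfolding eq by (simp add: not_less top_unique)
  next
    case True
    then have int: "integrable lebesgue ?F" using meas by (intro integrableI_bounded)
    then have "set_integrable lebesgue {s..t} (\<lambda>x. T (?v x))" by (simp add: set_integrable_def)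
    then have "(LINT x:{s..t}|lebesgue. T (?v x)) = integral {s..t} (\<lambda>x. T (?v x))"
      by (rule set_lebesgue_integral_eq_integral(2))
    then have "integral\<^sup>L lebesgue ?F = T (\<gamma> t) - T (\<gamma> s)"
      using integral_unique[OF hi] by (simp add: set_lebesgue_integral_def)
    then show ?thesis using integral_norm_bound_ennreal[OF int] eq by simp
  qed
qed

section \<open>Mass norm, potential and action with values in the extended nonnegative reals\<close>

text \<open>Scaling the components by \<open>\<surd>m\<^sub>i\<close> turns the mass norm into the library norm.\<close>

definition mass_scale :: "('n::finite \<Rightarrow> real) \<Rightarrow> ('a::euclidean_space, 'n) config \<Rightarrow> ('a, 'n) config" where
  "mass_scale m x = (\<chi> i. sqrt (m i) *\<^sub>R x $ i)"

text \<open>The potential, the kinetic energy and the action take values in the extended nonnegative reals,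
  where integrals and limits of infinite potentials need no side conditions.\<close>

definition potential :: "('n::{finite,linorder} \<Rightarrow> real) \<Rightarrow> ('a::euclidean_space, 'n) config \<Rightarrow> ennreal" where
  "potential m x = (\<Sum>(i, j)\<in>{(i, j). i < j}. ennreal (m i * m j) / ennreal (norm (x $ i - x $ j)))"

definition kinetic :: "('n::finite \<Rightarrow> real) \<Rightarrow> ('a::euclidean_space, 'n) config \<Rightarrow> ennreal" where
  "kinetic m v = ennreal ((mass_norm m v)\<^sup>2 / 2)"

definition nn_action ::
    "('n::{finite,linorder} \<Rightarrow> real) \<Rightarrow> real \<Rightarrow> real \<Rightarrow> real \<Rightarrow> (real \<Rightarrow> ('a::euclidean_space, 'n) config) \<Rightarrow> ennreal" where
  "nn_action m h a b \<gamma> = (\<integral>\<^sup>+t\<in>{a..b}.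
     (kinetic m (vector_derivative \<gamma> (at t within {a..b})) + potential m (\<gamma> t) + ennreal h) \<partial>lebesgue)"

locale masses =
  fixes m :: "'n::{finite,linorder} \<Rightarrow> real"
  assumes mass_pos: "0 < m i"
begin

lemma bounded_linear_mass_scale: "bounded_linear (mass_scale m :: ('a::euclidean_space, 'n) config \<Rightarrow> _)"
  unfolding linear_conv_bounded_linear[symmetric]
  by (rule linearI) (simp_all add: mass_scale_def vec_eq_iff scaleR_add_right)

lemma mass_norm_eq: "mass_norm m x = norm (mass_scale m x)" for x :: "('a::euclidean_space, 'n) config"
proof -
  have "(norm (mass_scale m x $ i))\<^sup>2 = m i * (x $ i \<bullet> x $ i)" for i
    using mass_pos[of i] by (simp add: mass_scale_def power_mult_distrib power2_norm_eq_inner)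
  then show ?thesis unfolding mass_norm_def mass_inner_def norm_vec_def L2_set_def by simp
qed

lemma mass_scale_diff: "mass_scale m (x - y) = mass_scale m x - mass_scale m y"
  by (simp add: mass_scale_def vec_eq_iff scaleR_diff_right)

lemma mass_norm_minus_commute: "mass_norm m (x - y) = mass_norm m (y - x)"
  for x :: "('a::euclidean_space, 'n) config"
  unfolding mass_norm_eq mass_scale_diff by (rule norm_minus_commute)

lemma mass_norm_minus: "mass_norm m (- x) = mass_norm m x" for x :: "('a::euclidean_space, 'n) config"
  using mass_norm_minus_commute[of 0 x] by simp

lemma mass_norm_nonneg: "0 \<le> mass_norm m x" for x :: "('a::euclidean_space, 'n) config"
  by (simp add: mass_norm_eq)

lemma mass_norm_scaleR: "mass_norm m (c *\<^sub>R x) = \<bar>c\<bar> * mass_norm m x" for x :: "('a::euclidean_space, 'n) config"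
  by (simp add: mass_norm_eq linear_scale[OF bounded_linear.linear[OF bounded_linear_mass_scale]])

lemma continuous_on_mass_norm: "continuous_on S (mass_norm m :: ('a::euclidean_space, 'n) config \<Rightarrow> _)"
  unfolding mass_norm_eq by (intro continuous_intros bounded_linear.continuous_on[OF bounded_linear_mass_scale])

lemma mass_norm_le: "\<exists>C>0. \<forall>x :: ('a::euclidean_space, 'n) config. mass_norm m x \<le> C * norm x"
  using bounded_linear.pos_bounded[OF bounded_linear_mass_scale] unfolding mass_norm_eq by (metis mult.commute)

lemma norm_le_mass_norm: "\<exists>C>0. \<forall>x :: ('a::euclidean_space, 'n) config. norm x \<le> C * mass_norm m x"
proof -
  define R :: "('a, 'n) config \<Rightarrow> ('a, 'n) config" where "R = (\<lambda>x. \<chi> i. inverse (sqrt (m i)) *\<^sub>R x $ i)"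
  have "linear R" unfolding R_def by (rule linearI) (simp_all add: vec_eq_iff scaleR_add_right)
  then obtain C where C: "C > 0" "\<And>x. norm (R x) \<le> norm x * C"
    using bounded_linear.pos_bounded linear_conv_bounded_linear by blast
  have "R (mass_scale m x) = x" for x
    using mass_pos by (simp add: R_def mass_scale_def vec_eq_iff less_imp_neq[THEN not_sym])
  then have "norm x \<le> C * mass_norm m x" for x :: "('a, 'n) config"
    using C(2)[of "mass_scale m x"] by (simp add: mass_norm_eq mult.commute)
  then show ?thesis using C(1) by blast
qed

lemma newton_potential_eq: "newton_potential m x = enn2ereal (potential m x)"
  for x :: "('a::euclidean_space, 'n) config"
proof -
  have "ereal (m i * m j) / ereal (norm (x $ i - x $ j)) = enn2ereal (ennreal (m i * m j) / ennreal (norm (x $ i - x $ j)))" for i j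
    using mass_pos[of i] mass_pos[of j]
    by (simp add: divide_ennreal_def divide_ereal_def times_ennreal.rep_eq inverse_ennreal.rep_eq)
  then show ?thesis unfolding newton_potential_def potential_def
    by (simp add: case_prod_unfold)
qed

lemma continuous_on_potential: "continuous_on S (potential m :: ('a::euclidean_space, 'n) config \<Rightarrow> _)"
proof -
  have "continuous_on S (\<lambda>x :: ('a, 'n) config. ennreal (m i * m j) / ennreal (norm (x $ i - x $ j)))" for i j
    unfolding divide_ennreal_def
    by (intro ennreal_continuous_on_cmult continuous_on_inverse_ennreal continuous_on_ennreal continuous_intros) auto
  then show ?thesis unfolding potential_def case_prod_unfold by (intro continuous_on_sum) auto
qed

lemma tendsto_potential:
  fixes f :: "_ \<Rightarrow> ('a::euclidean_space, 'n) config"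
  assumes "(f \<longlongrightarrow> x) F"
  shows "((\<lambda>t. potential m (f t)) \<longlongrightarrow> potential m x) F"
  using continuous_on_tendsto_compose[OF continuous_on_potential[of UNIV] assms] by simp

lemma action_eq:
  fixes \<gamma> :: "real \<Rightarrow> ('a::euclidean_space, 'n) config"
  assumes "h \<ge> 0"
  shows "action m h (a, b, \<gamma>) = enn2ereal (nn_action m h a b \<gamma>)"
proof -
  have "lagrangian m x v + ereal h = enn2ereal (kinetic m v + potential m x + ennreal h)" for x v :: "('a, 'n) config"
    using assms by (simp add: lagrangian_def kinetic_def newton_potential_eq plus_ennreal.rep_eq)
  then show ?thesis unfolding action_def nn_action_def by simp
qed

lemma kinetic_minus: "kinetic m (- v) = kinetic m v" for v :: "('a::euclidean_space, 'n) config"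
  by (simp add: kinetic_def mass_norm_minus)

context
  fixes \<gamma> :: "real \<Rightarrow> ('a::euclidean_space, 'n) config" and a b :: real
  assumes ac: "abs_continuous_on_interval a b \<gamma>" and ab: "a \<le> b"
begin

lemma kinetic_measurable:
  "(\<lambda>t. kinetic m (vector_derivative \<gamma> (at t within {a..b})) * indicator {a..b} t) \<in> borel_measurable lebesgue"
proof -
  let ?w = "\<lambda>t. indicator {a..b} t *\<^sub>R vector_derivative \<gamma> (at t within {a..b})"
  have "?w \<in> borel_measurable lebesgue" by (rule ac_derivative_measurable[OF ac ab])
  moreover have "(mass_norm m :: ('a, 'n) config \<Rightarrow> real) \<in> borel_measurable borel"
    by (rule borel_measurable_continuous_onI[OF continuous_on_mass_norm])
  ultimately have "(\<lambda>t. mass_norm m (?w t)) \<in> borel_measurable lebesgue" by (rule measurable_compose)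
  then have "(\<lambda>t. ennreal ((mass_norm m (?w t))\<^sup>2 / 2)) \<in> borel_measurable lebesgue" by measurable
  also have "(\<lambda>t. ennreal ((mass_norm m (?w t))\<^sup>2 / 2)) =
      (\<lambda>t. kinetic m (vector_derivative \<gamma> (at t within {a..b})) * indicator {a..b} t)"
    by (auto simp: kinetic_def indicator_def mass_norm_eq mass_scale_def zero_vec_def[symmetric])
  finally show ?thesis .
qed

lemma potential_measurable: "(\<lambda>t. potential m (\<gamma> t) * indicator {a..b} t) \<in> borel_measurable lebesgue"
proof -
  have "continuous_on {a..b} (\<lambda>t. potential m (\<gamma> t))"
    by (rule continuous_on_compose2[OF continuous_on_potential[of UNIV] ac_imp_continuous_on[OF ac]]) simp
  then have "(\<lambda>t. potential m (\<gamma> t)) \<in> borel_measurable (restrict_space borel {a..b})"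
    by (rule borel_measurable_continuous_on_restrict)
  then have "(\<lambda>t. potential m (\<gamma> t) * indicator {a..b} t) \<in> borel_measurable borel"
    by (subst (asm) borel_measurable_restrict_space_iff_ennreal) auto
  then show ?thesis by (simp add: measurable_completion)
qed

lemma action_density_measurable:
  "(\<lambda>t. (kinetic m (vector_derivative \<gamma> (at t within {a..b})) + potential m (\<gamma> t) + ennreal h) * indicator {a..b} t)
     \<in> borel_measurable lebesgue"
  unfolding distrib_right by (intro borel_measurable_add kinetic_measurable potential_measurable borel_measurable_times_ennreal borel_measurable_indicator borel_measurable_const) simp

text \<open>For every \<open>c \<ge> 0\<close> the density of kinetic energy plus \<open>c\<close> is at least \<open>\<surd>(2 c)\<close> times the speed.\<close>

lemma displacement_le_energy:
  assumes st: "a \<le> s" "s \<le> t" "t \<le> b" and c: "c \<ge> 0"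
  shows "ennreal (sqrt (2 * c) * mass_norm m (\<gamma> t - \<gamma> s)) \<le>
    (\<integral>\<^sup>+x\<in>{s..t}. (kinetic m (vector_derivative \<gamma> (at x within {a..b})) + ennreal c) \<partial>lebesgue)"
proof -
  let ?v = "\<lambda>x. vector_derivative \<gamma> (at x within {a..b})"
  have T: "bounded_linear (\<lambda>x. sqrt (2 * c) *\<^sub>R mass_scale m x :: ('a, 'n) config)"
    by (intro bounded_linear_intros bounded_linear_mass_scale)
  have "ennreal (sqrt (2 * c) * mass_norm m (\<gamma> t - \<gamma> s)) =
      ennreal (norm (sqrt (2 * c) *\<^sub>R mass_scale m (\<gamma> t) - sqrt (2 * c) *\<^sub>R mass_scale m (\<gamma> s)))"
    using c by (simp add: mass_norm_eq mass_scale_diff scaleR_diff_right[symmetric])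
  also have "\<dots> \<le> (\<integral>\<^sup>+x\<in>{s..t}. ennreal (norm (sqrt (2 * c) *\<^sub>R mass_scale m (?v x))) \<partial>lebesgue)"
    by (rule ac_norm_increment_le[OF ac T st])
  also have "\<dots> \<le> (\<integral>\<^sup>+x\<in>{s..t}. (kinetic m (?v x) + ennreal c) \<partial>lebesgue)"
  proof (intro nn_integral_mono mult_right_mono)
    fix x
    let ?n = "mass_norm m (?v x)"
    have "0 \<le> (?n - sqrt (2 * c))\<^sup>2" by simp
    then have "sqrt (2 * c) * ?n \<le> ?n\<^sup>2 / 2 + c"
      using c by (simp add: power2_diff mult.commute[of "sqrt (2 * c)"])
    then have "ennreal (sqrt (2 * c) * ?n) \<le> ennreal (?n\<^sup>2 / 2 + c)" by (rule ennreal_leI)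
    then show "ennreal (norm (sqrt (2 * c) *\<^sub>R mass_scale m (?v x))) \<le> kinetic m (?v x) + ennreal c"
      using c by (simp add: kinetic_def mass_norm_eq[symmetric] ennreal_plus[symmetric] del: ennreal_plus)
  qed simp
  finally show ?thesis .
qed

lemma displacement_square_le:
  assumes st: "a \<le> s" "s \<le> t" "t \<le> b" and e: "e \<ge> 0"
    and K: "(\<integral>\<^sup>+x\<in>{s..t}. kinetic m (vector_derivative \<gamma> (at x within {a..b})) \<partial>lebesgue) \<le> ennreal e"
  shows "(mass_norm m (\<gamma> t - \<gamma> s))\<^sup>2 \<le> 2 * (t - s) * e"
proof (cases "s = t")
  case True then show ?thesis by (simp add: mass_norm_eq mass_scale_def zero_vec_def[symmetric])
next
  case False
  then have st': "t - s > 0" using st by simp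
  let ?v = "\<lambda>x. vector_derivative \<gamma> (at x within {a..b})"
  define d where "d = mass_norm m (\<gamma> t - \<gamma> s)"
  have d: "d \<ge> 0" by (simp add: d_def mass_norm_eq)
  \<comment> \<open>The optimal constant: half the square of the mean speed.\<close>
  define c where "c = d\<^sup>2 / (2 * (t - s)\<^sup>2)"
  have c: "c \<ge> 0" by (simp add: c_def)
  have sq: "sqrt (2 * c) = d / (t - s)" using d st' by (simp add: c_def real_sqrt_divide)
  have meas: "(\<lambda>x. kinetic m (?v x) * indicator {s..t} x) \<in> borel_measurable lebesgue"
  proof -
    have "(\<lambda>x. kinetic m (?v x) * indicator {s..t} x) = (\<lambda>x. (kinetic m (?v x) * indicator {a..b} x) * indicator {s..t} x)"
      using st by (auto simp: indicator_def)
    also have "\<dots> \<in> borel_measurable lebesgue"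
      by (intro borel_measurable_times_ennreal kinetic_measurable borel_measurable_indicator) simp
    finally show ?thesis .
  qed
  have "ennreal (sqrt (2 * c) * d) \<le> (\<integral>\<^sup>+x\<in>{s..t}. (kinetic m (?v x) + ennreal c) \<partial>lebesgue)"
    unfolding d_def by (rule displacement_le_energy[OF st c])
  also have "\<dots> = (\<integral>\<^sup>+x\<in>{s..t}. kinetic m (?v x) \<partial>lebesgue) + (\<integral>\<^sup>+x\<in>{s..t}. ennreal c \<partial>lebesgue)"
    unfolding distrib_right by (intro nn_integral_add meas borel_measurable_times_ennreal borel_measurable_indicator borel_measurable_const) simp
  also have "(\<integral>\<^sup>+x\<in>{s..t}. ennreal c \<partial>lebesgue) = ennreal (c * (t - s))"
    using st c by (simp add: nn_integral_cmult_indicator ennreal_mult)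
  also have "(\<integral>\<^sup>+x\<in>{s..t}. kinetic m (?v x) \<partial>lebesgue) + ennreal (c * (t - s)) \<le> ennreal (e + c * (t - s))"
    using K e c st' by (simp add: ennreal_plus add_right_mono)
  finally have "sqrt (2 * c) * d \<le> e + c * (t - s)" using e c st' by (subst (asm) ennreal_le_iff) auto
  then have "d / (t - s) * d \<le> e + d\<^sup>2 / (2 * (t - s)\<^sup>2) * (t - s)" unfolding sq by (simp add: c_def)
  also have "d\<^sup>2 / (2 * (t - s)\<^sup>2) * (t - s) = d\<^sup>2 / (2 * (t - s))" using st' by (simp add: power2_eq_square)
  finally have A: "d\<^sup>2 / (t - s) \<le> e + d\<^sup>2 / (2 * (t - s))" by (simp add: power2_eq_square)
  define q where "q = d\<^sup>2 / (2 * (t - s))"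
  have q: "d\<^sup>2 = 2 * (t - s) * q" using st' by (simp add: q_def)
  have B: "d\<^sup>2 / (t - s) = 2 * q" using st' q by (simp add: divide_eq_eq mult.commute mult.left_commute)
  have "2 * q \<le> e + q" using A by (simp only: B q_def[symmetric])
  then have "q \<le> e" by simp
  then show ?thesis using st' unfolding d_def[symmetric] q by (simp add: mult_left_mono)
qed

end

lemma nn_action_split:
  fixes \<gamma> :: "real \<Rightarrow> ('a::euclidean_space, 'n) config"
  assumes ac: "abs_continuous_on_interval a c \<gamma>" and abc: "a \<le> b" "b \<le> c"
  shows "nn_action m h a c \<gamma> = nn_action m h a b \<gamma> + nn_action m h b c \<gamma>"
proof -
  let ?L = "\<lambda>S t. (kinetic m (vector_derivative \<gamma> (at t within S)) + potential m (\<gamma> t) + ennreal h) * indicator S t"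
  have ac1: "abs_continuous_on_interval a b \<gamma>" and ac2: "abs_continuous_on_interval b c \<gamma>"
    using ac_subinterval[OF ac] abc by auto
  have "negligible {a, b, c}" by simp
  then have ae: "AE t in lebesgue. t \<notin> {a, b, c}"
    by (simp only: negligible_iff_null_sets AE_not_in)
  have "nn_action m h a c \<gamma> = (\<integral>\<^sup>+t. ?L {a..b} t + ?L {b..c} t \<partial>lebesgue)"
    unfolding nn_action_def
  proof (rule nn_integral_cong_AE, rule AE_mp[OF ae], rule AE_I2, rule impI)
    fix t assume t: "t \<notin> {a, b, c}"
    consider "t \<in> {a<..<b}" | "t \<in> {b<..<c}" | "t \<notin> {a..c}" using t abc by force
    then show "?L {a..c} t = ?L {a..b} t + ?L {b..c} t"
    proof cases
      case 1 then show ?thesis using vector_derivative_within_subinterval[of a a b c t \<gamma>] abc by (simp add: indicator_def)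
    next
      case 2 then show ?thesis using vector_derivative_within_subinterval[of a b c c t \<gamma>] abc by (simp add: indicator_def)
    next
      case 3 then show ?thesis using abc by (auto simp: indicator_def)
    qed
  qed
  also have "\<dots> = nn_action m h a b \<gamma> + nn_action m h b c \<gamma>"
    unfolding nn_action_def
    by (intro nn_integral_add action_density_measurable ac1 ac2 abc)
  finally show ?thesis .
qed

lemma nn_action_cong:
  fixes \<gamma> :: "real \<Rightarrow> ('a::euclidean_space, 'n) config"
  assumes eq: "\<And>t. t \<in> {a..b} \<Longrightarrow> \<eta> t = \<gamma> t"
  shows "nn_action m h a b \<eta> = nn_action m h a b \<gamma>"
proof -
  have "(\<eta> has_vector_derivative D) (at t within {a..b}) \<longleftrightarrow> (\<gamma> has_vector_derivative D) (at t within {a..b})"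
    if "t \<in> {a..b}" for t D
    using that eq has_vector_derivative_transform[of t "{a..b}"] by (metis (full_types))
  then have "vector_derivative \<eta> (at t within {a..b}) = vector_derivative \<gamma> (at t within {a..b})" if "t \<in> {a..b}" for t
    using that by (simp add: vector_derivative_def)
  then show ?thesis unfolding nn_action_def using eq
    by (intro nn_integral_cong) (simp add: indicator_def)
qed

text \<open>The factor \<open>\<sigma>\<close> covers time shifts (\<open>\<sigma> = 1\<close>) and time reversal (\<open>\<sigma> = -1\<close>). Differentiability
  almost everywhere is essential here: at other points \<^const>\<open>vector_derivative\<close> is an arbitrary value,
  which need not transform by the chain rule.\<close>

lemma nn_action_affine_reparametrisation:
  fixes \<gamma> :: "real \<Rightarrow> ('a::euclidean_space, 'n) config"
  assumes ac: "abs_continuous_on_interval a b \<gamma>" and \<sigma>: "\<sigma> = 1 \<or> \<sigma> = -1" and ab: "a \<le> b"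
    and img: "\<And>r. \<sigma> * r + k \<in> {a..b} \<longleftrightarrow> r \<in> {c..d}"
  shows "nn_action m h c d (\<lambda>r. \<gamma> (\<sigma> * r + k)) = nn_action m h a b \<gamma>"
proof -
  let ?L = "\<lambda>t. (kinetic m (vector_derivative \<gamma> (at t within {a..b})) + potential m (\<gamma> t) + ennreal h) * indicator {a..b} t"
  let ?\<eta> = "\<lambda>r. \<gamma> (\<sigma> * r + k)"
  have \<sigma>0: "\<sigma> \<noteq> 0" "\<bar>\<sigma>\<bar> = 1" using \<sigma> by auto
  define N where "N = {x \<in> {a..b}. \<not> \<gamma> differentiable (at x)} \<union> {a, b}"
  have N: "negligible N" unfolding N_def using ac_differentiable_ae[OF ac] by (intro negligible_Un) auto
  have "negligible ((\<lambda>y. \<sigma> * (y - k)) ` N)"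
  proof (rule negligible_differentiable_image_negligible[OF order_refl N])
    show "(\<lambda>y. \<sigma> * (y - k)) differentiable_on N" unfolding differentiable_on_def by (intro ballI derivative_intros) 
  qed
  then have ae: "AE r in lebesgue. r \<notin> (\<lambda>y. \<sigma> * (y - k)) ` N"
    by (simp only: negligible_iff_null_sets AE_not_in)
  have "nn_action m h a b \<gamma> = (\<integral>\<^sup>+r. ?L (k + \<sigma> * r) \<partial>lebesgue)"
    unfolding nn_action_def using nn_integral_real_affine_lebesgue[OF action_density_measurable[OF ac ab] \<sigma>0(1), of h k] \<sigma>0(2)
    by simp
  also have "\<dots> = nn_action m h c d ?\<eta>"
    unfolding nn_action_def
  proof (rule nn_integral_cong_AE, rule AE_mp[OF ae], rule AE_I2, rule impI)
    fix r assume r: "r \<notin> (\<lambda>y. \<sigma> * (y - k)) ` N"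
    let ?y = "\<sigma> * r + k"
    have yr: "r = \<sigma> * (?y - k)" using \<sigma> by auto
    then have yN: "?y \<notin> N" using r by blast
    show "?L (k + \<sigma> * r) = (kinetic m (vector_derivative ?\<eta> (at r within {c..d})) + potential m (?\<eta> r) + ennreal h) * indicator {c..d} r"
    proof (cases "r \<in> {c..d}")
      case False
      then have "k + \<sigma> * r \<notin> {a..b}" using img[of r] by (simp add: add.commute)
      then show ?thesis using False by (simp only: indicator_simps mult_zero_right simp_thms)
    next
      case True
      then have y: "?y \<in> {a..b}" using img by blast
      then have yi: "a < ?y" "?y < b" and dif: "\<gamma> differentiable (at ?y)" using yN by (auto simp: N_def)
      let ?D = "vector_derivative \<gamma> (at ?y)"
      have D: "(\<gamma> has_vector_derivative ?D) (at ?y)" using dif vector_derivative_works by blast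
      have "((\<lambda>r. \<sigma> * r + k) has_vector_derivative \<sigma>) (at r)" by (auto intro!: derivative_eq_intros)
      then have D\<eta>: "(?\<eta> has_vector_derivative \<sigma> *\<^sub>R ?D) (at r)"
        using vector_diff_chain_at[of "\<lambda>r. \<sigma> * r + k" \<sigma> r \<gamma> ?D] D by (simp add: o_def)
      have cd: "c < d"
      proof -
        have "\<exists>r'. r' \<noteq> r \<and> \<sigma> * r' + k \<in> {a..b}"
        proof -
          obtain z where "?y < z" "z < b" using dense[OF yi(2)] by blast
          then show ?thesis using yi \<sigma> by (intro exI[of _ "\<sigma> * (z - k)"]) auto
        qed
        then show ?thesis using img True by force
      qed
      have "vector_derivative ?\<eta> (at r within {c..d}) = \<sigma> *\<^sub>R ?D"
        by (rule vector_derivative_within_closed_interval[OF cd True has_vector_derivative_at_within[OF D\<eta>]])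
      moreover have "vector_derivative \<gamma> (at ?y within {a..b}) = ?D" using yi by (simp add: at_within_Icc_at)
      moreover have "kinetic m (\<sigma> *\<^sub>R ?D) = kinetic m ?D" using \<sigma> kinetic_minus by auto
      ultimately show ?thesis using y True by (simp add: add.commute[of k "\<sigma> * r"])
    qed
  qed
  finally show ?thesis by simp
qed

end

section \<open>Symmetry and triangle inequality of the action potential\<close>

definition phi ::
    "('n::{finite,linorder} \<Rightarrow> real) \<Rightarrow> real \<Rightarrow> ('a::euclidean_space, 'n) config \<Rightarrow> ('a, 'n) config \<Rightarrow> ennreal" where
  "phi m h x y = (INF (a, b, \<gamma>)\<in>curves x y. nn_action m h a b \<gamma>)"

lemma ennreal_less_add_epsilon:
  fixes x :: ennreal
  assumes "x < top" "0 < e"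
  shows "x < x + ennreal e"
  using assms by (cases x) (auto simp: ennreal_plus[symmetric] ennreal_less_iff simp del: ennreal_plus)

context masses
begin

lemma action_potential_eq:
  fixes x y :: "('a::euclidean_space, 'n) config"
  assumes "h \<ge> 0"
  shows "action_potential m h x y = enn2ereal (phi m h x y)"
proof -
  have "action_potential m h x y = Inf (enn2ereal ` (\<lambda>(a, b, \<gamma>). nn_action m h a b \<gamma>) ` curves x y)"
    unfolding action_potential_def image_image using action_eq[OF assms]
    by (intro arg_cong[where f = Inf] image_cong refl) auto
  also have "\<dots> = enn2ereal (phi m h x y)" unfolding phi_def by (simp add: Inf_ennreal.rep_eq)
  finally show ?thesis .
qed

lemma phi_le:
  fixes x y :: "('a::euclidean_space, 'n) config"
  assumes "a < b" "abs_continuous_on_interval a b \<gamma>" "\<gamma> a = x" "\<gamma> b = y"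
  shows "phi m h x y \<le> nn_action m h a b \<gamma>"
  unfolding phi_def by (rule INF_lower2[of "(a, b, \<gamma>)"]) (use assms in \<open>auto simp: curves_def\<close>)

lemma curve_from_time_0:
  fixes \<gamma> :: "real \<Rightarrow> ('a::euclidean_space, 'n) config"
  assumes ab: "a < b" and ac: "abs_continuous_on_interval a b \<gamma>"
  shows "abs_continuous_on_interval 0 (b - a) (\<lambda>r. \<gamma> (1 * r + a))"
    "nn_action m h 0 (b - a) (\<lambda>r. \<gamma> (1 * r + a)) = nn_action m h a b \<gamma>"
proof -
  show "abs_continuous_on_interval 0 (b - a) (\<lambda>r. \<gamma> (1 * r + a))"
    by (rule ac_affine_reparametrisation[OF ac]) auto
  show "nn_action m h 0 (b - a) (\<lambda>r. \<gamma> (1 * r + a)) = nn_action m h a b \<gamma>"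
    by (rule nn_action_affine_reparametrisation[OF ac]) (use ab in auto)
qed

lemma reverse_curve:
  fixes \<gamma> :: "real \<Rightarrow> ('a::euclidean_space, 'n) config"
  assumes T: "0 < T" and ac: "abs_continuous_on_interval 0 T \<gamma>"
  shows "abs_continuous_on_interval 0 T (\<lambda>r. \<gamma> (- 1 * r + T))"
    "nn_action m h 0 T (\<lambda>r. \<gamma> (- 1 * r + T)) = nn_action m h 0 T \<gamma>"
proof -
  show "abs_continuous_on_interval 0 T (\<lambda>r. \<gamma> (- 1 * r + T))"
    by (rule ac_affine_reparametrisation[OF ac]) auto
  show "nn_action m h 0 T (\<lambda>r. \<gamma> (- 1 * r + T)) = nn_action m h 0 T \<gamma>"
    by (rule nn_action_affine_reparametrisation[OF ac]) (use T in auto)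
qed

lemma phi_less_curve:
  fixes x y :: "('a::euclidean_space, 'n) config"
  assumes "phi m h x y < c"
  shows "\<exists>T \<gamma>. 0 < T \<and> abs_continuous_on_interval 0 T \<gamma> \<and> \<gamma> 0 = x \<and> \<gamma> T = y \<and> nn_action m h 0 T \<gamma> < c"
proof -
  obtain a b \<gamma> where g: "a < b" "abs_continuous_on_interval a b \<gamma>" "\<gamma> a = x" "\<gamma> b = y" "nn_action m h a b \<gamma> < c"
    using assms unfolding phi_def INF_less_iff curves_def by auto
  show ?thesis
    using curve_from_time_0[OF g(1,2)] g by (intro exI[of _ "b - a"] exI[of _ "\<lambda>r. \<gamma> (1 * r + a)"]) auto
qed

lemma phi_commute: "phi m h x y = phi m h y x" for x y :: "('a::euclidean_space, 'n) config"
proof -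
  have "phi m h y x \<le> phi m h x y" for x y :: "('a, 'n) config"
  proof (rule ccontr)
    assume "\<not> ?thesis"
    then have "phi m h x y < phi m h y x" by simp
    then obtain T \<gamma> where g: "0 < T" "abs_continuous_on_interval 0 T \<gamma>" "\<gamma> 0 = x" "\<gamma> T = y"
      "nn_action m h 0 T \<gamma> < phi m h y x" using phi_less_curve by blast
    have "phi m h y x \<le> nn_action m h 0 T (\<lambda>r. \<gamma> (- 1 * r + T))"
      by (rule phi_le[OF g(1) reverse_curve(1)[OF g(1,2)]]) (use g in auto)
    then show False using reverse_curve(2)[OF g(1,2), of h] g(5) by simp
  qed
  then show ?thesis by (intro antisym)
qed

text \<open>Almost minimizing curves are run through one after the other.\<close>

lemma phi_triangle: "phi m h x z \<le> phi m h x y + phi m h y z" for x y z :: "('a::euclidean_space, 'n) config"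
proof (rule ennreal_le_epsilon)
  fix e :: real assume fin: "phi m h x y + phi m h y z < top" and e: "0 < e"
  have "phi m h x y < phi m h x y + ennreal (e/2)" "phi m h y z < phi m h y z + ennreal (e/2)"
    using fin e by (auto intro!: ennreal_less_add_epsilon)
  then obtain S T \<gamma> \<eta> where g: "0 < S" "abs_continuous_on_interval 0 S \<gamma>" "\<gamma> 0 = x" "\<gamma> S = y"
      "nn_action m h 0 S \<gamma> < phi m h x y + ennreal (e/2)"
    and k: "0 < T" "abs_continuous_on_interval 0 T \<eta>" "\<eta> 0 = y" "\<eta> T = z"
      "nn_action m h 0 T \<eta> < phi m h y z + ennreal (e/2)"
    using phi_less_curve by meson
  define \<zeta> where "\<zeta> t = (if t \<le> S then \<gamma> t else \<eta> (1 * t + - S))" for t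
  have eq1: "\<zeta> t = \<gamma> t" if "t \<in> {0..S}" for t using that by (simp add: \<zeta>_def)
  have eq2: "\<zeta> t = \<eta> (1 * t + - S)" if "t \<in> {S..S + T}" for t
    using that g k by (cases "t = S") (auto simp: \<zeta>_def)
  have ac2: "abs_continuous_on_interval S (S + T) (\<lambda>t. \<eta> (1 * t + - S))"
    by (rule ac_affine_reparametrisation[OF k(2)]) auto
  have ac: "abs_continuous_on_interval 0 (S + T) \<zeta>"
    by (rule ac_join[OF ac_cong[OF g(2) eq1] ac_cong[OF ac2 eq2]]) (use g k in auto)
  have "phi m h x z \<le> nn_action m h 0 (S + T) \<zeta>"
    by (rule phi_le[OF _ ac]) (use g k in \<open>auto simp: \<zeta>_def\<close>)
  also have "\<dots> = nn_action m h 0 S \<zeta> + nn_action m h S (S + T) \<zeta>"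
    by (rule nn_action_split[OF ac]) (use g k in auto)
  also have "nn_action m h 0 S \<zeta> = nn_action m h 0 S \<gamma>" by (rule nn_action_cong[OF eq1])
  also have "nn_action m h S (S + T) \<zeta> = nn_action m h S (S + T) (\<lambda>t. \<eta> (1 * t + - S))" by (rule nn_action_cong[OF eq2])
  also have "\<dots> = nn_action m h 0 T \<eta>"
    by (rule nn_action_affine_reparametrisation[OF k(2)]) (use k in auto)
  also have "nn_action m h 0 S \<gamma> + nn_action m h 0 T \<eta> \<le> (phi m h x y + ennreal (e/2)) + (phi m h y z + ennreal (e/2))"
    using g(5) k(5) by (intro add_mono) auto
  also have "\<dots> = phi m h x y + phi m h y z + (ennreal (e/2) + ennreal (e/2))" by (simp add: ac_simps)
  also have "ennreal (e/2) + ennreal (e/2) = ennreal e" using e by (simp add: ennreal_plus[symmetric] del: ennreal_plus)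
  finally show "phi m h x z \<le> phi m h x y + phi m h y z + ennreal e" .
qed

end

section \<open>Short curves near collisions\<close>

lemma nn_action_explicit:
  assumes der: "\<And>t. t \<in> {a<..<b} \<Longrightarrow> (\<gamma> has_vector_derivative v t) (at t)"
  shows "nn_action m h a b \<gamma> = (\<integral>\<^sup>+t\<in>{a..b}. (kinetic m (v t) + potential m (\<gamma> t) + ennreal h) \<partial>lebesgue)"
  unfolding nn_action_def
proof (rule nn_integral_cong_AE)
  have "negligible {a, b}" by simp
  then have ae: "AE t in lebesgue. t \<notin> {a, b}" by (simp only: negligible_iff_null_sets AE_not_in)
  show "AE t in lebesgue. (kinetic m (vector_derivative \<gamma> (at t within {a..b})) + potential m (\<gamma> t) + ennreal h) * indicator {a..b} t =
      (kinetic m (v t) + potential m (\<gamma> t) + ennreal h) * indicator {a..b} t"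
  proof (rule AE_mp[OF ae], rule AE_I2, rule impI)
    fix t assume "t \<notin> {a, b}"
    then consider "t \<in> {a<..<b}" | "t \<notin> {a..b}" by force
    then show "(kinetic m (vector_derivative \<gamma> (at t within {a..b})) + potential m (\<gamma> t) + ennreal h) * indicator {a..b} t =
      (kinetic m (v t) + potential m (\<gamma> t) + ennreal h) * indicator {a..b} t"
    proof cases
      case 1
      then have "vector_derivative \<gamma> (at t within {a..b}) = v t"
        using der[OF 1] by (simp add: at_within_Icc_at vector_derivative_at)
      then show ?thesis by simp
    next
      case 2 then show ?thesis by (simp only: indicator_simps mult_zero_right simp_thms)
    qed
  qed
qed

lemma ac_id: "abs_continuous_on_interval a b (\<lambda>t. t)"
  unfolding abs_continuous_on_interval_def
proof (intro allI impI)
  fix \<epsilon> :: real assume \<epsilon>: "\<epsilon> > 0"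
  show "\<exists>\<delta>>0. \<forall>(n::nat) s t. (\<forall>k<n. a \<le> s k \<and> s k < t k \<and> t k \<le> b) \<longrightarrow>
        disjoint_family_on (\<lambda>k. {s k<..<t k}) {..<n} \<longrightarrow> (\<Sum>k<n. t k - s k) < \<delta> \<longrightarrow>
        (\<Sum>k<n. dist (s k) (t k)) < \<epsilon>"
  proof (intro exI[of _ \<epsilon>] conjI allI impI \<epsilon>)
    fix n :: nat and s t
    assume st: "\<forall>k<n. a \<le> s k \<and> s k < t k \<and> t k \<le> b" and sm: "(\<Sum>k<n. t k - s k) < \<epsilon>"
    have "(\<Sum>k<n. dist (s k) (t k)) = (\<Sum>k<n. t k - s k)"
      using st by (intro sum.cong) (auto simp: dist_real_def)
    then show "(\<Sum>k<n. dist (s k) (t k)) < \<epsilon>" using sm by simp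
  qed
qed

lemma ac_line:
  fixes x v :: "'b::real_normed_vector"
  shows "abs_continuous_on_interval a b (\<lambda>t. x + t *\<^sub>R v)"
proof (rule ac_lipschitz_image[OF ac_id, of "norm v + 1"])
  show "dist (x + s *\<^sub>R v) (x + t *\<^sub>R v) \<le> (norm v + 1) * dist s t" for s t
  proof -
    have "dist (x + s *\<^sub>R v) (x + t *\<^sub>R v) = norm ((s - t) *\<^sub>R v)"
      unfolding dist_norm scaleR_diff_left by simp
    also have "\<dots> = norm v * dist s t" by (simp add: dist_real_def)
    also have "\<dots> \<le> (norm v + 1) * dist s t" by (intro mult_right_mono) auto
    finally show ?thesis .
  qed
qed (simp add: add_nonneg_pos)

text \<open>For \<open>l = 0\<close>, the length of a degenerate interval, the quotient is \<open>0\<close>.\<close>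

lemma quotient_le_if_le_mult:
  fixes x l c :: real
  assumes "x \<le> l * c" "0 \<le> l" "0 \<le> c"
  shows "x / l \<le> c"
  using assms by (cases "l = 0") (simp_all add: pos_divide_le_eq mult.commute)

lemma monotone_increment_sum:
  fixes F :: "real \<Rightarrow> real"
  assumes F: "\<And>s t. a \<le> s \<Longrightarrow> s \<le> t \<Longrightarrow> t \<le> b \<Longrightarrow> F s \<le> F t" and ab: "a \<le> b"
    and I: "interval_family a b I s t"
  shows "(\<Sum>k\<in>I. F (t k) - F (s k)) \<le> F b - F a"
proof -
  define I' where "I' = {k \<in> I. s k < t k}"
  define J where "J = (\<lambda>k. (s k, t k)) ` I'"
  have fam: "interval_family a b I' s t" by (rule interval_family_subset[OF I]) (auto simp: I'_def)
  note II = interval_familyD[OF fam]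
  have inj: "inj_on (\<lambda>k. (s k, t k)) I'"
  proof (rule inj_onI, rule ccontr)
    fix k l assume kl: "k \<in> I'" "l \<in> I'" "(s k, t k) = (s l, t l)" "k \<noteq> l"
    then have "{s k<..<t k} \<inter> {s l<..<t l} = {}" by (intro disjoint_family_onD[OF II(3)])
    then show False using kl by (simp add: I'_def)
  qed
  have "disjoint_family_on (\<lambda>i. {fst i<..<snd i}) J"
    unfolding J_def disjoint_family_on_def using disjoint_family_onD[OF II(3)] by fastforce
  then have famJ: "interval_family a b J fst snd" using II(1,2) by (auto simp: interval_family_def J_def)
  obtain R where R: "interval_family a b (J \<union> R) fst snd"
    and eq: "\<forall>g::real \<Rightarrow> real. g b - g a = (\<Sum>i\<in>J. g (snd i) - g (fst i)) + (\<Sum>i\<in>R. g (snd i) - g (fst i))"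
    using complementary_intervals[OF famJ _ ab] by (auto simp: J_def I'_def)
  have "0 \<le> (\<Sum>i\<in>R. F (snd i) - F (fst i))"
  proof (rule sum_nonneg)
    fix i assume "i \<in> R" then show "0 \<le> F (snd i) - F (fst i)"
      using interval_familyD(2)[OF R, of i] F[of "fst i" "snd i"] by simp
  qed
  moreover have "(\<Sum>i\<in>J. F (snd i) - F (fst i)) = (\<Sum>k\<in>I'. F (t k) - F (s k))"
    unfolding J_def by (simp add: sum.reindex[OF inj])
  moreover have "(\<Sum>k\<in>I'. F (t k) - F (s k)) = (\<Sum>k\<in>I. F (t k) - F (s k))"
  proof (rule sum.mono_neutral_left)
    show "\<forall>k\<in>I - I'. F (t k) - F (s k) = 0"
    proof
      fix k assume "k \<in> I - I'"
      then have "s k = t k" using interval_familyD(2)[OF I, of k] by (auto simp: I'_def)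
      then show "F (t k) - F (s k) = 0" by simp
    qed
  qed (use interval_familyD(1)[OF I] in \<open>auto simp: I'_def\<close>)
  ultimately show ?thesis using spec[OF eq, of F] by linarith
qed

text \<open>A bound on the difference quotients in the sense of the energy forces absolute continuity, by
  the Cauchy-Schwarz inequality.\<close>

lemma ac_if_energy_bounded:
  fixes \<gamma> :: "real \<Rightarrow> 'b::metric_space"
  assumes C: "\<And>(I :: nat set) s t. interval_family a b I s t \<Longrightarrow> (\<Sum>k\<in>I. (dist (\<gamma> (s k)) (\<gamma> (t k)))\<^sup>2 / (t k - s k)) \<le> C"
  shows "abs_continuous_on_interval a b \<gamma>"
proof (rule ac_if_small_variation)
  fix \<epsilon> :: real assume \<epsilon>: "\<epsilon> > 0"
  have C0: "0 \<le> C" using C[of "{}"] by (simp add: interval_family_def disjoint_family_on_def)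
  define \<delta> where "\<delta> = \<epsilon>\<^sup>2 / (C + 1)"
  have \<delta>: "\<delta> > 0" using \<epsilon> C0 by (simp add: \<delta>_def)
  show "\<exists>\<delta>>0. \<forall>(I :: nat set) s t. interval_family a b I s t \<longrightarrow> (\<Sum>k\<in>I. t k - s k) < \<delta> \<longrightarrow>
     (\<Sum>k\<in>I. dist (\<gamma> (s k)) (\<gamma> (t k))) < \<epsilon>"
  proof (intro exI[of _ \<delta>] conjI allI impI \<delta>)
    fix I :: "nat set" and s t
    assume I: "interval_family a b I s t" and sm: "(\<Sum>k\<in>I. t k - s k) < \<delta>"
    note II = interval_familyD(2)[OF I]
    let ?d = "\<lambda>k. dist (\<gamma> (s k)) (\<gamma> (t k))" and ?l = "\<lambda>k. t k - s k"
    have "(\<Sum>k\<in>I. ?d k) = (\<Sum>k\<in>I. (?d k / sqrt (?l k)) * sqrt (?l k))"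
    proof (intro sum.cong refl)
      fix k assume "k \<in> I"
      then consider "s k = t k" | "0 < t k - s k" using II[of k] by force
      then show "?d k = (?d k / sqrt (?l k)) * sqrt (?l k)" by cases auto
    qed
    then have "(\<Sum>k\<in>I. ?d k)\<^sup>2 \<le> (\<Sum>k\<in>I. (?d k / sqrt (?l k))\<^sup>2) * (\<Sum>k\<in>I. (sqrt (?l k))\<^sup>2)"
      using Cauchy_Schwarz_ineq_sum[of "\<lambda>k. ?d k / sqrt (?l k)" "\<lambda>k. sqrt (?l k)" I] by simp
    also have "(\<Sum>k\<in>I. (?d k / sqrt (?l k))\<^sup>2) = (\<Sum>k\<in>I. (?d k)\<^sup>2 / ?l k)"
      using II by (intro sum.cong) (auto simp: power_divide)
    also have "(\<Sum>k\<in>I. (sqrt (?l k))\<^sup>2) = (\<Sum>k\<in>I. ?l k)"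
      using II by (intro sum.cong) auto
    also have "(\<Sum>k\<in>I. (?d k)\<^sup>2 / ?l k) * (\<Sum>k\<in>I. ?l k) \<le> C * (\<Sum>k\<in>I. ?l k)"
      using C[OF I] II by (intro mult_right_mono sum_nonneg) auto
    also have "\<dots> \<le> C * \<delta>" using sm C0 by (intro mult_left_mono) auto
    also have "\<dots> < (C + 1) * \<delta>" using \<delta> by simp
    also have "\<dots> = \<epsilon>\<^sup>2" using C0 by (simp add: \<delta>_def)
    finally show "(\<Sum>k\<in>I. ?d k) < \<epsilon>" using \<epsilon> by (simp add: power2_less_imp_less)
  qed
qed

text \<open>The exponent 2/3 makes the kinetic energy and the Newtonian potential, both of order
  \<open>t\<^sup>-\<^sup>2\<^sup>/\<^sup>3\<close>, integrable at the collision.\<close>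

lemma ac_power_curve:
  fixes z w :: "'b::real_normed_vector"
  assumes T: "T > 0"
  shows "abs_continuous_on_interval 0 T (\<lambda>t. z + (t powr (2/3)) *\<^sub>R w)"
proof (rule ac_if_energy_bounded)
  fix I :: "nat set" and s t :: "nat \<Rightarrow> real"
  assume I: "interval_family 0 T I s t"
  let ?F = "\<lambda>r. 2 * (norm w)\<^sup>2 * r powr (1/3)"
  have "(\<Sum>k\<in>I. (dist (z + (s k powr (2/3)) *\<^sub>R w) (z + (t k powr (2/3)) *\<^sub>R w))\<^sup>2 / (t k - s k)) \<le> (\<Sum>k\<in>I. ?F (t k) - ?F (s k))"
  proof (rule sum_mono)
    fix k assume "k \<in> I"
    then have st: "0 \<le> s k" "s k \<le> t k" using interval_familyD(2)[OF I] by auto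
    define \<alpha> \<beta> where "\<alpha> = s k powr (1/3)" and "\<beta> = t k powr (1/3)"
    have \<alpha>\<beta>: "0 \<le> \<alpha>" "0 \<le> \<beta>" by (simp_all add: \<alpha>_def \<beta>_def)
    have pw: "r powr (2/3) = (r powr (1/3))\<^sup>2" "r = (r powr (1/3)) ^ 3" if "0 \<le> r" for r :: real
      using that by (simp_all add: powr_numeral[symmetric] powr_powr powr_gt_zero del: powr_numeral)
    have cube: "t k - s k = \<beta> ^ 3 - \<alpha> ^ 3" using pw(2)[of "t k"] pw(2)[of "s k"] st by (simp add: \<alpha>_def \<beta>_def)
    have fac: "\<beta> ^ 3 - \<alpha> ^ 3 = (\<beta> - \<alpha>) * (\<beta>\<^sup>2 + \<alpha> * \<beta> + \<alpha>\<^sup>2)" by (simp add: power3_eq_cube power2_eq_square algebra_simps)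
    have "(dist (z + (s k powr (2/3)) *\<^sub>R w) (z + (t k powr (2/3)) *\<^sub>R w))\<^sup>2 = ((\<beta>\<^sup>2 - \<alpha>\<^sup>2) * norm w)\<^sup>2"
      using pw(1)[of "t k"] pw(1)[of "s k"] st
      by (simp add: dist_norm scaleR_diff_left[symmetric] \<alpha>_def \<beta>_def power_mult_distrib)
         (simp add: power2_commute)
    also have "\<dots> = (\<beta> - \<alpha>)\<^sup>2 * (\<beta> + \<alpha>)\<^sup>2 * (norm w)\<^sup>2" by (simp add: power2_eq_square algebra_simps)
    also have "\<dots> \<le> (\<beta> - \<alpha>)\<^sup>2 * (2 * (\<beta>\<^sup>2 + \<alpha> * \<beta> + \<alpha>\<^sup>2)) * (norm w)\<^sup>2"
    proof (intro mult_right_mono mult_left_mono)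
      have "0 \<le> \<beta>\<^sup>2 + \<alpha>\<^sup>2" by simp
      then show "(\<beta> + \<alpha>)\<^sup>2 \<le> 2 * (\<beta>\<^sup>2 + \<alpha> * \<beta> + \<alpha>\<^sup>2)" by (simp add: power2_sum)
    qed auto
    also have "\<dots> = (t k - s k) * (2 * (norm w)\<^sup>2 * (\<beta> - \<alpha>))" unfolding cube fac by (simp add: power2_eq_square)
    finally have "(dist (z + (s k powr (2/3)) *\<^sub>R w) (z + (t k powr (2/3)) *\<^sub>R w))\<^sup>2 \<le> (t k - s k) * (2 * (norm w)\<^sup>2 * (\<beta> - \<alpha>))" .
    moreover have "0 \<le> 2 * (norm w)\<^sup>2 * (\<beta> - \<alpha>)" unfolding \<alpha>_def \<beta>_def using st by (simp add: powr_mono2)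
    ultimately have "(dist (z + (s k powr (2/3)) *\<^sub>R w) (z + (t k powr (2/3)) *\<^sub>R w))\<^sup>2 / (t k - s k) \<le> 2 * (norm w)\<^sup>2 * (\<beta> - \<alpha>)"
      using st by (intro quotient_le_if_le_mult) auto
    also have "\<dots> = ?F (t k) - ?F (s k)" by (simp add: \<alpha>_def \<beta>_def right_diff_distrib)
    finally show "(dist (z + (s k powr (2/3)) *\<^sub>R w) (z + (t k powr (2/3)) *\<^sub>R w))\<^sup>2 / (t k - s k) \<le> ?F (t k) - ?F (s k)" .
  qed
  also have "\<dots> \<le> ?F T - ?F 0"
    by (rule monotone_increment_sum[OF _ _ I]) (use T in \<open>auto intro!: mult_left_mono powr_mono2\<close>)
  finally show "(\<Sum>k\<in>I. (dist (z + (s k powr (2/3)) *\<^sub>R w) (z + (t k powr (2/3)) *\<^sub>R w))\<^sup>2 / (t k - s k)) \<le> ?F T - ?F 0" .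
qed

text \<open>Along a direction \<open>w\<close> that is spread relative to \<open>z\<close> the bodies are ordered on the axis \<open>e\<close> as
  in \<open>z\<close>, with gaps at least 1. Moving \<open>z\<close> along \<open>w\<close> therefore separates all bodies at least
  at unit speed, even from a collision.\<close>

definition spread :: "'a::euclidean_space \<Rightarrow> ('a, 'n::finite) config \<Rightarrow> ('a, 'n) config \<Rightarrow> bool" where
  "spread e w z \<longleftrightarrow> (\<forall>i j. i \<noteq> j \<longrightarrow>
     (z $ i \<bullet> e \<le> z $ j \<bullet> e \<and> w $ i \<bullet> e + 1 \<le> w $ j \<bullet> e) \<or>
     (z $ j \<bullet> e \<le> z $ i \<bullet> e \<and> w $ j \<bullet> e + 1 \<le> w $ i \<bullet> e))"

lemma spread_distance:
  assumes "spread e w z" "norm e = 1" "0 \<le> s" "i \<noteq> j"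
  shows "s \<le> norm ((z + s *\<^sub>R w) $ i - (z + s *\<^sub>R w) $ j)"
proof -
  let ?d = "(z + s *\<^sub>R w) $ i - (z + s *\<^sub>R w) $ j"
  have d: "?d \<bullet> e = (z $ i \<bullet> e - z $ j \<bullet> e) + s * (w $ i \<bullet> e - w $ j \<bullet> e)"
    by (simp add: inner_diff_left inner_add_left algebra_simps)
  have ne: "\<bar>?d \<bullet> e\<bar> \<le> norm ?d" using Cauchy_Schwarz_ineq2[of ?d e] assms(2) by simp
  consider "z $ i \<bullet> e \<le> z $ j \<bullet> e" "1 \<le> w $ j \<bullet> e - w $ i \<bullet> e" | "z $ j \<bullet> e \<le> z $ i \<bullet> e" "1 \<le> w $ i \<bullet> e - w $ j \<bullet> e"
    using assms(1,4) unfolding spread_def by (metis add.commute le_diff_eq)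
  then have "s \<le> \<bar>?d \<bullet> e\<bar>"
  proof cases
    case 1
    have "s * 1 \<le> s * (w $ j \<bullet> e - w $ i \<bullet> e)" using 1 assms(3) by (intro mult_left_mono)
    then have "s \<le> - (?d \<bullet> e)" using 1 d by (simp add: right_diff_distrib)
    then show ?thesis by simp
  next
    case 2
    have "s * 1 \<le> s * (w $ i \<bullet> e - w $ j \<bullet> e)" using 2 assms(3) by (intro mult_left_mono)
    then have "s \<le> ?d \<bullet> e" using 2 d by simp
    then show ?thesis by simp
  qed
  then show ?thesis using ne by simp
qed

text \<open>The sign of each gap is dictated by \<open>w\<close> alone, so the configurations with a given spread direction
  form a convex set.\<close>

lemma spread_convex:
  assumes "spread e w x" "spread e w y" "0 \<le> u" "u \<le> 1"
  shows "spread e w (x + u *\<^sub>R (y - x))"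
  unfolding spread_def
proof (intro allI impI)
  fix i j :: 'b assume ij: "i \<noteq> j"
  have c: "(x + u *\<^sub>R (y - x)) $ k \<bullet> e = (1 - u) * (x $ k \<bullet> e) + u * (y $ k \<bullet> e)" for k
    by (simp add: inner_diff_left inner_add_left algebra_simps)
  have mono: "(1 - u) * p + u * q \<le> (1 - u) * p' + u * q'" if "p \<le> p'" "q \<le> q'" for p q p' q'
    using that assms(3,4) by (intro add_mono mult_left_mono) auto
  consider "x $ i \<bullet> e \<le> x $ j \<bullet> e" "y $ i \<bullet> e \<le> y $ j \<bullet> e" "w $ i \<bullet> e + 1 \<le> w $ j \<bullet> e"
    | "x $ j \<bullet> e \<le> x $ i \<bullet> e" "y $ j \<bullet> e \<le> y $ i \<bullet> e" "w $ j \<bullet> e + 1 \<le> w $ i \<bullet> e"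
    using assms(1,2) ij unfolding spread_def by fastforce
  then show "((x + u *\<^sub>R (y - x)) $ i \<bullet> e \<le> (x + u *\<^sub>R (y - x)) $ j \<bullet> e \<and> w $ i \<bullet> e + 1 \<le> w $ j \<bullet> e) \<or>
     ((x + u *\<^sub>R (y - x)) $ j \<bullet> e \<le> (x + u *\<^sub>R (y - x)) $ i \<bullet> e \<and> w $ j \<bullet> e + 1 \<le> w $ i \<bullet> e)"
    unfolding c using mono by cases auto
qed

lemma closed_spread: "closed {z. spread e w z}"
proof -
  have "closed {z :: ('a, 'b) config. z $ i \<bullet> e \<le> z $ j \<bullet> e}" for i j :: 'b
    by (intro closed_Collect_le continuous_intros)
  then have "closed {z :: ('a, 'b) config. i \<noteq> j \<longrightarrow> (z $ i \<bullet> e \<le> z $ j \<bullet> e \<and> w $ i \<bullet> e + 1 \<le> w $ j \<bullet> e) \<or>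
     (z $ j \<bullet> e \<le> z $ i \<bullet> e \<and> w $ j \<bullet> e + 1 \<le> w $ i \<bullet> e)}" for i j
    by (intro closed_Collect_imp closed_Collect_disj closed_Collect_conj open_Collect_const closed_Collect_const)
  then show ?thesis unfolding spread_def by (intro closed_Collect_all)
qed

text \<open>There are only finitely many orders of the bodies on an axis.\<close>

lemma finitely_many_spread_directions:
  fixes e :: "'a::euclidean_space"
  assumes e: "norm e = 1"
  shows "\<exists>W :: ('a, 'n::{finite,linorder}) config set. finite W \<and> (\<forall>z. \<exists>w\<in>W. spread e w z)"
proof -
  define dir :: "('n \<times> 'n) set \<Rightarrow> ('a, 'n) config" where
    "dir R = (\<chi> i. real (card {j. (j, i) \<in> R}) *\<^sub>R e)" for R
  have "\<exists>w\<in>range dir. spread e w z" for z :: "('a, 'n) config"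
  proof -
    define R where "R = {(j, i). z $ j \<bullet> e < z $ i \<bullet> e \<or> (z $ j \<bullet> e = z $ i \<bullet> e \<and> j < i)}"
    have step: "z $ i \<bullet> e \<le> z $ j \<bullet> e \<and> dir R $ i \<bullet> e + 1 \<le> dir R $ j \<bullet> e" if "(i, j) \<in> R" for i j
    proof
      show "z $ i \<bullet> e \<le> z $ j \<bullet> e" using that by (auto simp: R_def)
      have "insert i {k. (k, i) \<in> R} \<subseteq> {k. (k, j) \<in> R}" using that by (auto simp: R_def)
      then have "card (insert i {k. (k, i) \<in> R}) \<le> card {k. (k, j) \<in> R}" by (intro card_mono) auto
      moreover have "i \<notin> {k. (k, i) \<in> R}" by (auto simp: R_def)
      ultimately have "card {k. (k, i) \<in> R} + 1 \<le> card {k. (k, j) \<in> R}" by simp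
      moreover have "e \<bullet> e = 1" using e by (simp add: norm_eq_1)
      ultimately show "dir R $ i \<bullet> e + 1 \<le> dir R $ j \<bullet> e" by (simp add: dir_def)
    qed
    have "(i, j) \<in> R \<or> (j, i) \<in> R" if "i \<noteq> j" for i j using that by (auto simp: R_def)
    then have "spread e (dir R) z" unfolding spread_def using step by blast
    then show ?thesis by blast
  qed
  moreover have "finite (range dir)" by simp
  ultimately show ?thesis by blast
qed

context masses
begin

definition total_mass_product :: real where
  "total_mass_product = (\<Sum>(i, j)\<in>{(i, j). i < j}. m i * m j)"

lemma total_mass_product_nonneg: "0 \<le> total_mass_product"
  unfolding total_mass_product_def using mass_pos by (intro sum_nonneg) (auto simp: less_imp_le)

lemma potential_le_of_separated:
  fixes z :: "('a::euclidean_space, 'n) config"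
  assumes s: "s > 0" and sep: "\<And>i j. i \<noteq> j \<Longrightarrow> s \<le> norm (z $ i - z $ j)"
  shows "potential m z \<le> ennreal (total_mass_product / s)"
proof -
  have "potential m z \<le> (\<Sum>(i, j)\<in>{(i, j). i < j}. ennreal (m i * m j / s))"
    unfolding potential_def
  proof (rule sum_mono, clarify)
    fix i j :: 'n assume "i < j"
    then have d: "s \<le> norm (z $ i - z $ j)" using sep by auto
    have "ennreal (m i * m j) / ennreal (norm (z $ i - z $ j)) = ennreal (m i * m j / norm (z $ i - z $ j))"
      using s d mass_pos[of i] mass_pos[of j] by (intro divide_ennreal) auto
    also have "\<dots> \<le> ennreal (m i * m j / s)"
      using s d mass_pos[of i] mass_pos[of j] by (intro ennreal_leI divide_left_mono mult_pos_pos) auto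
    finally show "ennreal (m i * m j) / ennreal (norm (z $ i - z $ j)) \<le> ennreal (m i * m j / s)" .
  qed
  also have "\<dots> = ennreal (\<Sum>(i, j)\<in>{(i, j). i < j}. m i * m j / s)"
    unfolding case_prod_unfold using s mass_pos by (intro sum_ennreal) (auto simp: less_imp_le)
  also have "(\<Sum>(i, j)\<in>{(i, j). i < j}. m i * m j / s) = total_mass_product / s"
    unfolding total_mass_product_def by (simp add: sum_divide_distrib case_prod_unfold)
  finally show ?thesis .
qed

lemma line_action:
  fixes x v :: "('a::euclidean_space, 'n) config"
  assumes T: "T > 0" and h: "h \<ge> 0" and P: "P \<ge> 0"
    and pot: "\<And>t. t \<in> {0..T} \<Longrightarrow> potential m (x + t *\<^sub>R v) \<le> ennreal P"
  shows "phi m h x (x + T *\<^sub>R v) \<le> ennreal (T * ((mass_norm m v)\<^sup>2 / 2 + P + h))"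
proof -
  let ?k = "(mass_norm m v)\<^sup>2 / 2"
  have "phi m h x (x + T *\<^sub>R v) \<le> nn_action m h 0 T (\<lambda>t. x + t *\<^sub>R v)"
    by (rule phi_le[OF T ac_line]) auto
  also have "\<dots> = (\<integral>\<^sup>+t\<in>{0..T}. (kinetic m v + potential m (x + t *\<^sub>R v) + ennreal h) \<partial>lebesgue)"
    by (rule nn_action_explicit) (auto intro!: derivative_eq_intros)
  also have "\<dots> \<le> (\<integral>\<^sup>+t. ennreal (?k + P + h) * indicator {0..T} t \<partial>lebesgue)"
  proof (rule nn_integral_mono)
    fix t
    show "(kinetic m v + potential m (x + t *\<^sub>R v) + ennreal h) * indicator {0..T} t \<le> ennreal (?k + P + h) * indicator {0..T} t"
    proof (cases "t \<in> {0..T}")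
      case True
      then have "kinetic m v + potential m (x + t *\<^sub>R v) + ennreal h \<le> ennreal ?k + ennreal P + ennreal h"
        using pot by (intro add_mono) (auto simp: kinetic_def)
      also have "\<dots> = ennreal (?k + P + h)" using h P by simp
      finally show ?thesis by (rule mult_right_mono) simp
    qed simp
  qed
  also have "\<dots> = ennreal (?k + P + h) * ennreal T" using T by (subst nn_integral_cmult_indicator) auto
  also have "\<dots> = ennreal (T * (?k + P + h))" using T h P by (simp add: ennreal_mult[symmetric] mult.commute del: ennreal_plus)
  finally show ?thesis .
qed

text \<open>Along the escape \<open>z + t\<^sup>2\<^sup>/\<^sup>3 w\<close> all distances are at least \<open>t\<^sup>2\<^sup>/\<^sup>3\<close>. Kinetic energy and potential are
  then both at most a multiple of \<open>t\<^sup>-\<^sup>2\<^sup>/\<^sup>3\<close>, whose integral over \<open>[0, T]\<close> is \<open>3 T\<^sup>1\<^sup>/\<^sup>3\<close>.\<close>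

lemma escape_action:
  fixes z w :: "('a::euclidean_space, 'n) config"
  assumes e: "norm e = 1" and sp: "spread e w z" and T: "T > 0" and h: "h \<ge> 0"
  shows "phi m h z (z + (T powr (2/3)) *\<^sub>R w) \<le>
    ennreal (3 * (2/9 * (mass_norm m w)\<^sup>2 + total_mass_product) * T powr (1/3) + h * T)"
proof -
  define K where "K = 2/9 * (mass_norm m w)\<^sup>2 + total_mass_product"
  have K: "K \<ge> 0" using total_mass_product_nonneg by (simp add: K_def)
  let ?\<gamma> = "\<lambda>t. z + (t powr (2/3)) *\<^sub>R w"
  let ?v = "\<lambda>t. (2/3 * t powr (-1/3)) *\<^sub>R w"
  have "phi m h z (z + (T powr (2/3)) *\<^sub>R w) \<le> nn_action m h 0 T ?\<gamma>"
    by (rule phi_le[OF T ac_power_curve[OF T]]) auto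
  also have "\<dots> = (\<integral>\<^sup>+t\<in>{0..T}. (kinetic m (?v t) + potential m (?\<gamma> t) + ennreal h) \<partial>lebesgue)"
  proof (rule nn_action_explicit)
    fix t assume "t \<in> {0<..<T}"
    then have "((\<lambda>t. t powr (2/3)) has_real_derivative (2/3 * t powr (2/3 - 1))) (at t)"
      by (intro has_real_derivative_powr) simp
    then have "((\<lambda>t. (t powr (2/3)) *\<^sub>R w) has_vector_derivative ?v t) (at t)"
      using has_vector_derivative_scaleR[OF _ has_vector_derivative_const[of w]] by fastforce
    then show "(?\<gamma> has_vector_derivative ?v t) (at t)"
      using has_vector_derivative_add[OF has_vector_derivative_const[of z]] by fastforce
  qed
  also have "\<dots> \<le> (\<integral>\<^sup>+t\<in>{0..T}. ennreal (K * t powr (-2/3) + h) \<partial>lebesgue)"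
  proof (rule nn_integral_mono_AE)
    have "negligible {0 :: real}" by simp
    then have ae: "AE t in lebesgue. t \<notin> {0 :: real}" by (simp only: negligible_iff_null_sets AE_not_in)
    show "AE t in lebesgue. (kinetic m (?v t) + potential m (?\<gamma> t) + ennreal h) * indicator {0..T} t \<le>
       ennreal (K * t powr (-2/3) + h) * indicator {0..T} t"
    proof (rule AE_mp[OF ae], rule AE_I2, rule impI)
      fix t :: real assume "t \<notin> {0}"
      then have t0: "t \<noteq> 0" by simp
      show "(kinetic m (?v t) + potential m (?\<gamma> t) + ennreal h) * indicator {0..T} t \<le>
         ennreal (K * t powr (-2/3) + h) * indicator {0..T} t"
      proof (cases "t \<in> {0..T}")
        case True
        then have t: "t > 0" using t0 by simp
        have p: "(t powr (-1/3))\<^sup>2 = t powr (-2/3)" using t by (simp add: powr_numeral[symmetric] powr_powr del: powr_numeral)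
        have "kinetic m (?v t) = ennreal (2/9 * (mass_norm m w)\<^sup>2 * t powr (-2/3))"
          unfolding kinetic_def mass_norm_scaleR power_mult_distrib
          using p by (simp add: abs_mult power_mult_distrib power_divide)
        moreover have "potential m (?\<gamma> t) \<le> ennreal (total_mass_product / t powr (2/3))"
          by (rule potential_le_of_separated, use t in simp, rule spread_distance[OF sp e], auto)
        moreover have "total_mass_product / t powr (2/3) = total_mass_product * t powr (-2/3)"
          using t by (simp add: powr_minus_divide)
        ultimately have "kinetic m (?v t) + potential m (?\<gamma> t) + ennreal h \<le>
            ennreal (2/9 * (mass_norm m w)\<^sup>2 * t powr (-2/3)) + ennreal (total_mass_product * t powr (-2/3)) + ennreal h"
          by (intro add_mono) auto
        also have "\<dots> = ennreal (K * t powr (-2/3) + h)"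
          using h total_mass_product_nonneg by (simp add: K_def ennreal_plus[symmetric] distrib_right del: ennreal_plus)
        finally show ?thesis by (rule mult_right_mono) simp
      qed simp
    qed
  qed
  also have "\<dots> = (\<integral>\<^sup>+t\<in>{0..T}. ennreal (K * t powr (-2/3) + h) \<partial>lborel)"
    by (rule nn_integral_completion)
  also have "\<dots> = ennreal (3 * K * T powr (1/3) + h * T)"
  proof (rule nn_integral_has_integral_lebesgue')
    have "((\<lambda>t. t powr (-2/3)) has_integral (T powr (-2/3 + 1) / (-2/3 + 1))) {0..T}"
      by (rule has_integral_powr_from_0) (use T in auto)
    then have "((\<lambda>t. t powr (-2/3)) has_integral (3 * T powr (1/3))) {0..T}" by (simp add: mult.commute)
    then have "((\<lambda>t. K * t powr (-2/3)) has_integral (K * (3 * T powr (1/3)))) {0..T}"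
      by (rule has_integral_mult_right)
    moreover have "((\<lambda>t. h) has_integral (h * T)) {0..T}"
      using has_integral_const_real[of h 0 T] T by (simp add: mult.commute)
    ultimately have "((\<lambda>t. K * t powr (-2/3) + h) has_integral (K * (3 * T powr (1/3)) + h * T)) {0..T}"
      by (rule has_integral_add)
    then show "((\<lambda>t. K * t powr (-2/3) + h) has_integral (3 * K * T powr (1/3) + h * T)) {0..T}"
      by (simp add: mult.assoc mult.left_commute)
  qed (use K h in auto)
  finally show ?thesis unfolding K_def .
qed

text \<open>Go from \<open>y'\<close> and from \<open>y\<close> away from collisions along the common direction \<open>w\<close>, and join the two
  ends by a segment. By convexity it keeps the distance from collisions that its ends have gained,
  so it is cheap once \<open>y'\<close> is close enough to \<open>y\<close>.\<close>

lemma phi_small_same_order: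
  fixes y w :: "('a::euclidean_space, 'n) config"
  assumes e: "norm e = 1" and sp: "spread e w y" and h: "h \<ge> 0" and \<epsilon>: "\<epsilon> > 0"
  shows "\<exists>\<delta>>0. \<forall>y'. norm (y' - y) < \<delta> \<longrightarrow> spread e w y' \<longrightarrow> phi m h y' y \<le> ennreal \<epsilon>"
proof -
  define B where "B T = 3 * (2/9 * (mass_norm m w)\<^sup>2 + total_mass_product) * T powr (1/3) + h * T" for T
  have "(B \<longlongrightarrow> 3 * (2/9 * (mass_norm m w)\<^sup>2 + total_mass_product) * 0 powr (1/3) + h * 0) (at_right 0)"
    unfolding B_def by (intro tendsto_intros tendsto_powr2) (auto intro: eventually_mono[OF eventually_at_right_less])
  then have "\<forall>\<^sub>F T in at_right 0. B T < \<epsilon> / 3" using \<epsilon> by (intro order_tendstoD(2)[where y = 0]) auto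
  moreover have "\<forall>\<^sub>F T in at_right 0. (0::real) < T" by (rule eventually_at_right_less)
  ultimately have "\<forall>\<^sub>F T in at_right 0. B T < \<epsilon> / 3 \<and> 0 < T" by (rule eventually_conj)
  then obtain T where T: "T > 0" "B T < \<epsilon> / 3" using eventually_happens'[of "at_right (0::real)"] by auto
  define \<sigma> where "\<sigma> = T powr (2/3)"
  have \<sigma>: "\<sigma> > 0" using T by (simp add: \<sigma>_def)
  define P where "P = total_mass_product / \<sigma>"
  have P: "P \<ge> 0" using \<sigma> total_mass_product_nonneg by (simp add: P_def)
  define \<tau> where "\<tau> = (\<epsilon> / 6) / (P + h + 1)"
  have \<tau>: "\<tau> > 0" using P h \<epsilon> by (simp add: \<tau>_def)
  have "\<tau> * (P + h + 1) = \<epsilon> / 6" unfolding \<tau>_def using P h by (intro nonzero_eq_divide_eq[THEN iffD1]) auto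
  then have \<tau>2: "\<tau> * (P + h) \<le> \<epsilon> / 6" using \<tau> by (simp add: algebra_simps)
  obtain C where C: "C > 0" "\<And>x :: ('a, 'n) config. mass_norm m x \<le> C * norm x" using mass_norm_le by blast
  define \<delta> where "\<delta> = sqrt (\<tau> * \<epsilon> / 3) / C"
  have \<delta>: "\<delta> > 0" using \<tau> \<epsilon> C by (simp add: \<delta>_def)
  show ?thesis
  proof (intro exI[of _ \<delta>] conjI allI impI \<delta>)
    fix y' assume d: "norm (y' - y) < \<delta>" and sp': "spread e w y'"
    define v where "v = (1 / \<tau>) *\<^sub>R (y - y')"
    have v: "\<tau> *\<^sub>R v = y - y'" using \<tau> by (simp add: v_def)
    have "mass_norm m (y - y') \<le> C * \<delta>"
      using C(2)[of "y - y'"] d C(1) by (smt (verit) mult_left_mono norm_minus_commute)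
    also have "\<dots> = sqrt (\<tau> * \<epsilon> / 3)" using C(1) by (simp add: \<delta>_def)
    finally have "(mass_norm m (y - y'))\<^sup>2 \<le> (sqrt (\<tau> * \<epsilon> / 3))\<^sup>2" by (intro power_mono mass_norm_nonneg)
    then have mn: "(mass_norm m (y - y'))\<^sup>2 \<le> \<tau> * \<epsilon> / 3" using \<tau> \<epsilon> by simp
    have "phi m h (y' + \<sigma> *\<^sub>R w) (y' + \<sigma> *\<^sub>R w + \<tau> *\<^sub>R v) \<le> ennreal (\<tau> * ((mass_norm m v)\<^sup>2 / 2 + P + h))"
    proof (rule line_action[OF \<tau> h P])
      fix t assume t: "t \<in> {0..\<tau>}"
      have "spread e w (y' + (t / \<tau>) *\<^sub>R (y - y'))" by (rule spread_convex[OF sp' sp]) (use t \<tau> in auto)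
      moreover have "(t / \<tau>) *\<^sub>R (y - y') = t *\<^sub>R v" by (simp add: v_def)
      ultimately have spt: "spread e w (y' + t *\<^sub>R v)" by simp
      have "potential m (y' + t *\<^sub>R v + \<sigma> *\<^sub>R w) \<le> ennreal P"
        unfolding P_def by (rule potential_le_of_separated[OF \<sigma>], rule spread_distance[OF spt e]) (use \<sigma> in auto)
      then show "potential m (y' + \<sigma> *\<^sub>R w + t *\<^sub>R v) \<le> ennreal P" by (simp add: ac_simps)
    qed
    also have "\<tau> * ((mass_norm m v)\<^sup>2 / 2 + P + h) = (mass_norm m (y - y'))\<^sup>2 / (2 * \<tau>) + \<tau> * (P + h)"
      unfolding v_def mass_norm_scaleR using \<tau> by (simp add: field_simps power2_eq_square)
    also have "\<dots> \<le> ennreal (\<epsilon> / 3)"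
    proof (rule ennreal_leI)
      have "(mass_norm m (y - y'))\<^sup>2 / (2 * \<tau>) \<le> \<epsilon> / 6"
        using mn \<tau> by (simp add: pos_divide_le_eq mult.commute)
      then show "(mass_norm m (y - y'))\<^sup>2 / (2 * \<tau>) + \<tau> * (P + h) \<le> \<epsilon> / 3" using \<tau>2 by simp
    qed
    finally have mid: "phi m h (y' + \<sigma> *\<^sub>R w) (y + \<sigma> *\<^sub>R w) \<le> ennreal (\<epsilon> / 3)"
      by (simp add: v algebra_simps)
    have leg: "phi m h z (z + \<sigma> *\<^sub>R w) \<le> ennreal (\<epsilon> / 3)" if "spread e w z" for z
      using escape_action[OF e that T(1) h] T(2) unfolding \<sigma>_def B_def by (meson ennreal_leI less_imp_le order_trans)
    have "phi m h y' y \<le> phi m h y' (y' + \<sigma> *\<^sub>R w) + phi m h (y' + \<sigma> *\<^sub>R w) y" by (rule phi_triangle)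
    also have "\<dots> \<le> phi m h y' (y' + \<sigma> *\<^sub>R w) + (phi m h (y' + \<sigma> *\<^sub>R w) (y + \<sigma> *\<^sub>R w) + phi m h (y + \<sigma> *\<^sub>R w) y)"
      by (intro add_left_mono phi_triangle)
    also have "\<dots> \<le> ennreal (\<epsilon> / 3) + (ennreal (\<epsilon> / 3) + ennreal (\<epsilon> / 3))"
      using leg[OF sp'] leg[OF sp] mid by (intro add_mono) (simp_all add: phi_commute[of _ _ y])
    also have "\<dots> = ennreal \<epsilon>"
      using \<epsilon> by (simp add: ennreal_plus[symmetric] del: ennreal_plus)
    finally show "phi m h y' y \<le> ennreal \<epsilon>" .
  qed
qed

text \<open>Continuity of the action potential on the diagonal, also at collisions. Nearby configurations may
  order the bodies differently, but an order that occurs arbitrarily close to \<open>y\<close> is also an order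
  of \<open>y\<close>, because the configurations with a given order are closed and there are finitely many orders.\<close>

lemma phi_small:
  fixes y :: "('a::euclidean_space, 'n) config"
  assumes h: "h \<ge> 0" and \<epsilon>: "\<epsilon> > 0"
  shows "\<exists>\<delta>>0. \<forall>y'. norm (y' - y) < \<delta> \<longrightarrow> phi m h y' y \<le> ennreal \<epsilon>"
proof -
  obtain e :: 'a where "e \<in> Basis" using nonempty_Basis by blast
  then have e: "norm e = 1" by simp
  obtain W :: "('a, 'n) config set" where W: "finite W" "\<And>z. \<exists>w\<in>W. spread e w z"
    using finitely_many_spread_directions[OF e] by blast
  have "\<exists>\<delta>>0. \<forall>y'. norm (y' - y) < \<delta> \<longrightarrow> spread e w y' \<longrightarrow> phi m h y' y \<le> ennreal \<epsilon>" for w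
  proof (cases "spread e w y")
    case True then show ?thesis by (rule phi_small_same_order[OF e _ h \<epsilon>])
  next
    case False
    moreover have "open {z. \<not> spread e w z}" using closed_spread[of e w] by (simp add: closed_def Collect_neg_eq)
    ultimately obtain d where "d > 0" "ball y d \<subseteq> {z. \<not> spread e w z}" by (metis mem_Collect_eq openE)
    then show ?thesis by (intro exI[of _ d]) (auto simp: ball_def dist_norm norm_minus_commute)
  qed
  then obtain \<delta> where \<delta>: "\<And>w. \<delta> w > 0"
    "\<And>w y'. norm (y' - y) < \<delta> w \<Longrightarrow> spread e w y' \<Longrightarrow> phi m h y' y \<le> ennreal \<epsilon>" by metis
  have ne: "W \<noteq> {}" using W(2) by blast
  have "Min (\<delta> ` W) > 0" using W(1) ne \<delta>(1) by (subst Min_gr_iff) auto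
  moreover have "phi m h y' y \<le> ennreal \<epsilon>" if d: "norm (y' - y) < Min (\<delta> ` W)" for y'
  proof -
    obtain w where w: "w \<in> W" "spread e w y'" using W(2) by blast
    then have "norm (y' - y) < \<delta> w" using d W(1) ne by (subst (asm) Min_gr_iff) auto
    then show ?thesis using \<delta>(2) w by blast
  qed
  ultimately show ?thesis by blast
qed

end

section \<open>Lower semicontinuity of the action\<close>

lemma nn_set_integral_split_interval:
  fixes f :: "real \<Rightarrow> ennreal"
  assumes abc: "a \<le> b" "b \<le> c" and meas: "(\<lambda>t. f t * indicator {a..c} t) \<in> borel_measurable lebesgue"
  shows "(\<integral>\<^sup>+t\<in>{a..c}. f t \<partial>lebesgue) = (\<integral>\<^sup>+t\<in>{a..b}. f t \<partial>lebesgue) + (\<integral>\<^sup>+t\<in>{b..c}. f t \<partial>lebesgue)"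
proof -
  have m: "(\<lambda>t. f t * indicator S t) \<in> borel_measurable lebesgue" if "S \<subseteq> {a..c}" "S \<in> sets lebesgue" for S
  proof -
    have "(\<lambda>t. f t * indicator S t) = (\<lambda>t. (f t * indicator {a..c} t) * indicator S t)"
      using that(1) by (intro ext) (auto split: split_indicator)
    also have "\<dots> \<in> borel_measurable lebesgue"
      by (intro borel_measurable_times_ennreal meas borel_measurable_indicator that)
    finally show ?thesis .
  qed
  have "negligible {b}" by simp
  then have ae: "AE t in lebesgue. t \<notin> {b}" by (simp only: negligible_iff_null_sets AE_not_in)
  have "(\<integral>\<^sup>+t\<in>{a..c}. f t \<partial>lebesgue) = (\<integral>\<^sup>+t. f t * indicator {a..b} t + f t * indicator {b..c} t \<partial>lebesgue)"
    by (rule nn_integral_cong_AE, rule AE_mp[OF ae], rule AE_I2) (use abc in \<open>auto simp: indicator_def\<close>)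
  also have "\<dots> = (\<integral>\<^sup>+t\<in>{a..b}. f t \<partial>lebesgue) + (\<integral>\<^sup>+t\<in>{b..c}. f t \<partial>lebesgue)"
    using abc by (intro nn_integral_add m) auto
  finally show ?thesis .
qed

context masses
begin

text \<open>The energy spent up to time \<open>t\<close> controls the squares of all displacements. Stopping the curve
  at time \<open>T\<close> makes the estimate available on the whole half line.\<close>

lemma energy_function:
  fixes \<gamma> :: "real \<Rightarrow> ('a::euclidean_space, 'n) config"
  assumes ac: "abs_continuous_on_interval 0 T \<gamma>" and T: "0 \<le> T" and K: "0 \<le> K"
    and kin: "(\<integral>\<^sup>+t\<in>{0..T}. kinetic m (vector_derivative \<gamma> (at t within {0..T})) \<partial>lebesgue) \<le> ennreal K"
  shows "\<exists>F. (\<forall>s t. 0 \<le> s \<longrightarrow> s \<le> t \<longrightarrow> F s \<le> F t \<and>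
      (mass_norm m (\<gamma> (min t T) - \<gamma> (min s T)))\<^sup>2 \<le> 2 * (t - s) * (F t - F s)) \<and> (\<forall>t\<ge>0. 0 \<le> F t \<and> F t \<le> K)"
proof -
  let ?v = "\<lambda>t. vector_derivative \<gamma> (at t within {0..T})"
  define E where "E a b = (\<integral>\<^sup>+t\<in>{a..b}. kinetic m (?v t) \<partial>lebesgue)" for a b
  define F where "F t = enn2real (E 0 (min t T))" for t
  have EK: "E a b \<le> ennreal K" if "0 \<le> a" "b \<le> T" for a b
  proof -
    have "E a b \<le> E 0 T" unfolding E_def by (rule nn_set_integral_set_mono) (use that in auto)
    then show ?thesis using kin unfolding E_def by (rule order_trans)
  qed
  have fin: "E a b < top" if "0 \<le> a" "b \<le> T" for a b using EK[OF that] by (simp add: le_less_trans)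
  have split: "E 0 t = E 0 s + E s t" if "0 \<le> s" "s \<le> t" "t \<le> T" for s t
    unfolding E_def
  proof (rule nn_set_integral_split_interval)
    have "(\<lambda>r. kinetic m (?v r) * indicator {0..t} r) = (\<lambda>r. (kinetic m (?v r) * indicator {0..T} r) * indicator {0..t} r)"
      using that by (auto simp: indicator_def)
    also have "\<dots> \<in> borel_measurable lebesgue"
      by (intro borel_measurable_times_ennreal kinetic_measurable[OF ac T] borel_measurable_indicator) simp
    finally show "(\<lambda>r. kinetic m (?v r) * indicator {0..t} r) \<in> borel_measurable lebesgue" .
  qed (use that in auto)
  have inc: "F s \<le> F t \<and> (mass_norm m (\<gamma> (min t T) - \<gamma> (min s T)))\<^sup>2 \<le> 2 * (t - s) * (F t - F s)" if st: "0 \<le> s" "s \<le> t" for s t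
  proof -
    let ?s = "min s T" and ?t = "min t T"
    have o: "0 \<le> ?s" "?s \<le> ?t" "?t \<le> T" using st T by auto
    define e where "e = enn2real (E ?s ?t)"
    have e0: "0 \<le> e" by (simp add: e_def)
    have eE: "E ?s ?t = ennreal e" using fin[of ?s ?t] o by (simp add: e_def)
    have "F t = F s + e" unfolding F_def e_def split[OF o] using fin o by (intro enn2real_plus) auto
    moreover have "(mass_norm m (\<gamma> ?t - \<gamma> ?s))\<^sup>2 \<le> 2 * (?t - ?s) * e"
      by (rule displacement_square_le[OF ac T o e0]) (use eE in \<open>simp add: E_def\<close>)
    moreover have "2 * (?t - ?s) * e \<le> 2 * (t - s) * e" using e0 st by (intro mult_right_mono) auto
    ultimately show ?thesis using e0 by auto
  qed
  have "0 \<le> F t \<and> F t \<le> K" if "t \<ge> 0" for t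
  proof
    show "0 \<le> F t" by (simp add: F_def)
    show "F t \<le> K" unfolding F_def using EK[of 0 "min t T"] K by (simp add: enn2real_leI)
  qed
  then show ?thesis using inc by blast
qed

lemma partition_energy_le:
  fixes \<gamma> :: "real \<Rightarrow> ('a::euclidean_space, 'n) config"
  assumes ac: "abs_continuous_on_interval 0 T \<gamma>" and T: "0 \<le> T" and K: "0 \<le> K"
    and kin: "(\<integral>\<^sup>+t\<in>{0..T}. kinetic m (vector_derivative \<gamma> (at t within {0..T})) \<partial>lebesgue) \<le> ennreal K"
    and b: "0 \<le> b" and I: "interval_family 0 b I s t"
  shows "(\<Sum>k\<in>I. (mass_norm m (\<gamma> (min (t k) T) - \<gamma> (min (s k) T)))\<^sup>2 / (t k - s k)) \<le> 2 * K"
proof -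
  obtain F where F: "\<forall>s t. 0 \<le> s \<longrightarrow> s \<le> t \<longrightarrow> F s \<le> F t \<and>
      (mass_norm m (\<gamma> (min t T) - \<gamma> (min s T)))\<^sup>2 \<le> 2 * (t - s) * (F t - F s)" "\<forall>t\<ge>0. 0 \<le> F t \<and> F t \<le> K"
    using energy_function[OF ac T K kin] by (elim exE conjE)
  have "(\<Sum>k\<in>I. (mass_norm m (\<gamma> (min (t k) T) - \<gamma> (min (s k) T)))\<^sup>2 / (t k - s k)) \<le> (\<Sum>k\<in>I. 2 * (F (t k) - F (s k)))"
  proof (rule sum_mono)
    fix k assume "k \<in> I"
    then have st: "0 \<le> s k" "s k \<le> t k" using interval_familyD(2)[OF I] by auto
    have "(mass_norm m (\<gamma> (min (t k) T) - \<gamma> (min (s k) T)))\<^sup>2 \<le> (t k - s k) * (2 * (F (t k) - F (s k)))"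
      using F(1)[rule_format, OF st] by (simp only: mult.commute mult.left_commute)
    then show "(mass_norm m (\<gamma> (min (t k) T) - \<gamma> (min (s k) T)))\<^sup>2 / (t k - s k) \<le> 2 * (F (t k) - F (s k))"
      using st F(1) by (intro quotient_le_if_le_mult) auto
  qed
  also have "\<dots> = 2 * (\<Sum>k\<in>I. F (t k) - F (s k))" by (simp add: sum_distrib_left)
  also have "\<dots> \<le> 2 * K"
  proof -
    have "(\<Sum>k\<in>I. F (t k) - F (s k)) \<le> F b - F 0"
      by (rule monotone_increment_sum[OF _ b I]) (use F(1) in auto)
    moreover have "F b \<le> K" "0 \<le> F 0" using F(2) b by auto
    ultimately show ?thesis by simp
  qed
  finally show ?thesis .
qed

text \<open>The intervals of a partition that shrink to a point have it inside rather than as an end.\<close>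

lemma straddled_difference_quotient:
  fixes \<eta> :: "real \<Rightarrow> 'b::real_normed_vector"
  assumes der: "(\<eta> has_vector_derivative D) (at t)"
    and uv: "\<And>n. u n \<le> t" "\<And>n. t \<le> v n" "\<And>n. u n < v n" and lim: "(\<lambda>n. v n - u n) \<longlonglongrightarrow> 0"
  shows "(\<lambda>n. (1 / (v n - u n)) *\<^sub>R (\<eta> (v n) - \<eta> (u n))) \<longlonglongrightarrow> D"
proof (rule LIMSEQ_I)
  fix r :: real assume r: "0 < r"
  then have r2: "r / 2 > 0" by simp
  have "\<exists>d>0. \<forall>y. norm (y - t) < d \<longrightarrow> norm (\<eta> y - \<eta> t - (y - t) *\<^sub>R D) \<le> r / 2 * norm (y - t)"
    using der r2 unfolding has_vector_derivative_def has_derivative_at_alt by blast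
  then obtain d where d: "d > 0" "\<And>y. \<bar>y - t\<bar> < d \<Longrightarrow> norm (\<eta> y - \<eta> t - (y - t) *\<^sub>R D) \<le> r / 2 * \<bar>y - t\<bar>" by auto
  obtain N where N: "\<And>n. n \<ge> N \<Longrightarrow> \<bar>v n - u n\<bar> < d" using LIMSEQ_D[OF lim d(1)] by auto
  have "norm ((1 / (v n - u n)) *\<^sub>R (\<eta> (v n) - \<eta> (u n)) - D) < r" if "n \<ge> N" for n
  proof -
    let ?l = "v n - u n"
    have l: "?l > 0" using uv(3)[of n] by simp
    have A: "norm (\<eta> (v n) - \<eta> t - (v n - t) *\<^sub>R D) \<le> r / 2 * (v n - t)"
      using d(2)[of "v n"] N[OF that] uv[of n] by auto
    have B: "norm (\<eta> (u n) - \<eta> t - (u n - t) *\<^sub>R D) \<le> r / 2 * (t - u n)"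
      using d(2)[of "u n"] N[OF that] uv[of n] by auto
    have "(\<eta> (v n) - \<eta> (u n)) - ?l *\<^sub>R D = (\<eta> (v n) - \<eta> t - (v n - t) *\<^sub>R D) - (\<eta> (u n) - \<eta> t - (u n - t) *\<^sub>R D)"
      by (simp add: algebra_simps)
    then have "norm ((\<eta> (v n) - \<eta> (u n)) - ?l *\<^sub>R D) \<le> r / 2 * (v n - t) + r / 2 * (t - u n)"
      by (simp only:) (rule order_trans[OF norm_triangle_ineq4 add_mono[OF A B]])
    also have "\<dots> = r / 2 * ?l" by (simp only: distrib_left[symmetric]) simp
    also have "\<dots> < r * ?l" using l r by simp
    finally have C: "norm ((\<eta> (v n) - \<eta> (u n)) - ?l *\<^sub>R D) < r * ?l" .
    have "(1 / ?l) *\<^sub>R (\<eta> (v n) - \<eta> (u n)) - D = (1 / ?l) *\<^sub>R ((\<eta> (v n) - \<eta> (u n)) - ?l *\<^sub>R D)"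
      using l by (simp add: scaleR_diff_right)
    then have "norm ((1 / ?l) *\<^sub>R (\<eta> (v n) - \<eta> (u n)) - D) = norm ((\<eta> (v n) - \<eta> (u n)) - ?l *\<^sub>R D) / ?l"
      using l by simp
    also have "\<dots> < r" using C l by (simp add: pos_divide_less_eq)
    finally show ?thesis .
  qed
  then show "\<exists>N. \<forall>n\<ge>N. norm ((1 / (v n - u n)) *\<^sub>R (\<eta> (v n) - \<eta> (u n)) - D) < r" by blast
qed

lemma tendsto_kinetic:
  fixes f :: "nat \<Rightarrow> ('a::euclidean_space, 'n) config"
  assumes "f \<longlonglongrightarrow> D"
  shows "(\<lambda>n. kinetic m (f n)) \<longlonglongrightarrow> kinetic m D"
proof -
  have "(\<lambda>n. mass_norm m (f n)) \<longlonglongrightarrow> mass_norm m D"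
    using continuous_on_tendsto_compose[OF continuous_on_mass_norm[of UNIV] assms] by simp
  then show ?thesis unfolding kinetic_def by (intro tendsto_ennrealI tendsto_intros) auto
qed

text \<open>The kinetic energy is the limit of the energies of inscribed polygons, of which only one
  inequality is needed; it follows from Fatou's lemma for the step functions formed by the squared
  difference quotients on a uniform partition.\<close>

lemma kinetic_le_of_partitions:
  fixes \<eta> :: "real \<Rightarrow> ('a::euclidean_space, 'n) config"
  assumes ac: "abs_continuous_on_interval 0 T \<eta>" and T: "0 < T"
    and B: "\<And>(I :: nat set) s t. interval_family 0 T I s t \<Longrightarrow>
      (\<Sum>k\<in>I. (mass_norm m (\<eta> (t k) - \<eta> (s k)))\<^sup>2 / (t k - s k)) \<le> 2 * B"
  shows "(\<integral>\<^sup>+t\<in>{0..T}. kinetic m (vector_derivative \<eta> (at t within {0..T})) \<partial>lebesgue) \<le> ennreal B"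
proof -
  define \<Delta> where "\<Delta> n = T / real (Suc n)" for n
  have \<Delta>: "\<Delta> n > 0" for n using T by (simp add: \<Delta>_def)
  have \<Delta>T: "real (Suc n) * \<Delta> n = T" for n by (simp add: \<Delta>_def)
  define S where "S n k = {real k * \<Delta> n..<real (Suc k) * \<Delta> n}" for n k
  define c where "c n k = (1 / \<Delta> n) *\<^sub>R (\<eta> (real (Suc k) * \<Delta> n) - \<eta> (real k * \<Delta> n))" for n k
  define q where "q n t = (\<Sum>k<Suc n. kinetic m (c n k) * indicator (S n k) t)" for n t
  have S_meas: "S n k \<in> sets lebesgue" for n k by (simp add: S_def)
  have S_emeasure: "emeasure lebesgue (S n k) = ennreal (\<Delta> n)" for n k
    using \<Delta>[of n] by (simp add: S_def emeasure_lborel_Ico algebra_simps)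
  have q_int: "(\<integral>\<^sup>+t. q n t \<partial>lebesgue) \<le> ennreal B" for n
  proof -
    have "(\<integral>\<^sup>+t. q n t \<partial>lebesgue) = (\<Sum>k<Suc n. \<integral>\<^sup>+t. kinetic m (c n k) * indicator (S n k) t \<partial>lebesgue)"
      unfolding q_def using S_meas by (intro nn_integral_sum borel_measurable_times_ennreal borel_measurable_indicator borel_measurable_const)
    also have "\<dots> = (\<Sum>k<Suc n. kinetic m (c n k) * ennreal (\<Delta> n))"
      using S_meas S_emeasure by (simp add: nn_integral_cmult_indicator)
    also have "\<dots> = (\<Sum>k<Suc n. ennreal ((mass_norm m (\<eta> (real (Suc k) * \<Delta> n) - \<eta> (real k * \<Delta> n)))\<^sup>2 / \<Delta> n / 2))"
    proof (intro sum.cong refl)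
      fix k
      let ?d = "mass_norm m (\<eta> (real (Suc k) * \<Delta> n) - \<eta> (real k * \<Delta> n))"
      have "kinetic m (c n k) * ennreal (\<Delta> n) = ennreal ((?d / \<Delta> n)\<^sup>2 / 2) * ennreal (\<Delta> n)"
        unfolding kinetic_def c_def mass_norm_scaleR using \<Delta>[of n] by simp
      also have "\<dots> = ennreal ((?d / \<Delta> n)\<^sup>2 / 2 * \<Delta> n)" using \<Delta>[of n] by (intro ennreal_mult[symmetric]) auto
      also have "(?d / \<Delta> n)\<^sup>2 / 2 * \<Delta> n = ?d\<^sup>2 / \<Delta> n / 2" using \<Delta>[of n] by (simp add: power2_eq_square)
      finally show "kinetic m (c n k) * ennreal (\<Delta> n) = ennreal (?d\<^sup>2 / \<Delta> n / 2)" .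
    qed
    also have "\<dots> = ennreal (\<Sum>k<Suc n. (mass_norm m (\<eta> (real (Suc k) * \<Delta> n) - \<eta> (real k * \<Delta> n)))\<^sup>2 / \<Delta> n / 2)"
      using \<Delta>[of n] by (intro sum_ennreal) (simp add: less_imp_le)
    also have "\<dots> \<le> ennreal B"
    proof (rule ennreal_leI)
      have "(\<Sum>k<Suc n. (mass_norm m (\<eta> (real (Suc k) * \<Delta> n) - \<eta> (real k * \<Delta> n)))\<^sup>2 / (real (Suc k) * \<Delta> n - real k * \<Delta> n)) \<le> 2 * B"
      proof (rule B)
        have "disjoint_family_on (\<lambda>k. {real k * \<Delta> n<..<real (Suc k) * \<Delta> n}) {..<Suc n}"
          unfolding disjoint_family_on_def
        proof (intro ballI impI equals0I)
          fix k l :: nat and y assume kl: "k \<noteq> l" and y: "y \<in> {real k * \<Delta> n<..<real (Suc k) * \<Delta> n} \<inter> {real l * \<Delta> n<..<real (Suc l) * \<Delta> n}"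
          then have "real k * \<Delta> n < real (Suc l) * \<Delta> n" "real l * \<Delta> n < real (Suc k) * \<Delta> n" by auto
          then have "real k < real (Suc l)" "real l < real (Suc k)" using \<Delta>[of n] by (simp_all only: mult_less_cancel_right_pos)
          then show False using kl by simp
        qed
        moreover have "0 \<le> real k * \<Delta> n \<and> real k * \<Delta> n \<le> real (Suc k) * \<Delta> n \<and> real (Suc k) * \<Delta> n \<le> T" if "k < Suc n" for k
        proof -
          have "real (Suc k) * \<Delta> n \<le> real (Suc n) * \<Delta> n" using \<Delta>[of n] that by (intro mult_right_mono) auto
          then have "real (Suc k) * \<Delta> n \<le> T" unfolding \<Delta>T .
          then show ?thesis using \<Delta>[of n] by simp
        qed
        ultimately show "interval_family 0 T {..<Suc n} (\<lambda>k. real k * \<Delta> n) (\<lambda>k. real (Suc k) * \<Delta> n)"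
          unfolding interval_family_def by blast
      qed
      moreover have "real (Suc k) * \<Delta> n - real k * \<Delta> n = \<Delta> n" for k by (simp add: algebra_simps)
      ultimately show "(\<Sum>k<Suc n. (mass_norm m (\<eta> (real (Suc k) * \<Delta> n) - \<eta> (real k * \<Delta> n)))\<^sup>2 / \<Delta> n / 2) \<le> B"
        by (simp only: sum_divide_distrib[symmetric] pos_divide_le_eq zero_less_numeral mult.commute[of B])
    qed
    finally show ?thesis .
  qed
  have q_meas: "q n \<in> borel_measurable lebesgue" for n
    unfolding q_def using S_meas
    by (intro borel_measurable_sum borel_measurable_times_ennreal borel_measurable_indicator borel_measurable_const)
  define N where "N = {t \<in> {0..T}. \<not> \<eta> differentiable (at t)} \<union> {0, T}"
  have "negligible N" unfolding N_def using ac_differentiable_ae[OF ac] by (intro negligible_Un) auto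
  then have ae: "AE t in lebesgue. t \<notin> N" by (simp only: negligible_iff_null_sets AE_not_in)
  have lim: "(\<lambda>n. q n t) \<longlonglongrightarrow> kinetic m (vector_derivative \<eta> (at t within {0..T}))" if t: "t \<in> {0..T}" "t \<notin> N" for t
  proof -
    have ti: "0 < t" "t < T" and dif: "\<eta> differentiable (at t)" using t by (auto simp: N_def)
    define k where "k n = nat \<lfloor>t / \<Delta> n\<rfloor>" for n
    have kn: "real (k n) * \<Delta> n \<le> t" "t < real (Suc (k n)) * \<Delta> n" for n
    proof -
      have "0 \<le> t / \<Delta> n" using ti \<Delta>[of n] by simp
      then have "real (k n) = of_int \<lfloor>t / \<Delta> n\<rfloor>" by (simp add: k_def)
      then have "real (k n) \<le> t / \<Delta> n" "t / \<Delta> n < real (Suc (k n))" by linarith+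
      then show "real (k n) * \<Delta> n \<le> t" "t < real (Suc (k n)) * \<Delta> n" using \<Delta>[of n] by (simp_all only: pos_le_divide_eq pos_divide_less_eq)
    qed
    have q_eq: "q n t = kinetic m (c n (k n))" for n
    proof -
      have "real (k n) * \<Delta> n < real (Suc n) * \<Delta> n" using kn(1)[of n] ti \<Delta>T[of n] by simp
      then have kn': "k n < Suc n" using \<Delta>[of n] by (simp only: mult_less_cancel_right_pos of_nat_less_iff)
      have "indicator (S n l) t = (if l = k n then 1 else 0 :: ennreal)" for l
      proof (cases "l = k n")
        case True then show ?thesis using kn[of n] by (simp add: S_def)
      next
        case False
        have "t \<notin> S n l"
        proof
          assume "t \<in> S n l"
          then have "real l * \<Delta> n < real (Suc (k n)) * \<Delta> n" "real (k n) * \<Delta> n < real (Suc l) * \<Delta> n"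
            using kn[of n] by (auto simp: S_def)
          then have "l < Suc (k n)" "k n < Suc l" using \<Delta>[of n] by (simp_all only: mult_less_cancel_right_pos of_nat_less_iff)
          then show False using False by simp
        qed
        then show ?thesis using False by simp
      qed
      then show ?thesis unfolding q_def using kn' by (simp add: if_distrib[of "\<lambda>z. _ * z"] sum.delta cong: if_cong del: sum.lessThan_Suc)
    qed
    let ?D = "vector_derivative \<eta> (at t)"
    have "(\<lambda>n. (1 / (real (Suc (k n)) * \<Delta> n - real (k n) * \<Delta> n)) *\<^sub>R (\<eta> (real (Suc (k n)) * \<Delta> n) - \<eta> (real (k n) * \<Delta> n))) \<longlonglongrightarrow> ?D"
    proof (rule straddled_difference_quotient)
      show "(\<eta> has_vector_derivative ?D) (at t)" using dif vector_derivative_works by blast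
      show "real (k n) * \<Delta> n \<le> t" "t \<le> real (Suc (k n)) * \<Delta> n" for n using kn[of n] by auto
      show "real (k n) * \<Delta> n < real (Suc (k n)) * \<Delta> n" for n using \<Delta>[of n] by simp
      have "(\<lambda>n. T * inverse (real (Suc n))) \<longlonglongrightarrow> T * 0" by (intro tendsto_intros LIMSEQ_inverse_real_of_nat)
      then have "\<Delta> \<longlonglongrightarrow> 0" unfolding \<Delta>_def by (simp add: divide_inverse)
      moreover have "real (Suc (k n)) * \<Delta> n - real (k n) * \<Delta> n = \<Delta> n" for n by (simp add: algebra_simps)
      ultimately show "(\<lambda>n. real (Suc (k n)) * \<Delta> n - real (k n) * \<Delta> n) \<longlonglongrightarrow> 0" by presburger
    qed
    moreover have "real (Suc (k n)) * \<Delta> n - real (k n) * \<Delta> n = \<Delta> n" for n by (simp add: algebra_simps)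
    ultimately have "(\<lambda>n. c n (k n)) \<longlonglongrightarrow> ?D" unfolding c_def by (simp only:)
    then have "(\<lambda>n. q n t) \<longlonglongrightarrow> kinetic m ?D" unfolding q_eq by (rule tendsto_kinetic)
    moreover have "vector_derivative \<eta> (at t within {0..T}) = ?D" using ti by (simp add: at_within_Icc_at)
    ultimately show ?thesis by simp
  qed
  have "(\<integral>\<^sup>+t\<in>{0..T}. kinetic m (vector_derivative \<eta> (at t within {0..T})) \<partial>lebesgue) \<le> (\<integral>\<^sup>+t. liminf (\<lambda>n. q n t) \<partial>lebesgue)"
  proof (rule nn_integral_mono_AE, rule AE_mp[OF ae], rule AE_I2, rule impI)
    fix t assume t: "t \<notin> N"
    show "kinetic m (vector_derivative \<eta> (at t within {0..T})) * indicator {0..T} t \<le> liminf (\<lambda>n. q n t)"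
    proof (cases "t \<in> {0..T}")
      case True
      then have "liminf (\<lambda>n. q n t) = kinetic m (vector_derivative \<eta> (at t within {0..T}))"
        using lim[OF True t] by (intro lim_imp_Liminf) auto
      then show ?thesis using True by simp
    qed simp
  qed
  also have "\<dots> \<le> liminf (\<lambda>n. \<integral>\<^sup>+t. q n t \<partial>lebesgue)" by (rule nn_integral_liminf[OF q_meas])
  also have "\<dots> \<le> liminf (\<lambda>n. ennreal B)" by (rule Liminf_mono) (simp add: q_int)
  also have "\<dots> = ennreal B" by (rule Liminf_const) simp
  finally show ?thesis .
qed

lemma nn_action_eq_kinetic_plus_potential:
  fixes \<gamma> :: "real \<Rightarrow> ('a::euclidean_space, 'n) config"
  assumes ac: "abs_continuous_on_interval a b \<gamma>" and ab: "a \<le> b"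
  shows "nn_action m h a b \<gamma> =
    (\<integral>\<^sup>+t\<in>{a..b}. kinetic m (vector_derivative \<gamma> (at t within {a..b})) \<partial>lebesgue) +
    (\<integral>\<^sup>+t\<in>{a..b}. (potential m (\<gamma> t) + ennreal h) \<partial>lebesgue)"
  unfolding nn_action_def add.assoc distrib_right[of "kinetic _ _"]
proof (rule nn_integral_add[OF kinetic_measurable[OF ac ab]])
  show "(\<lambda>t. (potential m (\<gamma> t) + ennreal h) * indicator {a..b} t) \<in> borel_measurable lebesgue"
    unfolding distrib_right
    by (intro borel_measurable_add potential_measurable[OF ac ab] borel_measurable_times_ennreal borel_measurable_indicator borel_measurable_const) simp
qed

text \<open>Tonelli's direct method for curves with a common start and bounded action. Stopped at their
  final times, they are uniformly Hoelder continuous, so the Arzela-Ascoli theorem gives a limit.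
  The polygon energies pass to the limit pointwise and the potential by Fatou's lemma.\<close>

lemma action_limit_curve:
  fixes \<gamma> :: "nat \<Rightarrow> real \<Rightarrow> ('a::euclidean_space, 'n) config"
  assumes h: "h \<ge> 0"
    and \<tau>: "\<And>n. 0 < \<tau> n" "\<tau> \<longlonglongrightarrow> \<tau>0" "0 < \<tau>0"
    and ac: "\<And>n. abs_continuous_on_interval 0 (\<tau> n) (\<gamma> n)"
    and start: "\<And>n. \<gamma> n 0 = x"
    and final: "(\<lambda>n. \<gamma> n (\<tau> n)) \<longlonglongrightarrow> y"
    and S: "closed S" "\<And>n t. t \<in> {0..\<tau> n} \<Longrightarrow> \<gamma> n t \<in> S"
    and A: "\<And>n. nn_action m h 0 (\<tau> n) (\<gamma> n) \<le> ennreal (A n)" "\<And>n. 0 \<le> A n" "A \<longlonglongrightarrow> \<alpha>"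
  shows "\<exists>\<eta>. abs_continuous_on_interval 0 \<tau>0 \<eta> \<and> \<eta> 0 = x \<and> \<eta> \<tau>0 = y \<and>
    nn_action m h 0 \<tau>0 \<eta> \<le> ennreal \<alpha> \<and> (\<forall>t\<in>{0..\<tau>0}. \<eta> t \<in> S)"
proof -
  have "Bseq A" using A(3) convergentI convergent_imp_Bseq by blast
  then obtain M where M: "M > 0" "\<And>n. norm (A n) \<le> M" using BseqE by blast
  have AM: "A n \<le> M" for n using M(2)[of n] A(2)[of n] by simp
  obtain C where C: "C > 0" "\<And>z :: ('a, 'n) config. norm z \<le> C * mass_norm m z" using norm_le_mass_norm by blast
  define Kin where "Kin n = (\<integral>\<^sup>+t\<in>{0..\<tau> n}. kinetic m (vector_derivative (\<gamma> n) (at t within {0..\<tau> n})) \<partial>lebesgue)" for n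
  define Pot where "Pot n = (\<integral>\<^sup>+t\<in>{0..\<tau> n}. (potential m (\<gamma> n t) + ennreal h) \<partial>lebesgue)" for n
  have KP: "Kin n + Pot n \<le> ennreal (A n)" for n
    using A(1)[of n] nn_action_eq_kinetic_plus_potential[OF ac[of n] less_imp_le[OF \<tau>(1)[of n]], of h]
    by (simp add: Kin_def Pot_def)
  define K where "K n = enn2real (Kin n)" for n
  define p where "p n = enn2real (Pot n)" for n
  have K0: "0 \<le> K n" "0 \<le> p n" for n by (simp_all add: K_def p_def)
  have fin: "Kin n < top" "Pot n < top" for n
  proof -
    have "Kin n + Pot n < top" using KP[of n] ennreal_less_top by (rule le_less_trans)
    then show "Kin n < top" "Pot n < top" by simp_all
  qed
  have Kin: "Kin n = ennreal (K n)" and Pot: "Pot n = ennreal (p n)" for n using fin by (simp_all add: K_def p_def)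
  have Kp: "K n + p n \<le> A n" for n
    using KP[of n] K0[of n] A(2)[of n] unfolding Kin Pot by (simp add: ennreal_plus[symmetric] del: ennreal_plus)
  define g where "g n t = \<gamma> n (min t (\<tau> n))" for n t
  define E where "E I s t f = (\<Sum>k\<in>I. (mass_norm m (f (t k) - f (s k)))\<^sup>2 / (t k - s k))"
    for I :: "nat set" and s t and f :: "real \<Rightarrow> ('a, 'n) config"
  have EK: "E I s t (g n) \<le> 2 * K n"
    if "0 \<le> b" "interval_family 0 b I s t" for I s t n b
    unfolding E_def g_def
    by (rule partition_energy_le[OF ac less_imp_le[OF \<tau>(1)] K0(1) _ that]) (simp add: Kin[symmetric] Kin_def)
  have hoelder: "norm (g n t - g n s) \<le> C * sqrt (2 * M * \<bar>t - s\<bar>)" if "0 \<le> s" "0 \<le> t" for n s t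
  proof -
    have "norm (g n t - g n s) \<le> C * sqrt (2 * M * (t - s))" if st: "0 \<le> s" "s < t" for s t
    proof -
      have "(mass_norm m (g n t - g n s))\<^sup>2 / (t - s) \<le> 2 * K n"
        using EK[of t "{0}" "\<lambda>_. s" "\<lambda>_. t" n] st by (simp add: E_def interval_family_def disjoint_family_on_def)
      also have "\<dots> \<le> 2 * M" using Kp[of n] K0[of n] AM[of n] by simp
      finally have "(mass_norm m (g n t - g n s))\<^sup>2 \<le> 2 * M * (t - s)" using st by (simp add: pos_divide_le_eq)
      then have "mass_norm m (g n t - g n s) \<le> sqrt (2 * M * (t - s))" by (rule real_le_rsqrt)
      then show ?thesis using C by (meson less_imp_le mult_left_mono order_trans)
    qed
    from this[of s t] this[of t s] show ?thesis using that
      by (cases s t rule: linorder_cases) (auto simp: norm_minus_commute)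
  qed
  have g0: "g n 0 = x" for n using start[of n] \<tau>(1)[of n] by (simp add: g_def)
  obtain \<eta> r where r: "strict_mono (r :: nat \<Rightarrow> nat)"
    and unif: "\<And>e. 0 < e \<Longrightarrow> \<exists>N. \<forall>n t. n \<ge> N \<and> t \<in> {0..\<tau>0} \<longrightarrow> norm (g (r n) t - \<eta> t) < e"
  proof (rule Arzela_Ascoli[of "{0..\<tau>0}" g "norm x + C * sqrt (2 * M * \<tau>0)"])
    show "norm (g n t) \<le> norm x + C * sqrt (2 * M * \<tau>0)" if "t \<in> {0..\<tau>0}" for n t
    proof -
      have "norm (g n t - g n 0) \<le> C * sqrt (2 * M * \<bar>t - 0\<bar>)" by (rule hoelder) (use that in auto)
      also have "\<dots> \<le> C * sqrt (2 * M * \<tau>0)" using C M that by (intro mult_left_mono real_sqrt_le_mono) auto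
      finally show ?thesis using g0[of n] norm_triangle_sub[of "g n t" "g n 0"] by simp
    qed
    show "\<exists>d. 0 < d \<and> (\<forall>n s. s \<in> {0..\<tau>0} \<and> norm (t - s) < d \<longrightarrow> norm (g n t - g n s) < e)"
      if t: "t \<in> {0..\<tau>0}" and e: "0 < e" for t e
    proof (intro exI[of _ "(e / C)\<^sup>2 / (2 * M)"] conjI allI impI)
      show d: "0 < (e / C)\<^sup>2 / (2 * M)" using e C M by simp
      fix n s assume s: "s \<in> {0..\<tau>0} \<and> norm (t - s) < (e / C)\<^sup>2 / (2 * M)"
      have "norm (g n t - g n s) \<le> C * sqrt (2 * M * \<bar>t - s\<bar>)" by (rule hoelder) (use s t in auto)
      also have "\<dots> < C * (e / C)"
      proof (intro mult_strict_left_mono C real_less_lsqrt)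
        show "2 * M * \<bar>t - s\<bar> < (e / C)\<^sup>2" using s M by (simp add: pos_less_divide_eq mult.commute)
      qed (use e C M in auto)
      finally show "norm (g n t - g n s) < e" using C by simp
    qed
  qed (auto)
  have conv: "(\<lambda>n. g (r n) t) \<longlonglongrightarrow> \<eta> t" if "t \<in> {0..\<tau>0}" for t
    using unif that by (intro LIMSEQ_I) blast
  have \<eta>0: "\<eta> 0 = x" using LIMSEQ_unique[OF conv[of 0]] g0 \<tau>(3) by simp
  have \<tau>r: "(\<lambda>n. \<tau> (r n)) \<longlonglongrightarrow> \<tau>0" using LIMSEQ_subseq_LIMSEQ[OF \<tau>(2) r] by (simp add: o_def)
  have Ar: "(\<lambda>n. A (r n)) \<longlonglongrightarrow> \<alpha>" using LIMSEQ_subseq_LIMSEQ[OF A(3) r] by (simp add: o_def)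
  have \<eta>\<tau>: "\<eta> \<tau>0 = y"
  proof -
    have "(\<lambda>n. C * sqrt (2 * M * \<bar>\<tau>0 - \<tau> (r n)\<bar>)) \<longlonglongrightarrow> C * sqrt (2 * M * \<bar>\<tau>0 - \<tau>0\<bar>)"
      by (intro tendsto_intros \<tau>r)
    then have lim0: "(\<lambda>n. C * sqrt (2 * M * \<bar>\<tau>0 - \<tau> (r n)\<bar>)) \<longlonglongrightarrow> 0" by simp
    have "(\<lambda>n. g (r n) \<tau>0 - \<gamma> (r n) (\<tau> (r n))) \<longlonglongrightarrow> 0"
    proof (rule Lim_null_comparison[OF _ lim0], rule always_eventually, rule allI)
      fix n
      have "g (r n) (\<tau> (r n)) = \<gamma> (r n) (\<tau> (r n))" by (simp add: g_def)
      then show "norm (g (r n) \<tau>0 - \<gamma> (r n) (\<tau> (r n))) \<le> C * sqrt (2 * M * \<bar>\<tau>0 - \<tau> (r n)\<bar>)"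
        using hoelder[of "\<tau> (r n)" \<tau>0 "r n"] \<tau>(1)[of "r n"] \<tau>(3) by simp
    qed
    moreover have "(\<lambda>n. \<gamma> (r n) (\<tau> (r n))) \<longlonglongrightarrow> y" using LIMSEQ_subseq_LIMSEQ[OF final r] by (simp add: o_def)
    ultimately have "(\<lambda>n. (g (r n) \<tau>0 - \<gamma> (r n) (\<tau> (r n))) + \<gamma> (r n) (\<tau> (r n))) \<longlonglongrightarrow> 0 + y" by (rule tendsto_add)
    then have "(\<lambda>n. g (r n) \<tau>0) \<longlonglongrightarrow> y" by simp
    then show ?thesis using conv[of \<tau>0] \<tau>(3) LIMSEQ_unique by fastforce
  qed
  have \<eta>S: "\<eta> t \<in> S" if t: "t \<in> {0..\<tau>0}" for t
  proof (rule closed_sequentially[OF S(1) _ conv[OF t]])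
    show "g (r n) t \<in> S" for n unfolding g_def by (rule S(2)) (use t \<tau>(1)[of "r n"] in auto)
  qed
  define P where "P = (\<integral>\<^sup>+t\<in>{0..\<tau>0}. (potential m (\<eta> t) + ennreal h) \<partial>lebesgue)"
  have P_le: "P \<le> liminf (\<lambda>n. Pot (r n))"
  proof -
    let ?u = "\<lambda>n t. (potential m (\<gamma> (r n) t) + ennreal h) * indicator {0..\<tau> (r n)} t"
    have meas: "?u n \<in> borel_measurable lebesgue" for n
      unfolding distrib_right
      by (intro borel_measurable_add potential_measurable[OF ac less_imp_le[OF \<tau>(1)]] borel_measurable_times_ennreal
          borel_measurable_indicator borel_measurable_const) simp
    have "negligible {\<tau>0}" by simp
    then have ae: "AE t in lebesgue. t \<notin> {\<tau>0}" by (simp only: negligible_iff_null_sets AE_not_in)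
    have "P \<le> (\<integral>\<^sup>+t. liminf (\<lambda>n. ?u n t) \<partial>lebesgue)"
      unfolding P_def
    proof (rule nn_integral_mono_AE, rule AE_mp[OF ae], rule AE_I2, rule impI)
      fix t assume "t \<notin> {\<tau>0}"
      show "(potential m (\<eta> t) + ennreal h) * indicator {0..\<tau>0} t \<le> liminf (\<lambda>n. ?u n t)"
      proof (cases "t \<in> {0..\<tau>0}")
        case True
        then have t: "0 \<le> t" "t < \<tau>0" using \<open>t \<notin> {\<tau>0}\<close> by auto
        have "(\<lambda>n. potential m (g (r n) t) + ennreal h) \<longlonglongrightarrow> potential m (\<eta> t) + ennreal h"
          by (intro tendsto_add tendsto_potential conv True tendsto_const)
        moreover have "\<forall>\<^sub>F n in sequentially. potential m (g (r n) t) + ennreal h = ?u n t"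
          using order_tendstoD(1)[OF \<tau>r t(2)] t(1) by (elim eventually_mono) (simp add: g_def)
        ultimately have "(\<lambda>n. ?u n t) \<longlonglongrightarrow> potential m (\<eta> t) + ennreal h" by (rule Lim_transform_eventually)
        then have "liminf (\<lambda>n. ?u n t) = potential m (\<eta> t) + ennreal h" by (intro lim_imp_Liminf) auto
        then show ?thesis using True by simp
      qed simp
    qed
    also have "\<dots> \<le> liminf (\<lambda>n. \<integral>\<^sup>+t. ?u n t \<partial>lebesgue)" by (rule nn_integral_liminf[OF meas])
    finally show ?thesis by (simp add: Pot_def)
  qed
  have E_lim: "(\<lambda>n. E I s t (g (r n))) \<longlonglongrightarrow> E I s t \<eta>"
    if "interval_family 0 \<tau>0 I s t" for I s t
    unfolding E_def
  proof (rule tendsto_sum)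
    fix k assume "k \<in> I"
    then have k: "s k \<in> {0..\<tau>0}" "t k \<in> {0..\<tau>0}" using interval_familyD(2)[OF that, of k] by auto
    have "(\<lambda>n. mass_norm m (g (r n) (t k) - g (r n) (s k))) \<longlonglongrightarrow> mass_norm m (\<eta> (t k) - \<eta> (s k))"
      by (rule continuous_on_tendsto_compose[OF continuous_on_mass_norm[of UNIV] tendsto_diff[OF conv[OF k(2)] conv[OF k(1)]]]) auto
    then show "(\<lambda>n. (mass_norm m (g (r n) (t k) - g (r n) (s k)))\<^sup>2 / (t k - s k)) \<longlonglongrightarrow> (mass_norm m (\<eta> (t k) - \<eta> (s k)))\<^sup>2 / (t k - s k)"
      by (cases "t k = s k") (auto intro!: tendsto_intros)
  qed
  have main: "E I s t \<eta> / 2 \<le> \<alpha> \<and> P \<le> ennreal (\<alpha> - E I s t \<eta> / 2)"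
    if I: "interval_family 0 \<tau>0 I s t" for I s t
  proof
    have EK': "E I s t (g n) \<le> 2 * K n" for n using EK[of \<tau>0] I \<tau>(3) by simp
    have le: "p n \<le> A n - E I s t (g n) / 2" for n using EK'[of n] Kp[of n] by simp
    have L: "(\<lambda>n. A (r n) - E I s t (g (r n)) / 2) \<longlonglongrightarrow> \<alpha> - E I s t \<eta> / 2"
      by (intro tendsto_intros Ar E_lim I) auto
    have "0 \<le> A n - E I s t (g n) / 2" for n using le[of n] K0(2)[of n] by simp
    then have "0 \<le> \<alpha> - E I s t \<eta> / 2" by (intro LIMSEQ_le_const[OF L]) auto
    then show "E I s t \<eta> / 2 \<le> \<alpha>" by simp
    have "P \<le> liminf (\<lambda>n. Pot (r n))" by (rule P_le)
    also have "\<dots> \<le> liminf (\<lambda>n. ennreal (A (r n) - E I s t (g (r n)) / 2))"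
      unfolding Pot by (intro Liminf_mono always_eventually allI ennreal_leI le)
    also have "\<dots> = ennreal (\<alpha> - E I s t \<eta> / 2)" by (intro lim_imp_Liminf tendsto_ennrealI L) simp
    finally show "P \<le> ennreal (\<alpha> - E I s t \<eta> / 2)" .
  qed
  have \<alpha>0: "0 \<le> \<alpha>" by (intro LIMSEQ_le_const[OF A(3)]) (use A(2) in auto)
  have "P \<le> ennreal \<alpha>" using main[of "{}"] by (simp add: E_def interval_family_def disjoint_family_on_def)
  then obtain q where q: "0 \<le> q" "P = ennreal q" "q \<le> \<alpha>"
    using \<alpha>0 by (cases P) (auto simp: top_unique)
  have EB: "E I s t \<eta> \<le> 2 * (\<alpha> - q)"
    if I: "interval_family 0 \<tau>0 I s t" for I s t
  proof -
    have "E I s t \<eta> / 2 \<le> \<alpha>" "ennreal q \<le> ennreal (\<alpha> - E I s t \<eta> / 2)" using main[OF I] unfolding q(2) by auto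
    then have "q \<le> \<alpha> - E I s t \<eta> / 2" by (subst (asm) ennreal_le_iff) auto
    then show ?thesis by simp
  qed
  have ac\<eta>: "abs_continuous_on_interval 0 \<tau>0 \<eta>"
  proof (rule ac_if_energy_bounded)
    fix I :: "nat set" and s t
    assume I: "interval_family 0 \<tau>0 I s t"
    have "(\<Sum>k\<in>I. (dist (\<eta> (s k)) (\<eta> (t k)))\<^sup>2 / (t k - s k)) \<le> (\<Sum>k\<in>I. C\<^sup>2 * ((mass_norm m (\<eta> (t k) - \<eta> (s k)))\<^sup>2 / (t k - s k)))"
    proof (rule sum_mono)
      fix k assume "k \<in> I"
      have "(dist (\<eta> (s k)) (\<eta> (t k)))\<^sup>2 \<le> (C * mass_norm m (\<eta> (t k) - \<eta> (s k)))\<^sup>2"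
        using C(2)[of "\<eta> (t k) - \<eta> (s k)"] by (intro power_mono) (auto simp: dist_norm norm_minus_commute)
      then show "(dist (\<eta> (s k)) (\<eta> (t k)))\<^sup>2 / (t k - s k) \<le> C\<^sup>2 * ((mass_norm m (\<eta> (t k) - \<eta> (s k)))\<^sup>2 / (t k - s k))"
        using interval_familyD(2)[OF I \<open>k \<in> I\<close>] by (simp add: power_mult_distrib divide_right_mono)
    qed
    also have "\<dots> = C\<^sup>2 * E I s t \<eta>" by (simp add: E_def sum_distrib_left)
    also have "\<dots> \<le> C\<^sup>2 * (2 * (\<alpha> - q))" by (intro mult_left_mono EB I) auto
    finally show "(\<Sum>k\<in>I. (dist (\<eta> (s k)) (\<eta> (t k)))\<^sup>2 / (t k - s k)) \<le> C\<^sup>2 * (2 * (\<alpha> - q))" .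
  qed
  have "(\<integral>\<^sup>+t\<in>{0..\<tau>0}. kinetic m (vector_derivative \<eta> (at t within {0..\<tau>0})) \<partial>lebesgue) \<le> ennreal (\<alpha> - q)"
    by (rule kinetic_le_of_partitions[OF ac\<eta> \<tau>(3)]) (rule EB[unfolded E_def])
  then have "nn_action m h 0 \<tau>0 \<eta> \<le> ennreal (\<alpha> - q) + ennreal q"
    unfolding nn_action_eq_kinetic_plus_potential[OF ac\<eta> less_imp_le[OF \<tau>(3)]] P_def[symmetric] q(2)
    by (rule add_right_mono)
  also have "\<dots> = ennreal \<alpha>" using q by (simp add: ennreal_plus[symmetric] del: ennreal_plus)
  finally show ?thesis using ac\<eta> \<eta>0 \<eta>\<tau> \<eta>S by blast
qed

end

section \<open>Horofunctions and calibrated curves\<close>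

text \<open>A limit of differences in the extended reals that is a real number forces both terms to be
  eventually finite, because differences with an infinite term are infinite.\<close>

lemma tendsto_ereal_diff_finite:
  fixes a b :: "nat \<Rightarrow> ennreal"
  assumes "(\<lambda>n. enn2ereal (a n) - enn2ereal (b n)) \<longlonglongrightarrow> ereal l"
  shows "\<forall>\<^sub>F n in sequentially. a n < top" "\<forall>\<^sub>F n in sequentially. b n < top"
    "(\<lambda>n. enn2real (a n) - enn2real (b n)) \<longlonglongrightarrow> l"
proof -
  let ?d = "\<lambda>n. enn2ereal (a n) - enn2ereal (b n)"
  have "\<forall>\<^sub>F n in sequentially. ?d n < ereal (l + 1)" "\<forall>\<^sub>F n in sequentially. ereal (l - 1) < ?d n"
    using order_tendstoD[OF assms] by auto
  then have ev: "\<forall>\<^sub>F n in sequentially. a n < top \<and> b n < top"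
  proof eventually_elim
    case (elim n)
    have "a n \<noteq> top \<and> b n \<noteq> top"
    proof (rule ccontr)
      assume "\<not> (a n \<noteq> top \<and> b n \<noteq> top)"
      then consider "a n = top" | "b n = top" "a n \<noteq> top" by blast
      then show False
      proof cases
        case 1 then show ?thesis using elim(1) by simp
      next
        case 2
        then obtain c where "0 \<le> c" "a n = ennreal c" by (cases "a n") auto
        then show ?thesis using 2 elim(2) by simp
      qed
    qed
    then show ?case by (simp add: less_top)
  qed
  show "\<forall>\<^sub>F n in sequentially. a n < top" "\<forall>\<^sub>F n in sequentially. b n < top"
    using ev by (auto elim: eventually_mono)
  have "\<forall>\<^sub>F n in sequentially. ?d n = ereal (enn2real (a n) - enn2real (b n))"
    using ev
  proof eventually_elim
    case (elim n)
    obtain c where "0 \<le> c" "a n = ennreal c" using elim by (cases "a n") auto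
    moreover obtain d where "0 \<le> d" "b n = ennreal d" using elim by (cases "b n") auto
    ultimately show ?case by simp
  qed
  then have "(\<lambda>n. ereal (enn2real (a n) - enn2real (b n))) \<longlonglongrightarrow> ereal l"
    using assms by (simp add: tendsto_cong)
  then show "(\<lambda>n. enn2real (a n) - enn2real (b n)) \<longlonglongrightarrow> l" by simp
qed

context masses
begin

text \<open>Differences of the action potential are expressed by real numbers, and the value at the origin
  is eliminated, which leaves what the proofs use of a member of the ideal boundary.\<close>

definition horofunction_of ::
    "real \<Rightarrow> (('a::euclidean_space, 'n) config \<Rightarrow> real) \<Rightarrow> (nat \<Rightarrow> ('a, 'n) config) \<Rightarrow> bool" where
  "horofunction_of h u p \<longleftrightarrow> filterlim (\<lambda>n. mass_norm m (p n)) at_top sequentially \<and>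
     (\<forall>x. \<forall>\<^sub>F n in sequentially. phi m h x (p n) < top) \<and>
     (\<forall>x y. (\<lambda>n. enn2real (phi m h x (p n)) - enn2real (phi m h y (p n))) \<longlonglongrightarrow> u x - u y)"

lemma ideal_boundary_horofunction:
  fixes u :: "('a::euclidean_space, 'n) config \<Rightarrow> real"
  assumes h: "h \<ge> 0" and u: "u \<in> ideal_boundary m h"
  shows "\<exists>p. horofunction_of h u p"
proof -
  obtain p :: "nat \<Rightarrow> ('a, 'n) config" where p: "filterlim (\<lambda>n. mass_norm m (p n)) at_top sequentially"
    "\<And>x. (\<lambda>n. enn2ereal (phi m h x (p n)) - enn2ereal (phi m h 0 (p n))) \<longlonglongrightarrow> ereal (u x)"
    using u unfolding ideal_boundary_def action_potential_eq[OF h] by blast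
  have "(\<lambda>n. enn2real (phi m h x (p n)) - enn2real (phi m h y (p n))) \<longlonglongrightarrow> u x - u y" for x y
    using tendsto_diff[OF tendsto_ereal_diff_finite(3)[OF p(2)[of x]] tendsto_ereal_diff_finite(3)[OF p(2)[of y]]] by simp
  then show ?thesis unfolding horofunction_of_def using p(1) tendsto_ereal_diff_finite(1)[OF p(2)] by blast
qed

text \<open>The triangle inequality for the action potential survives the limit.\<close>

lemma horofunction_dominated:
  fixes u :: "('a::euclidean_space, 'n) config \<Rightarrow> real"
  assumes p: "horofunction_of h u p"
  shows "ennreal (u x - u y) \<le> phi m h x y"
proof (cases "phi m h x y")
  case (real c)
  have "\<forall>\<^sub>F n in sequentially. phi m h y (p n) < top" using p unfolding horofunction_of_def by blast
  then have "\<forall>\<^sub>F n in sequentially. enn2real (phi m h x (p n)) - enn2real (phi m h y (p n)) \<le> c"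
  proof eventually_elim
    case (elim n)
    then obtain d where d: "0 \<le> d" "phi m h y (p n) = ennreal d" by (cases "phi m h y (p n)") auto
    have "phi m h x (p n) \<le> ennreal c + ennreal d" using phi_triangle[of h x "p n" y] real d by simp
    also have "\<dots> = ennreal (c + d)" using real d by simp
    finally have "enn2real (phi m h x (p n)) \<le> c + d" using real d by (intro enn2real_leI) auto
    then show ?case using d by simp
  qed
  moreover have "(\<lambda>n. enn2real (phi m h x (p n)) - enn2real (phi m h y (p n))) \<longlonglongrightarrow> u x - u y"
    using p unfolding horofunction_of_def by blast
  ultimately have "u x - u y \<le> c" by (intro tendsto_upperbound) auto
  then show ?thesis using real by (simp add: ennreal_leI)
qed simp

text \<open>The positive energy level makes long curves expensive; it bounds the time of travel to the
  sphere.\<close>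

lemma duration_le_action:
  fixes \<gamma> :: "real \<Rightarrow> ('a::euclidean_space, 'n) config"
  assumes "0 \<le> T" "0 \<le> h"
  shows "ennreal (h * T) \<le> nn_action m h 0 T \<gamma>"
proof -
  have "ennreal (h * T) = (\<integral>\<^sup>+t. ennreal h * indicator {0..T} t \<partial>lebesgue)"
    using assms by (subst nn_integral_cmult_indicator) (auto simp: ennreal_mult)
  also have "\<dots> \<le> nn_action m h 0 T \<gamma>" unfolding nn_action_def
    by (intro nn_integral_mono mult_right_mono) (auto simp: add_increasing)
  finally show ?thesis .
qed

lemma first_exit:
  fixes f :: "real \<Rightarrow> real"
  assumes f: "continuous_on {0..T} f" "f 0 < r" "r < f T" and T: "0 \<le> T"
  shows "\<exists>\<tau>. 0 < \<tau> \<and> \<tau> < T \<and> f \<tau> = r \<and> (\<forall>t\<in>{0..\<tau>}. f t \<le> r)"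
proof -
  define Z where "Z = {t \<in> {0..T}. f t = r}"
  have "Z \<noteq> {}" using IVT'[of f 0 r T] f T by (auto simp: Z_def)
  moreover have "compact Z"
    unfolding Z_def using continuous_closed_preimage_constant[OF f(1), of r]
    by (auto simp: compact_eq_bounded_closed intro: bounded_subset[OF bounded_closed_interval])
  ultimately have "\<exists>\<tau>\<in>Z. \<forall>t\<in>Z. \<tau> \<le> t" by (intro compact_attains_inf)
  then obtain \<tau> where \<tau>: "\<tau> \<in> Z" "\<And>t. t \<in> Z \<Longrightarrow> \<tau> \<le> t" by auto
  have "f t \<le> r" if t: "t \<in> {0..\<tau>}" for t
  proof (rule ccontr)
    assume "\<not> f t \<le> r"
    then obtain s where s: "0 \<le> s" "s \<le> t" "f s = r"
      using IVT'[of f 0 r t] f(2) t \<tau>(1) continuous_on_subset[OF f(1), of "{0..t}"] by (force simp: Z_def)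
    then have "s \<in> Z" using t \<tau>(1) by (auto simp: Z_def)
    then have "s = t" using \<tau>(2) s t by force
    then show False using s \<open>\<not> f t \<le> r\<close> by simp
  qed
  moreover have "0 < \<tau>" "\<tau> < T" "f \<tau> = r"
    using \<tau>(1) f(2,3) by (auto simp: Z_def less_le)
  ultimately show ?thesis by blast
qed

lemma almost_minimizing_exit:
  fixes x p :: "('a::euclidean_space, 'n) config"
  assumes fin: "phi m h x p < top" and far: "r < mass_norm m (p - x)" and r: "0 < r" and \<epsilon>: "\<epsilon> > 0"
  shows "\<exists>\<tau> \<gamma>. 0 < \<tau> \<and> abs_continuous_on_interval 0 \<tau> \<gamma> \<and> \<gamma> 0 = x \<and> mass_norm m (\<gamma> \<tau> - x) = r \<and>
    (\<forall>t\<in>{0..\<tau>}. mass_norm m (\<gamma> t - x) \<le> r) \<and>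
    nn_action m h 0 \<tau> \<gamma> + phi m h (\<gamma> \<tau>) p \<le> phi m h x p + ennreal \<epsilon>"
proof -
  obtain T \<gamma> where g: "0 < T" "abs_continuous_on_interval 0 T \<gamma>" "\<gamma> 0 = x" "\<gamma> T = p"
    "nn_action m h 0 T \<gamma> < phi m h x p + ennreal \<epsilon>"
    using phi_less_curve[OF ennreal_less_add_epsilon[OF fin \<epsilon>]] by blast
  have "continuous_on {0..T} (\<lambda>t. mass_norm m (\<gamma> t - x))"
    by (rule continuous_on_compose2[OF continuous_on_mass_norm[of UNIV]])
       (auto intro!: continuous_intros ac_imp_continuous_on[OF g(2)])
  moreover have "mass_norm m (\<gamma> 0 - x) = 0" using g(3) mass_norm_scaleR[of 0 0] by simp
  ultimately obtain \<tau> where \<tau>: "0 < \<tau>" "\<tau> < T" "mass_norm m (\<gamma> \<tau> - x) = r" "\<forall>t\<in>{0..\<tau>}. mass_norm m (\<gamma> t - x) \<le> r"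
    using first_exit[of T "\<lambda>t. mass_norm m (\<gamma> t - x)" r] r far g by auto
  have "phi m h (\<gamma> \<tau>) p \<le> nn_action m h \<tau> T \<gamma>"
    by (rule phi_le[OF \<tau>(2) ac_subinterval[OF g(2)]]) (use \<tau> g in auto)
  then have "nn_action m h 0 \<tau> \<gamma> + phi m h (\<gamma> \<tau>) p \<le> nn_action m h 0 \<tau> \<gamma> + nn_action m h \<tau> T \<gamma>"
    by (rule add_left_mono)
  also have "\<dots> = nn_action m h 0 T \<gamma>" by (rule nn_action_split[OF g(2), symmetric]) (use \<tau> in auto)
  also have "\<dots> \<le> phi m h x p + ennreal \<epsilon>" using g(5) by simp
  finally have "nn_action m h 0 \<tau> \<gamma> + phi m h (\<gamma> \<tau>) p \<le> phi m h x p + ennreal \<epsilon>" .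
  moreover have "abs_continuous_on_interval 0 \<tau> \<gamma>" using ac_subinterval[OF g(2)] \<tau> by simp
  ultimately show ?thesis using \<tau> g(3) by blast
qed

text \<open>Almost minimizing curves from \<open>x\<close> to \<open>p\<^sub>n\<close> are cut where they first leave the ball of radius \<open>r\<close>.
  The exit points accumulate at some \<open>z\<close>, and \<open>\<phi>(y\<^sub>n, z) \<longlonglongrightarrow> 0\<close> turns almost minimality into an
  upper bound of the actions that tends to \<open>u x - u z\<close>. The exit times stay bounded because \<open>h > 0\<close>,
  and bounded away from 0 because a distance \<open>r\<close> has to be covered with bounded energy. Hence the
  pieces have a limit curve, of action at most \<open>u x - u z\<close>, and domination gives equality.\<close>

lemma calibrated_curve:
  fixes u :: "('a::euclidean_space, 'n) config \<Rightarrow> real"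
  assumes h: "h > 0" and horo: "horofunction_of h u p" and r: "0 < r"
  shows "\<exists>T \<eta>. 0 < T \<and> abs_continuous_on_interval 0 T \<eta> \<and> \<eta> 0 = x \<and> mass_norm m (\<eta> T - x) = r \<and>
    (\<forall>t\<in>{0..T}. mass_norm m (\<eta> t - x) \<le> r) \<and>
    0 \<le> u x - u (\<eta> T) \<and> nn_action m h 0 T \<eta> = ennreal (u x - u (\<eta> T))"
proof -
  have h0: "h \<ge> 0" using h by simp
  have p_far: "filterlim (\<lambda>n. mass_norm m (p n)) at_top sequentially"
    and p_fin: "\<And>x. \<forall>\<^sub>F n in sequentially. phi m h x (p n) < top"
    and p_lim: "\<And>x y. (\<lambda>n. enn2real (phi m h x (p n)) - enn2real (phi m h y (p n))) \<longlonglongrightarrow> u x - u y"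
    using horo unfolding horofunction_of_def by auto
  define Q where "Q n \<tau> \<gamma> \<longleftrightarrow> 0 < \<tau> \<and> abs_continuous_on_interval 0 \<tau> \<gamma> \<and> \<gamma> 0 = x \<and> mass_norm m (\<gamma> \<tau> - x) = r \<and>
    (\<forall>t\<in>{0..\<tau>}. mass_norm m (\<gamma> t - x) \<le> r) \<and>
    nn_action m h 0 \<tau> \<gamma> + phi m h (\<gamma> \<tau>) (p n) \<le> phi m h x (p n) + ennreal (inverse (real (Suc n)))"
    for n :: nat and \<tau> :: real and \<gamma> :: "real \<Rightarrow> ('a, 'n) config"
  have "\<forall>\<^sub>F n in sequentially. mass_norm m x + r < mass_norm m (p n)"
    using p_far by (simp add: filterlim_at_top_dense)
  with p_fin[of x] have "\<forall>\<^sub>F n in sequentially. \<exists>\<tau> \<gamma>. Q n \<tau> \<gamma>"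
  proof eventually_elim
    case (elim n)
    have "mass_norm m (p n) \<le> mass_norm m (p n - x) + mass_norm m x"
      unfolding mass_norm_eq mass_scale_diff using norm_triangle_sub[of "mass_scale m (p n)" "mass_scale m x"] by simp
    then have "r < mass_norm m (p n - x)" using elim(2) by simp
    then show ?case unfolding Q_def by (intro almost_minimizing_exit elim(1) r) auto
  qed
  then obtain N0 where "\<forall>n\<ge>N0. \<exists>\<tau> \<gamma>. Q n \<tau> \<gamma>" unfolding eventually_sequentially by blast
  then have "\<forall>n. \<exists>\<tau> \<gamma>. Q (n + N0) \<tau> \<gamma>" by simp
  then obtain \<tau> \<gamma> where "\<forall>n. Q (n + N0) (\<tau> n) (\<gamma> n)" by metis
  then have curve: "0 < \<tau> n" "abs_continuous_on_interval 0 (\<tau> n) (\<gamma> n)" "\<gamma> n 0 = x"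
      "mass_norm m (\<gamma> n (\<tau> n) - x) = r" "\<And>t. t \<in> {0..\<tau> n} \<Longrightarrow> mass_norm m (\<gamma> n t - x) \<le> r"
      "nn_action m h 0 (\<tau> n) (\<gamma> n) + phi m h (\<gamma> n (\<tau> n)) (p (n + N0)) \<le> phi m h x (p (n + N0)) + ennreal (inverse (real (Suc (n + N0))))"
      for n unfolding Q_def by auto
  define y where "y n = \<gamma> n (\<tau> n)" for n
  obtain C where C: "C > 0" "\<And>z :: ('a, 'n) config. norm z \<le> C * mass_norm m z" using norm_le_mass_norm by blast
  have "norm (y n) \<le> C * r + norm x" for n
    using C(2)[of "y n - x"] curve(4)[of n] norm_triangle_sub[of "y n" x] by (simp add: y_def)
  then have "bounded (range y)" by (auto simp: bounded_iff)
  then obtain z r1 where r1: "strict_mono r1" "(y \<circ> r1) \<longlonglongrightarrow> z" using bounded_imp_convergent_subsequence by blast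
  have y_phi: "\<forall>\<^sub>F n in sequentially. phi m h (y (r1 n)) z \<le> ennreal \<epsilon>" if \<epsilon>: "\<epsilon> > 0" for \<epsilon>
  proof -
    obtain \<delta> where \<delta>: "\<delta> > 0" "\<And>y'. norm (y' - z) < \<delta> \<Longrightarrow> phi m h y' z \<le> ennreal \<epsilon>" using phi_small[OF h0 \<epsilon>] by blast
    have "\<forall>\<^sub>F n in sequentially. dist ((y \<circ> r1) n) z < \<delta>" using r1(2) \<delta>(1) by (rule tendstoD)
    then show ?thesis by eventually_elim (use \<delta>(2) in \<open>auto simp: dist_norm\<close>)
  qed
  have sub: "filterlim (\<lambda>n. r1 n + N0) sequentially sequentially"
    by (rule filterlim_at_top_mono[OF filterlim_subseq[OF r1(1)]]) auto
  have "\<forall>\<^sub>F n in sequentially. phi m h (y (r1 n)) z \<le> ennreal 1 \<and> phi m h x (p (r1 n + N0)) < top \<and> phi m h z (p (r1 n + N0)) < top"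
    using y_phi[of 1] filterlim_iff[THEN iffD1, OF sub, rule_format, OF p_fin[of x]]
      filterlim_iff[THEN iffD1, OF sub, rule_format, OF p_fin[of z]]
    by (intro eventually_conj) simp_all
  then obtain N1 where N1: "\<And>n. n \<ge> N1 \<Longrightarrow> phi m h (y (r1 n)) z \<le> ennreal 1 \<and> phi m h x (p (r1 n + N0)) < top \<and> phi m h z (p (r1 n + N0)) < top"
    unfolding eventually_sequentially by blast
  define s where "s n = r1 (n + N1)" for n
  have s: "strict_mono s" using r1(1) by (auto simp: s_def strict_mono_def)
  have s_lim: "filterlim (\<lambda>n. s n + N0) sequentially sequentially"
    by (rule filterlim_at_top_mono[OF filterlim_subseq[OF s]]) auto
  have ys: "(\<lambda>n. y (s n)) \<longlonglongrightarrow> z" using LIMSEQ_ignore_initial_segment[OF r1(2), of N1] by (simp add: s_def o_def)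
  have fin: "phi m h (y (s n)) z < top" "phi m h x (p (s n + N0)) < top" "phi m h z (p (s n + N0)) < top" for n
    using N1[of "n + N1"] le_less_trans[OF _ ennreal_less_top, of _ 1] by (simp_all add: s_def)
  define A where "A n = (enn2real (phi m h x (p (s n + N0))) - enn2real (phi m h z (p (s n + N0)))) +
     inverse (real (Suc (s n + N0))) + enn2real (phi m h (y (s n)) z)" for n
  have action_le: "nn_action m h 0 (\<tau> (s n)) (\<gamma> (s n)) \<le> ennreal (A n) \<and> 0 \<le> A n" for n
  proof -
    let ?p = "p (s n + N0)" and ?i = "inverse (real (Suc (s n + N0)))" and ?a = "nn_action m h 0 (\<tau> (s n)) (\<gamma> (s n))"
    obtain a b c where abc: "phi m h (y (s n)) z = ennreal a" "0 \<le> a" "phi m h x ?p = ennreal b" "0 \<le> b" "phi m h z ?p = ennreal c" "0 \<le> c"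
      using fin[of n] by (metis ennreal_cases less_irrefl)
    have i: "0 \<le> ?i" by simp
    have "phi m h z ?p \<le> phi m h z (y (s n)) + phi m h (y (s n)) ?p" by (rule phi_triangle)
    then have "?a + phi m h z ?p \<le> ?a + (phi m h z (y (s n)) + phi m h (y (s n)) ?p)"
      by (rule add_left_mono)
    also have "\<dots> = (?a + phi m h (y (s n)) ?p) + phi m h z (y (s n))" by (simp only: ac_simps)
    also have "\<dots> \<le> (phi m h x ?p + ennreal ?i) + phi m h z (y (s n))"
      using curve(6)[of "s n"] unfolding y_def by (rule add_right_mono)
    also have "\<dots> = ennreal (b + ?i + a)"
      using abc i phi_commute[of h z "y (s n)"] by (simp add: ennreal_plus[symmetric] del: ennreal_plus)
    finally have le: "?a + ennreal c \<le> ennreal (b + ?i + a)" using abc by simp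
    then obtain d where d: "?a = ennreal d" "0 \<le> d" by (cases ?a) (auto simp: top_unique)
    have "d + c \<le> b + ?i + a" using le d abc i by (simp add: ennreal_plus[symmetric] del: ennreal_plus)
    then have "d \<le> A n" unfolding A_def abc using abc(2,4,6) by simp
    then show ?thesis using d by (simp add: ennreal_leI)
  qed
  have A_lim: "A \<longlonglongrightarrow> u x - u z"
  proof -
    have 1: "(\<lambda>n. enn2real (phi m h x (p (s n + N0))) - enn2real (phi m h z (p (s n + N0)))) \<longlonglongrightarrow> u x - u z"
      by (rule filterlim_compose[OF p_lim s_lim])
    have 2: "(\<lambda>n. inverse (real (Suc (s n + N0)))) \<longlonglongrightarrow> 0"
      by (rule filterlim_compose[OF LIMSEQ_inverse_real_of_nat s_lim])
    have 3: "(\<lambda>n. enn2real (phi m h (y (s n)) z)) \<longlonglongrightarrow> 0"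
    proof (rule tendstoI)
      fix e :: real assume e: "e > 0"
      then have e2: "e / 2 > 0" by simp
      have "filterlim (\<lambda>n. n + N1) sequentially sequentially" by (rule filterlim_add_const_nat_at_top)
      then have "\<forall>\<^sub>F n in sequentially. phi m h (y (s n)) z \<le> ennreal (e/2)"
        using y_phi[OF e2] unfolding s_def filterlim_iff by blast
      then show "\<forall>\<^sub>F n in sequentially. dist (enn2real (phi m h (y (s n)) z)) 0 < e"
      proof eventually_elim
        case (elim n)
        then have "enn2real (phi m h (y (s n)) z) \<le> e / 2" using e by (intro enn2real_leI) auto
        then show ?case using e by (simp add: dist_real_def)
      qed
    qed
    show ?thesis unfolding A_def using tendsto_add[OF tendsto_add[OF 1 2] 3] by simp
  qed
  have "Bseq A" using A_lim convergentI convergent_imp_Bseq by blast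
  then obtain M where M: "M > 0" "\<And>n. norm (A n) \<le> M" using BseqE by blast
  have AM: "A n \<le> M" for n using M(2)[of n] by simp
  have upper: "\<tau> (s n) \<le> M / h" for n
  proof -
    have "ennreal (h * \<tau> (s n)) \<le> ennreal (A n)"
      using duration_le_action[OF less_imp_le[OF curve(1)] h0] action_le[of n] by (meson order_trans)
    then have "h * \<tau> (s n) \<le> M" using action_le[of n] AM[of n] by (simp add: ennreal_le_iff)
    then show ?thesis using h by (simp add: pos_le_divide_eq mult.commute)
  qed
  have lower: "r\<^sup>2 / (2 * M) \<le> \<tau> (s n)" for n
  proof -
    have ac: "abs_continuous_on_interval 0 (\<tau> (s n)) (\<gamma> (s n))" and t0: "0 \<le> \<tau> (s n)"
      using curve(1,2)[of "s n"] by simp_all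
    have "(\<integral>\<^sup>+t\<in>{0..\<tau> (s n)}. kinetic m (vector_derivative (\<gamma> (s n)) (at t within {0..\<tau> (s n)})) \<partial>lebesgue) \<le>
        nn_action m h 0 (\<tau> (s n)) (\<gamma> (s n))"
      unfolding nn_action_eq_kinetic_plus_potential[OF ac t0] by simp
    also have "\<dots> \<le> ennreal M" using action_le[of n] AM[of n] by (meson ennreal_leI order_trans)
    finally have "(mass_norm m (\<gamma> (s n) (\<tau> (s n)) - \<gamma> (s n) 0))\<^sup>2 \<le> 2 * (\<tau> (s n) - 0) * M"
      using M(1) t0 by (intro displacement_square_le[OF ac t0]) auto
    then have "r\<^sup>2 \<le> 2 * \<tau> (s n) * M" using curve(3,4)[of "s n"] by simp
    then show ?thesis using M(1) by (simp add: pos_divide_le_eq mult.commute mult.left_commute)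
  qed
  have "bounded (range (\<lambda>n. \<tau> (s n)))"
    using upper curve(1) by (intro boundedI[where B = "M / h"]) (auto simp: less_imp_le)
  then obtain T r2 where r2: "strict_mono r2" "((\<lambda>n. \<tau> (s n)) \<circ> r2) \<longlonglongrightarrow> T"
    using bounded_imp_convergent_subsequence by blast
  have "r\<^sup>2 / (2 * M) \<le> T" using LIMSEQ_le_const[OF r2(2)] lower by auto
  moreover have "0 < r\<^sup>2 / (2 * M)" using r M(1) by simp
  ultimately have T: "0 < T" by simp
  let ?k = "\<lambda>n. s (r2 n)"
  have "closed {w. mass_norm m (w - x) \<le> r}"
    by (intro closed_Collect_le continuous_on_compose2[OF continuous_on_mass_norm[of UNIV]] continuous_intros) auto
  then have "\<exists>\<eta>. abs_continuous_on_interval 0 T \<eta> \<and> \<eta> 0 = x \<and> \<eta> T = z \<and>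
    nn_action m h 0 T \<eta> \<le> ennreal (u x - u z) \<and> (\<forall>t\<in>{0..T}. \<eta> t \<in> {w. mass_norm m (w - x) \<le> r})"
  proof (rule action_limit_curve[where \<tau> = "\<lambda>n. \<tau> (?k n)" and \<gamma> = "\<lambda>n. \<gamma> (?k n)" and A = "\<lambda>n. A (r2 n)", OF h0, rotated 6])
    show "0 < \<tau> (?k n)" "abs_continuous_on_interval 0 (\<tau> (?k n)) (\<gamma> (?k n))" "\<gamma> (?k n) 0 = x" for n
      using curve by auto
    show "(\<lambda>n. \<tau> (?k n)) \<longlonglongrightarrow> T" using r2(2) by (simp add: o_def)
    show "(\<lambda>n. \<gamma> (?k n) (\<tau> (?k n))) \<longlonglongrightarrow> z" using LIMSEQ_subseq_LIMSEQ[OF ys r2(1)] by (simp add: o_def y_def)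
    show "\<gamma> (?k n) t \<in> {w. mass_norm m (w - x) \<le> r}" if "t \<in> {0..\<tau> (?k n)}" for n t using curve(5)[OF that] by simp
    show "nn_action m h 0 (\<tau> (?k n)) (\<gamma> (?k n)) \<le> ennreal (A (r2 n))" "0 \<le> A (r2 n)" for n using action_le by auto
    show "(\<lambda>n. A (r2 n)) \<longlonglongrightarrow> u x - u z" using LIMSEQ_subseq_LIMSEQ[OF A_lim r2(1)] by (simp add: o_def)
  qed (rule T)
  then obtain \<eta> where \<eta>: "abs_continuous_on_interval 0 T \<eta>" "\<eta> 0 = x" "\<eta> T = z"
    "nn_action m h 0 T \<eta> \<le> ennreal (u x - u z)" "\<forall>t\<in>{0..T}. mass_norm m (\<eta> t - x) \<le> r" by auto
  have "ennreal (u x - u z) \<le> phi m h x z" by (rule horofunction_dominated[OF horo])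
  also have "\<dots> \<le> nn_action m h 0 T \<eta>" by (rule phi_le[OF T \<eta>(1,2,3)])
  finally have "nn_action m h 0 T \<eta> = ennreal (u x - u z)" using \<eta>(4) by simp
  moreover have "0 \<le> u x - u z" by (rule LIMSEQ_le_const[OF A_lim]) (use action_le in auto)
  moreover have "mass_norm m (z - x) = r"
  proof -
    have "(\<lambda>n. mass_norm m (y (s n) - x)) \<longlonglongrightarrow> mass_norm m (z - x)"
      by (rule continuous_on_tendsto_compose[OF continuous_on_mass_norm[of UNIV] tendsto_diff[OF ys tendsto_const]]) auto
    then show ?thesis using curve(4) LIMSEQ_unique[OF _ tendsto_const] by (simp add: y_def)
  qed
  ultimately show ?thesis using T \<eta> by blast
qed

end

section \<open>Viscosity solutions\<close>

lemma blinfun_component_sum: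
  fixes q :: "('a::euclidean_space, 'n::finite) config \<Rightarrow>\<^sub>L real"
  shows "blinfun_apply q v = (\<Sum>i\<in>UNIV. blinfun_apply q (axis i (v $ i)))"
proof -
  have "v = (\<Sum>i\<in>UNIV. axis i (v $ i))"
    by (simp add: vec_eq_iff axis_def if_distrib[of "\<lambda>z. z $ _"] sum.delta cong: if_cong)
  then have "blinfun_apply q v = blinfun_apply q (\<Sum>i\<in>UNIV. axis i (v $ i))" by simp
  then show ?thesis by (simp add: blinfun.sum_right)
qed

lemma bounded_linear_blinfun_axis:
  fixes q :: "('a::euclidean_space, 'n::finite) config \<Rightarrow>\<^sub>L real"
  shows "bounded_linear (\<lambda>v. blinfun_apply q (axis i v))"
proof -
  have "linear (axis i :: 'a \<Rightarrow> ('a, 'n) config)" by (rule linearI) (auto simp: vec_eq_iff axis_def)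
  then have "bounded_linear (axis i :: 'a \<Rightarrow> ('a, 'n) config)" by (simp add: linear_conv_bounded_linear)
  then show ?thesis by (rule bounded_linear_compose[OF blinfun.bounded_linear_right])
qed

lemma functional_representation:
  fixes f :: "'a::euclidean_space \<Rightarrow> real"
  assumes f: "bounded_linear f"
  shows "\<exists>w. (\<forall>v. f v = w \<bullet> v) \<and> onorm f = norm w"
proof -
  define w where "w = (\<Sum>b\<in>Basis. f b *\<^sub>R b)"
  have rep: "f v = w \<bullet> v" for v
  proof -
    interpret bounded_linear f by fact
    have "f v = f (\<Sum>b\<in>Basis. (v \<bullet> b) *\<^sub>R b)" by (simp only: euclidean_representation)
    also have "\<dots> = (\<Sum>b\<in>Basis. (v \<bullet> b) * f b)" by (simp add: sum scaleR)
    also have "\<dots> = w \<bullet> v" unfolding w_def by (simp add: inner_sum_left inner_commute[of v] mult.commute)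
    finally show ?thesis .
  qed
  have "onorm f = norm w"
  proof (rule antisym)
    show "onorm f \<le> norm w" by (rule onorm_bound) (auto simp: rep Cauchy_Schwarz_ineq2)
    have "norm (f w) \<le> onorm f * norm w" by (rule onorm[OF f])
    then have "norm w * norm w \<le> onorm f * norm w"
      by (simp add: rep power2_norm_eq_inner[symmetric] power2_eq_square)
    then show "norm w \<le> onorm f" using onorm_pos_le[OF f] by (cases "w = 0") auto
  qed
  then show ?thesis using rep by blast
qed

context masses
begin

lemma dual_mass_norm_nonneg: "0 \<le> dual_mass_norm m q"
  unfolding dual_mass_norm_def using mass_pos by (intro real_sqrt_ge_zero sum_nonneg) (auto simp: less_imp_le)

lemma mass_norm_square: "(mass_norm m v)\<^sup>2 = (\<Sum>i\<in>UNIV. m i * (norm (v $ i))\<^sup>2)"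
  for v :: "('a::euclidean_space, 'n) config"
  unfolding mass_norm_def mass_inner_def power2_norm_eq_inner
  using mass_pos by (intro real_sqrt_pow2 sum_nonneg) (auto simp: less_imp_le)

lemma dual_mass_norm_square:
  "(dual_mass_norm m q)\<^sup>2 = (\<Sum>i\<in>UNIV. inverse (m i) * (onorm (\<lambda>v. blinfun_apply q (axis i v)))\<^sup>2)"
  unfolding dual_mass_norm_def using mass_pos by (intro real_sqrt_pow2 sum_nonneg) (auto simp: less_imp_le)

lemma dual_mass_norm_le:
  fixes q :: "('a::euclidean_space, 'n) config \<Rightarrow>\<^sub>L real"
  shows "blinfun_apply q v \<le> dual_mass_norm m q * mass_norm m v"
proof -
  let ?o = "\<lambda>i. onorm (\<lambda>v. blinfun_apply q (axis i v))"
  have pos: "0 < sqrt (m i)" for i using mass_pos by simp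
  have "blinfun_apply q v \<le> (\<Sum>i\<in>UNIV. (?o i / sqrt (m i)) * (sqrt (m i) * norm (v $ i)))"
    unfolding blinfun_component_sum[of q v]
  proof (rule sum_mono)
    fix i
    have "blinfun_apply q (axis i (v $ i)) \<le> ?o i * norm (v $ i)"
      using onorm[OF bounded_linear_blinfun_axis[of q i], of "v $ i"] by simp
    also have "\<dots> = (?o i / sqrt (m i)) * (sqrt (m i) * norm (v $ i))" using pos[of i] by simp
    finally show "blinfun_apply q (axis i (v $ i)) \<le> (?o i / sqrt (m i)) * (sqrt (m i) * norm (v $ i))" .
  qed
  also have "\<dots> \<le> dual_mass_norm m q * mass_norm m v"
  proof (rule power2_le_imp_le)
    have "(\<Sum>i\<in>UNIV. (?o i / sqrt (m i)) * (sqrt (m i) * norm (v $ i)))\<^sup>2 \<le>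
        (\<Sum>i\<in>UNIV. (?o i / sqrt (m i))\<^sup>2) * (\<Sum>i\<in>UNIV. (sqrt (m i) * norm (v $ i))\<^sup>2)"
      by (rule Cauchy_Schwarz_ineq_sum)
    also have "(\<Sum>i\<in>UNIV. (?o i / sqrt (m i))\<^sup>2) = (dual_mass_norm m q)\<^sup>2"
      unfolding dual_mass_norm_square using mass_pos
      by (intro sum.cong refl) (simp add: power_mult_distrib power_inverse less_imp_le divide_inverse mult.commute)
    also have "(\<Sum>i\<in>UNIV. (sqrt (m i) * norm (v $ i))\<^sup>2) = (mass_norm m v)\<^sup>2"
      unfolding mass_norm_square using mass_pos by (intro sum.cong refl) (simp add: power_mult_distrib less_imp_le)
    finally show "(\<Sum>i\<in>UNIV. (?o i / sqrt (m i)) * (sqrt (m i) * norm (v $ i)))\<^sup>2 \<le> (dual_mass_norm m q * mass_norm m v)\<^sup>2"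
      by (simp add: power_mult_distrib)
    show "0 \<le> dual_mass_norm m q * mass_norm m v" by (intro mult_nonneg_nonneg dual_mass_norm_nonneg mass_norm_nonneg)
  qed
  finally show ?thesis .
qed

text \<open>The equality case of the duality between the mass norm and its dual: the components of \<open>v\<close> are
  the gradients of \<open>q\<close> divided by the masses.\<close>

lemma dual_mass_norm_attained:
  fixes q :: "('a::euclidean_space, 'n) config \<Rightarrow>\<^sub>L real"
  shows "\<exists>v. blinfun_apply q v = (dual_mass_norm m q)\<^sup>2 \<and> (mass_norm m v)\<^sup>2 = (dual_mass_norm m q)\<^sup>2"
proof -
  have "\<forall>i. \<exists>w. (\<forall>v. blinfun_apply q (axis i v) = w \<bullet> v) \<and> onorm (\<lambda>v. blinfun_apply q (axis i v)) = norm w"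
    using functional_representation[OF bounded_linear_blinfun_axis] by blast
  then obtain w where w: "\<And>i v. blinfun_apply q (axis i v) = w i \<bullet> v"
    "\<And>i. onorm (\<lambda>v. blinfun_apply q (axis i v)) = norm (w i)" by metis
  define v where "v = (\<chi> i. inverse (m i) *\<^sub>R w i)"
  have d: "(dual_mass_norm m q)\<^sup>2 = (\<Sum>i\<in>UNIV. inverse (m i) * (norm (w i))\<^sup>2)"
    unfolding dual_mass_norm_square w(2) ..
  have "blinfun_apply q v = (\<Sum>i\<in>UNIV. w i \<bullet> v $ i)" using blinfun_component_sum[of q v] by (simp only: w(1))
  then have "blinfun_apply q v = (dual_mass_norm m q)\<^sup>2" by (simp add: d v_def power2_norm_eq_inner)
  moreover have "m i * (norm (inverse (m i) *\<^sub>R w i))\<^sup>2 = inverse (m i) * (norm (w i))\<^sup>2" for i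
    using mass_pos[of i] by (simp add: power_mult_distrib power2_eq_square[of "inverse (m i)"])
  then have "(mass_norm m v)\<^sup>2 = (dual_mass_norm m q)\<^sup>2"
    unfolding mass_norm_square d v_def by simp
  ultimately show ?thesis by blast
qed

lemma hamiltonian_eq: "hamiltonian m x q = ereal ((dual_mass_norm m q)\<^sup>2 / 2) - enn2ereal (potential m x)"
  unfolding hamiltonian_def newton_potential_eq ..

text \<open>Domination bounds the increments of \<open>u\<close> along short straight lines by their action. At a
  collision the Hamiltonian is \<open>-\<infinity>\<close> and there is nothing to show.\<close>

lemma horofunction_subsolution:
  fixes u :: "('a::euclidean_space, 'n) config \<Rightarrow> real"
  assumes h: "h > 0" and horo: "horofunction_of h u p" and cont: "continuous_on UNIV u"
  shows "viscosity_subsolution m h u"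
  unfolding viscosity_subsolution_def
proof (intro conjI allI impI cont)
  fix \<psi> d\<psi> x0
  assume C1: "C1_with_differential \<psi> d\<psi>" and max: "\<forall>\<^sub>F x in nhds x0. u x - \<psi> x \<le> u x0 - \<psi> x0"
  show "hamiltonian m x0 (d\<psi> x0) \<le> ereal h"
  proof (cases "potential m x0")
    case top then show ?thesis by (simp add: hamiltonian_eq)
  next
    case (real U)
    let ?q = "d\<psi> x0"
    obtain v where v: "blinfun_apply ?q v = (dual_mass_norm m ?q)\<^sup>2" "(mass_norm m v)\<^sup>2 = (dual_mass_norm m ?q)\<^sup>2"
      using dual_mass_norm_attained by blast
    let ?d2 = "(dual_mass_norm m ?q)\<^sup>2"
    have small: "?d2 / 2 - U - h \<le> \<epsilon> * (1 + norm v)" if \<epsilon>: "\<epsilon> > 0" for \<epsilon>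
    proof -
      have der: "(\<psi> has_derivative blinfun_apply ?q) (at x0)" using C1 by (simp add: C1_with_differential_def)
      obtain d1 where d1: "d1 > 0" "\<And>y. norm (y - x0) < d1 \<Longrightarrow> norm (\<psi> y - \<psi> x0 - blinfun_apply ?q (y - x0)) \<le> \<epsilon> * norm (y - x0)"
        using der \<epsilon> unfolding has_derivative_at_alt by blast
      obtain d2 where d2: "d2 > 0" "\<And>y. dist y x0 < d2 \<Longrightarrow> u y - \<psi> y \<le> u x0 - \<psi> x0"
        using max unfolding eventually_nhds_metric by blast
      have "(potential m \<longlongrightarrow> potential m x0) (nhds x0)" by (rule tendsto_potential) (rule filterlim_ident)
      moreover have "potential m x0 < ennreal (U + \<epsilon>)" using real \<epsilon> by (simp add: ennreal_lessI)
      ultimately have "\<forall>\<^sub>F y in nhds x0. potential m y < ennreal (U + \<epsilon>)" by (rule order_tendstoD)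
      then obtain d3 where d3: "d3 > 0" "\<And>y. dist y x0 < d3 \<Longrightarrow> potential m y < ennreal (U + \<epsilon>)"
        unfolding eventually_nhds_metric by blast
      define s where "s = min d1 (min d2 d3) / (norm v + 1)"
      have nv: "0 < norm v + 1" by (simp add: add_nonneg_pos)
      have s: "0 < s" using d1 d2 d3 nv by (simp add: s_def)
      have sv: "s * norm v < min d1 (min d2 d3)"
      proof -
        have "s * norm v < s * (norm v + 1)" using s by simp
        also have "\<dots> = min d1 (min d2 d3)" using nv by (simp add: s_def)
        finally show ?thesis .
      qed
      define y where "y = x0 + s *\<^sub>R (- v)"
      have yx: "y - x0 = - (s *\<^sub>R v)" "norm (y - x0) = s * norm v" using s by (simp_all add: y_def)
      have "phi m h x0 y \<le> ennreal (s * ((mass_norm m (- v))\<^sup>2 / 2 + (U + \<epsilon>) + h))"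
        unfolding y_def
      proof (rule line_action[OF s])
        fix t assume t: "t \<in> {0..s}"
        have "dist (x0 + t *\<^sub>R (- v)) x0 = t * norm v" using t by (simp add: dist_norm)
        also have "\<dots> \<le> s * norm v" using t by (intro mult_right_mono) auto
        also have "\<dots> < d3" using sv by simp
        finally show "potential m (x0 + t *\<^sub>R (- v)) \<le> ennreal (U + \<epsilon>)" using d3(2) by (simp add: less_imp_le)
      qed (use h real \<epsilon> in auto)
      then have "ennreal (u x0 - u y) \<le> ennreal (s * (?d2 / 2 + (U + \<epsilon>) + h))"
        using horofunction_dominated[OF horo, of x0 y] v(2) by (simp add: mass_norm_minus)
      moreover have "0 \<le> s * (?d2 / 2 + (U + \<epsilon>) + h)" using s h real \<epsilon> by simp
      ultimately have A: "u x0 - u y \<le> s * (?d2 / 2 + (U + \<epsilon>) + h)" by (simp add: ennreal_le_iff)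
      have B: "\<psi> x0 - \<psi> y \<le> u x0 - u y" using d2(2)[of y] sv unfolding dist_norm yx(2) by simp
      have "norm (\<psi> y - \<psi> x0 - blinfun_apply ?q (y - x0)) \<le> \<epsilon> * (s * norm v)" using d1(2)[of y] sv unfolding yx(2) by simp
      moreover have "blinfun_apply ?q (y - x0) = - (s * ?d2)" using v(1) by (simp add: yx(1) blinfun.minus_right blinfun.scaleR_right)
      ultimately have "s * ?d2 - \<epsilon> * (s * norm v) \<le> \<psi> x0 - \<psi> y" by (simp add: abs_le_iff)
      then have "s * (?d2 - \<epsilon> * norm v) \<le> s * (?d2 / 2 + (U + \<epsilon>) + h)" using A B by (simp add: algebra_simps)
      then have "?d2 - \<epsilon> * norm v \<le> ?d2 / 2 + (U + \<epsilon>) + h" using s by simp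
      then show ?thesis by (simp add: algebra_simps)
    qed
    have "?d2 / 2 - U - h \<le> 0"
    proof (rule ccontr)
      assume "\<not> ?d2 / 2 - U - h \<le> 0"
      then have g: "0 < ?d2 / 2 - U - h" by simp
      have nv: "0 < 1 + norm v" by (simp add: add_pos_nonneg)
      have "?d2 / 2 - U - h \<le> ((?d2 / 2 - U - h) / (2 * (1 + norm v))) * (1 + norm v)"
        using g nv by (intro small) simp
      also have "\<dots> = (?d2 / 2 - U - h) / 2" using nv by (simp add: field_simps)
      finally show False using g by simp
    qed
    then show ?thesis using real by (simp add: hamiltonian_eq)
  qed
qed

text \<open>Suppose that \<open>\<parallel>d\<psi>\<parallel>\<^sup>2 / 2 < b < U + h\<close> at \<open>x\<^sub>0\<close>, hence \<open>b < U + h\<close> nearby; the potential may be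
  infinite. Along a calibrated curve that ends at distance \<open>\<rho>\<close> from \<open>x\<^sub>0\<close> the function \<open>u\<close> changes by at
  least \<open>\<surd>(2 b) \<rho>\<close>, more than the test function can for small \<open>\<rho>\<close>.\<close>

lemma horofunction_supersolution:
  fixes u :: "('a::euclidean_space, 'n) config \<Rightarrow> real"
  assumes h: "h > 0" and horo: "horofunction_of h u p" and cont: "continuous_on UNIV u"
  shows "viscosity_supersolution m h u"
  unfolding viscosity_supersolution_def
proof (intro conjI allI impI cont)
  fix \<psi> d\<psi> x0
  assume C1: "C1_with_differential \<psi> d\<psi>" and min: "\<forall>\<^sub>F x in nhds x0. u x - \<psi> x \<ge> u x0 - \<psi> x0"
  let ?q = "d\<psi> x0"
  let ?d = "dual_mass_norm m ?q"
  show "ereal h \<le> hamiltonian m x0 ?q"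
  proof (rule ccontr)
    assume neg: "\<not> ereal h \<le> hamiltonian m x0 ?q"
    have lt: "ennreal (?d\<^sup>2 / 2) < potential m x0 + ennreal h"
    proof (cases "potential m x0")
      case (real U)
      then have "?d\<^sup>2 / 2 < U + h" using neg by (simp add: hamiltonian_eq)
      moreover have "potential m x0 + ennreal h = ennreal (U + h)" using real h by simp
      ultimately show ?thesis using real h by (simp add: ennreal_lessI del: ennreal_plus)
    qed simp
    obtain b' where b': "ennreal (?d\<^sup>2 / 2) < b'" "b' < potential m x0 + ennreal h" using dense[OF lt] by blast
    then obtain b where b: "0 \<le> b" "b' = ennreal b" by (cases b') auto
    have db: "?d\<^sup>2 / 2 < b" using b'(1) b by (simp add: ennreal_less_iff)
    have d_less: "?d < sqrt (2 * b)" using db by (intro real_less_rsqrt) simp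
    obtain C where C: "C > 0" "\<And>z :: ('a, 'n) config. norm z \<le> C * mass_norm m z" using norm_le_mass_norm by blast
    define \<epsilon> where "\<epsilon> = (sqrt (2 * b) - ?d) / (2 * C)"
    have \<epsilon>: "0 < \<epsilon>" using d_less C by (simp add: \<epsilon>_def)
    have half: "a + (c - a) / 2 < c" if "a < c" for a c :: real using that by (simp add: field_simps)
    have "\<epsilon> * C = (sqrt (2 * b) - ?d) / 2" using C(1) by (simp add: \<epsilon>_def)
    then have eC: "?d + \<epsilon> * C < sqrt (2 * b)" using half[OF d_less] by (simp only:)
    have der: "(\<psi> has_derivative blinfun_apply ?q) (at x0)" using C1 by (simp add: C1_with_differential_def)
    obtain d1 where d1: "d1 > 0" "\<And>y. norm (y - x0) < d1 \<Longrightarrow> norm (\<psi> y - \<psi> x0 - blinfun_apply ?q (y - x0)) \<le> \<epsilon> * norm (y - x0)"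
      using der \<epsilon> unfolding has_derivative_at_alt by blast
    obtain d2 where d2: "d2 > 0" "\<And>y. dist y x0 < d2 \<Longrightarrow> u y - \<psi> y \<ge> u x0 - \<psi> x0"
      using min unfolding eventually_nhds_metric by blast
    have "((\<lambda>y. potential m y + ennreal h) \<longlongrightarrow> potential m x0 + ennreal h) (nhds x0)"
      by (intro tendsto_add tendsto_const tendsto_potential filterlim_ident)
    then have "\<forall>\<^sub>F y in nhds x0. ennreal b < potential m y + ennreal h" using b'(2) unfolding b(2) by (rule order_tendstoD)
    then obtain d3 where d3: "d3 > 0" "\<And>y. dist y x0 < d3 \<Longrightarrow> ennreal b < potential m y + ennreal h"
      unfolding eventually_nhds_metric by blast
    define \<rho> where "\<rho> = min d1 (min d2 d3) / (2 * C)"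
    have \<rho>: "\<rho> > 0" using d1 d2 d3 C by (simp add: \<rho>_def)
    have near: "norm (y - x0) < min d1 (min d2 d3)" if "mass_norm m (y - x0) \<le> \<rho>" for y
    proof -
      have "norm (y - x0) \<le> C * mass_norm m (y - x0)" by (rule C)
      also have "\<dots> \<le> C * \<rho>" using that C by (intro mult_left_mono) auto
      also have "\<dots> = min d1 (min d2 d3) / 2" using C by (simp add: \<rho>_def)
      also have "\<dots> < min d1 (min d2 d3)" using d1 d2 d3 by (auto simp: min_def)
      finally show ?thesis .
    qed
    obtain T \<eta> where \<eta>: "0 < T" "abs_continuous_on_interval 0 T \<eta>" "\<eta> 0 = x0" "mass_norm m (\<eta> T - x0) = \<rho>"
      "\<forall>t\<in>{0..T}. mass_norm m (\<eta> t - x0) \<le> \<rho>" "0 \<le> u x0 - u (\<eta> T)" "nn_action m h 0 T \<eta> = ennreal (u x0 - u (\<eta> T))"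
      using calibrated_curve[OF h horo \<rho>, of x0] by blast
    let ?y = "\<eta> T"
    have "ennreal (sqrt (2 * b) * mass_norm m (\<eta> T - \<eta> 0)) \<le>
        (\<integral>\<^sup>+t\<in>{0..T}. (kinetic m (vector_derivative \<eta> (at t within {0..T})) + ennreal b) \<partial>lebesgue)"
      by (rule displacement_le_energy[OF \<eta>(2)]) (use \<eta>(1) b in auto)
    also have "\<dots> \<le> nn_action m h 0 T \<eta>" unfolding nn_action_def
    proof (rule nn_integral_mono)
      fix t
      show "(kinetic m (vector_derivative \<eta> (at t within {0..T})) + ennreal b) * indicator {0..T} t
        \<le> (kinetic m (vector_derivative \<eta> (at t within {0..T})) + potential m (\<eta> t) + ennreal h) * indicator {0..T} t"
      proof (cases "t \<in> {0..T}")
        case True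
        then have "dist (\<eta> t) x0 < d3" using near[of "\<eta> t"] \<eta>(5) by (simp add: dist_norm)
        then have "ennreal b \<le> potential m (\<eta> t) + ennreal h" using d3(2) by (simp add: less_imp_le)
        then show ?thesis unfolding add.assoc by (intro mult_right_mono add_left_mono) auto
      qed simp
    qed
    also have "\<dots> = ennreal (u x0 - u ?y)" by (rule \<eta>(7))
    finally have "sqrt (2 * b) * \<rho> \<le> u x0 - u ?y" using \<eta>(3,4,6) by (simp add: ennreal_le_iff)
    also have "\<dots> \<le> \<psi> x0 - \<psi> ?y" using d2(2)[of ?y] near[of ?y] \<eta>(4) by (simp add: dist_norm)
    also have "\<dots> \<le> blinfun_apply ?q (x0 - ?y) + \<epsilon> * norm (?y - x0)"
    proof -
      have "norm (\<psi> ?y - \<psi> x0 - blinfun_apply ?q (?y - x0)) \<le> \<epsilon> * norm (?y - x0)"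
        using d1(2)[of ?y] near[of ?y] \<eta>(4) by simp
      moreover have "blinfun_apply ?q (x0 - ?y) = - blinfun_apply ?q (?y - x0)"
        by (simp add: blinfun.diff_right)
      ultimately show ?thesis by (simp add: abs_le_iff)
    qed
    also have "\<dots> \<le> ?d * \<rho> + \<epsilon> * (C * \<rho>)"
    proof (intro add_mono mult_left_mono)
      show "blinfun_apply ?q (x0 - ?y) \<le> ?d * \<rho>"
        using dual_mass_norm_le[of ?q "x0 - ?y"] \<eta>(4) by (simp add: mass_norm_minus_commute)
      show "norm (?y - x0) \<le> C * \<rho>" using C(2)[of "?y - x0"] \<eta>(4) by simp
    qed (use \<epsilon> in simp)
    finally have "sqrt (2 * b) * \<rho> \<le> (?d + \<epsilon> * C) * \<rho>" by (simp add: algebra_simps)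
    then have "sqrt (2 * b) \<le> ?d + \<epsilon> * C" using \<rho> by (rule mult_right_le_imp_le)
    then show False using eC by simp
  qed
qed

end

theorem theorem3p1:
  fixes m :: "'n::{finite,linorder} \<Rightarrow> real"
    and h :: real
    and u :: "('a::euclidean_space, 'n) config \<Rightarrow> real"
  assumes "CARD('n) \<ge> 2"
    and "DIM('a) \<ge> 2"
    and "\<And>i. m i > 0"
    and "h > 0"
    and "u \<in> ideal_boundary m h"
  shows "(\<forall>r>0. \<forall>x. \<exists>y. mass_norm m (y - x) = r \<and>
            (\<exists>\<gamma>\<in>curves y x. ereal (u x - u y) = action m h \<gamma>)) \<and>
         viscosity_solution m h u"
proof -
  interpret masses m using assms(3) by unfold_locales
  have h0: "h \<ge> 0" using assms(4) by simp
  obtain p where horo: "horofunction_of h u p" using ideal_boundary_horofunction[OF h0 assms(5)] by blast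
  have cont: "continuous_on UNIV u" using assms(5) by (simp add: ideal_boundary_def)
  have "\<exists>y. mass_norm m (y - x) = r \<and> (\<exists>\<gamma>\<in>curves y x. ereal (u x - u y) = action m h \<gamma>)" if r: "r > 0" for r x
  proof -
    obtain T \<eta> where \<eta>: "0 < T" "abs_continuous_on_interval 0 T \<eta>" "\<eta> 0 = x" "mass_norm m (\<eta> T - x) = r"
      "0 \<le> u x - u (\<eta> T)" "nn_action m h 0 T \<eta> = ennreal (u x - u (\<eta> T))"
      using calibrated_curve[OF assms(4) horo r, of x] by blast
    let ?\<gamma> = "(0, T, \<lambda>t. \<eta> (- 1 * t + T))"
    have "?\<gamma> \<in> curves (\<eta> T) x" using \<eta> reverse_curve(1)[OF \<eta>(1,2)] by (simp add: curves_def)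
    moreover have "ereal (u x - u (\<eta> T)) = action m h ?\<gamma>"
      using \<eta>(5,6) reverse_curve(2)[OF \<eta>(1,2), of h] by (simp add: action_eq[OF h0])
    ultimately show ?thesis using \<eta>(4) by blast
  qed
  moreover have "viscosity_solution m h u"
    unfolding viscosity_solution_def
    using horofunction_subsolution[OF assms(4) horo cont] horofunction_supersolution[OF assms(4) horo cont] by blast
  ultimately show ?thesis by blast
qed

end
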